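(* Let $0<s<1$ and $a=1-2s$. Given $u\in\mathscr S(\mathbb R^n)$, let $$U(x,z)=\int_{\mathbb R^n}K^{(a)}_z(x,y)\,u(y)\,dy,\qquad x\in\mathbb R^n,\ z>0.$$ Then one has in $L^2(\mathbb R^n)$ $$-\frac{2^{-a}\,\Gamma\left(\frac{1-a}2\right)}{\Gamma\left(\frac{1+a}2\right)}\lim_{z\to0^+}z^a\,\partial_zU(x,z)=(-\mathscr L)^su(x).$$
   Context: Let $n\ge3$ and let $\mathscr X=\{X_1,\dots,X_m\}$ be $C^\infty$ vector fields on $\mathbb R^n$ satisfying Hörmander's finite rank condition $\operatorname{rank}\operatorname{Lie}[X_1,\dots,X_m](x)=n$ at every $x\in\mathbb R^n$, with sub-Laplacean $\mathscr L=-\sum_{i=1}^mX_i^\star X_i$ ($X_i^\star$ the formal adjoint). It is assumed that outside a large compact set $\mathscr L$ coincides with the standard Laplacian. Let $d$ be the Carnot-Carathéodory distance of $\mathscr X$: $d(x,y)=\inf T$ over piecewise $C^1$ curves $\gamma:[0,T]\to\mathbb R^n$ with $\gamma(0)=x,\gamma(T)=y$ and $\gamma'=\sum_ia_i(t)X_i(\gamma)$ with $a_i$ piecewise continuous, $\sum_i|a_i|\le1$; $B(x,r)$ are its balls and $|B(x,r)|$ their Lebesgue measure. The heat operator $\mathscr H=\partial_t-\mathscr L$ admits a positive fundamental solution $p(x,t;\xi,\tau)=p(x,\xi;t-\tau)$, smooth in $\mathbb R^{n+1}\setminus\{(\xi,\tau)\}$; $p(x,y,t)$ denotes it with $\tau=0$.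 Recalled facts: there is $M>0$ such that for all $k,j\ge 0$ one has $|\partial_t^kX_{j_1}\cdots X_{j_j}p(x,y,t)|\le\frac{C}{t^{k+j/2}|B(x,\sqrt t)|}e^{-Md(x,y)^2/t}$ with $C=C(\mathscr X,k,j)$, and $p(x,y,t)\ge\frac{C^{-1}}{|B(x,\sqrt t)|}e^{-M^{-1}d(x,y)^2/t}$; moreover $\int_{\mathbb R^n}p(x,y,t)\,dy=1$. The heat semigroup is $P_tu(x)=\int_{\mathbb R^n}p(x,y,t)\,u(y)\,dy$; it is a self-adjoint strongly continuous contraction semigroup on $L^2(\mathbb R^n)$ with generator $\mathscr L$. $\mathscr S(\mathbb R^n)$ is the Schwartz class. For $u\in\mathscr S(\mathbb R^n)$ and $0<s<1$ the fractional sub-Laplacean is $$(-\mathscr L)^su=-\frac{s}{\Gamma(1-s)}\int_0^\infty t^{-s-1}\left[P_tu-u\right]dt,$$ interpreted as a Bochner integral in $L^2(\mathbb R^n)$. $\Gamma(\cdot)$ is Euler's gamma function. The Poisson kernel is $$K^{(a)}_z(x,y)=\frac{1}{2^{1-a}\Gamma(\frac{1-a}2)}\,z^{1-a}\int_0^\infty\frac{e^{-\frac{z^2}{4t}}}{t^{\frac{3-a}2}}\,p(x,y,t)\,dt.$$ *)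

theory Defs
  imports "HOL-Analysis.Analysis"
begin

section \<open>The Hilbert space of complex square-integrable functions\<close>

text \<open>Every Lebesgue measurable function agrees almost everywhere with a Borel measurable one, so
  Borel measurable representatives suffice.\<close>

definition square_integrable :: "('a::euclidean_space \<Rightarrow> complex) \<Rightarrow> bool" where
  "square_integrable f \<longleftrightarrow>
     f \<in> borel_measurable lborel \<and> integrable lborel (\<lambda>x. (norm (f x))\<^sup>2)"

lemma square_integrable_measurable [measurable_dest]:
  "square_integrable f \<Longrightarrow> f \<in> borel_measurable borel"
  by (simp add: square_integrable_def)

lemma square_integrable_zero [simp]: "square_integrable (\<lambda>x. 0)"
  by (simp add: square_integrable_def)

lemma square_integrable_bound:
  assumes g: "integrable lborel g" and [measurable]: "f \<in> borel_measurable borel"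
    and le: "AE x in lborel. (norm (f x))\<^sup>2 \<le> g x"
  shows "square_integrable f"
  unfolding square_integrable_def
proof (intro conjI)
  show "integrable lborel (\<lambda>x. (norm (f x))\<^sup>2)"
    by (rule Bochner_Integration.integrable_bound[OF g]) (use le in auto)
qed simp

lemma norm_add_square_le:
  "(norm (x + y))\<^sup>2 \<le> 2 * (norm x)\<^sup>2 + 2 * (norm (y::'b::real_normed_vector))\<^sup>2"
proof -
  have "(norm (x + y))\<^sup>2 \<le> (norm x + norm y)\<^sup>2"
    by (intro power_mono norm_triangle_ineq) simp
  also have "\<dots> \<le> 2 * (norm x)\<^sup>2 + 2 * (norm y)\<^sup>2"
    using sum_squares_bound[of "norm x" "norm y"] by (simp add: power2_sum)
  finally show ?thesis .
qed

lemma square_integrable_add: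
  assumes f: "square_integrable f" and g: "square_integrable g"
  shows "square_integrable (\<lambda>x. f x + g x)"
proof (rule square_integrable_bound)
  show "integrable lborel (\<lambda>x. 2 * (norm (f x))\<^sup>2 + 2 * (norm (g x))\<^sup>2)"
    using f g by (auto simp: square_integrable_def)
  show "(\<lambda>x. f x + g x) \<in> borel_measurable borel"
    using f g by measurable
qed (simp add: norm_add_square_le)

lemma square_integrable_scaleR:
  assumes f: "square_integrable f" shows "square_integrable (\<lambda>x. c *\<^sub>R f x)"
  using f by (auto simp: square_integrable_def power_mult_distrib)

lemma square_integrable_minus: "square_integrable f \<Longrightarrow> square_integrable (\<lambda>x. - f x)"
  using square_integrable_scaleR[of f "-1"] by simp

lemma square_integrable_diff:
  "square_integrable f \<Longrightarrow> square_integrable g \<Longrightarrow> square_integrable (\<lambda>x. f x - g x)"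
  using square_integrable_add[of f "\<lambda>x. - g x"] by (simp add: square_integrable_minus)

lemma square_integrable_inner:
  assumes f: "square_integrable f" and g: "square_integrable g"
  shows "integrable lborel (\<lambda>x. f x \<bullet> g x)"
proof (rule Bochner_Integration.integrable_bound)
  show "integrable lborel (\<lambda>x. (norm (f x))\<^sup>2 + (norm (g x))\<^sup>2)"
    using f g by (auto simp: square_integrable_def)
  show "(\<lambda>x. f x \<bullet> g x) \<in> borel_measurable lborel"
    using f g by measurable
  have "\<bar>f x \<bullet> g x\<bar> \<le> (norm (f x))\<^sup>2 + (norm (g x))\<^sup>2" for x
  proof -
    have "\<bar>f x \<bullet> g x\<bar> \<le> norm (f x) * norm (g x)" by (rule Cauchy_Schwarz_ineq2)
    moreover have "0 \<le> norm (f x) * norm (g x)" by simp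
    ultimately show ?thesis
      using sum_squares_bound[of "norm (f x)" "norm (g x)"] by linarith
  qed
  then show "AE x in lborel. norm (f x \<bullet> g x) \<le> norm ((norm (f x))\<^sup>2 + (norm (g x))\<^sup>2)"
    by (intro AE_I2) (simp add: abs_of_nonneg)
qed

quotient_type (overloaded) 'a L2 = "'a::euclidean_space \<Rightarrow> complex" / partial:
  "\<lambda>f g. square_integrable f \<and> square_integrable g \<and> (AE x in lborel. f x = g x)"
proof (rule part_equivpI)
  show "\<exists>x::'a \<Rightarrow> complex. square_integrable x \<and> square_integrable x \<and> (AE y in lborel. x y = x y)"
    by (intro exI[of _ "\<lambda>_. 0"]) simp
  show "symp (\<lambda>(f::'a \<Rightarrow> complex) g. square_integrable f \<and> square_integrable g \<and> (AE x in lborel. f x = g x))"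
    by (auto simp: symp_def elim: eventually_mono)
  show "transp (\<lambda>(f::'a \<Rightarrow> complex) g. square_integrable f \<and> square_integrable g \<and> (AE x in lborel. f x = g x))"
  proof (intro transpI conjI; elim conjE)
    fix f g h :: "'a \<Rightarrow> complex"
    assume "AE x in lborel. f x = g x" "AE x in lborel. g x = h x"
    then show "AE x in lborel. f x = h x" by eventually_elim simp
  qed
qed

instantiation L2 :: (euclidean_space) real_vector
begin

lift_definition zero_L2 :: "'a L2" is "\<lambda>x. 0" by simp

lift_definition plus_L2 :: "'a L2 \<Rightarrow> 'a L2 \<Rightarrow> 'a L2" is "\<lambda>f g x. f x + g x"
  by (auto intro: square_integrable_add elim: eventually_elim2)

lift_definition minus_L2 :: "'a L2 \<Rightarrow> 'a L2 \<Rightarrow> 'a L2" is "\<lambda>f g x. f x - g x"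
  by (auto intro: square_integrable_diff elim: eventually_elim2)

lift_definition uminus_L2 :: "'a L2 \<Rightarrow> 'a L2" is "\<lambda>f x. - f x"
  by (auto intro: square_integrable_minus elim: eventually_mono)

lift_definition scaleR_L2 :: "real \<Rightarrow> 'a L2 \<Rightarrow> 'a L2" is "\<lambda>c f x. c *\<^sub>R f x"
  by (auto intro: square_integrable_scaleR elim: eventually_mono)

instance
proof
  fix f g h :: "'a L2" and r q :: real
  show "f + g + h = f + (g + h)"
    by transfer (auto intro!: square_integrable_add simp: add.assoc)
  show "f + g = g + f"
    by transfer (auto intro!: square_integrable_add simp: add.commute)
  show "0 + f = f"
    by transfer auto
  show "- f + f = 0"
    by transfer (auto intro!: square_integrable_add square_integrable_minus)
  show "f - g = f + - g"
    by transfer (auto intro!: square_integrable_diff)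
  show "r *\<^sub>R (f + g) = r *\<^sub>R f + r *\<^sub>R g"
    by transfer (auto intro!: square_integrable_add square_integrable_scaleR simp: scaleR_add_right)
  show "(r + q) *\<^sub>R f = r *\<^sub>R f + q *\<^sub>R f"
    by transfer (auto intro!: square_integrable_add square_integrable_scaleR simp: scaleR_add_left)
  show "r *\<^sub>R q *\<^sub>R f = (r * q) *\<^sub>R f"
    by transfer (auto intro!: square_integrable_scaleR)
  show "1 *\<^sub>R f = f"
    by transfer auto
qed

end

instantiation L2 :: (euclidean_space) real_inner
begin

text \<open>This is the real part of the Hermitian product, since \<open>w \<bullet> z = Re (w * cnj z)\<close>
  on \<^typ>\<open>complex\<close>; it induces the usual norm.\<close>

lift_definition inner_L2 :: "'a L2 \<Rightarrow> 'a L2 \<Rightarrow> real" is "\<lambda>f g. LINT x|lborel. f x \<bullet> g x"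
proof (elim conjE)
  fix f f' g g' :: "'a \<Rightarrow> complex"
  assume [measurable]: "square_integrable f" "square_integrable f'"
      "square_integrable g" "square_integrable g'"
    and "AE x in lborel. f x = f' x" "AE x in lborel. g x = g' x"
  then have "AE x in lborel. f x \<bullet> g x = f' x \<bullet> g' x"
    by (auto elim: eventually_elim2)
  then show "(LINT x|lborel. f x \<bullet> g x) = (LINT x|lborel. f' x \<bullet> g' x)"
    by (intro integral_cong_AE) measurable
qed

definition norm_L2 :: "'a L2 \<Rightarrow> real" where "norm_L2 f = sqrt (f \<bullet> f)"

definition sgn_L2 :: "'a L2 \<Rightarrow> 'a L2" where "sgn_L2 f = f /\<^sub>R norm f"

definition dist_L2 :: "'a L2 \<Rightarrow> 'a L2 \<Rightarrow> real" where "dist_L2 f g = norm (f - g)"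

definition uniformity_L2 :: "('a L2 \<times> 'a L2) filter" where
  "uniformity_L2 = (INF e\<in>{0<..}. principal {(f, g). dist f g < e})"

definition open_L2 :: "'a L2 set \<Rightarrow> bool" where
  "open_L2 U = (\<forall>f\<in>U. eventually (\<lambda>(f', g). f' = f \<longrightarrow> g \<in> U) uniformity)"

instance
proof
  fix f g h :: "'a L2" and r :: real
  show "f \<bullet> g = g \<bullet> f"
    by transfer (simp add: inner_commute)
  show "(f + g) \<bullet> h = f \<bullet> h + g \<bullet> h"
    by transfer (auto simp: inner_add_left intro!: Bochner_Integration.integral_add square_integrable_inner)
  show "(r *\<^sub>R f) \<bullet> g = r * (f \<bullet> g)"
    by transfer simp
  show "0 \<le> f \<bullet> f"
    by transfer simp
  show "f \<bullet> f = 0 \<longleftrightarrow> f = 0"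
  proof (transfer, elim conjE)
    fix f :: "'a \<Rightarrow> complex" assume f: "square_integrable f"
    show "(LINT x|lborel. f x \<bullet> f x) = 0 \<longleftrightarrow>
        (square_integrable f \<and> square_integrable (\<lambda>x::'a. 0) \<and> (AE x in lborel. f x = 0))"
      using f by (subst integral_nonneg_eq_0_iff_AE) (auto intro: square_integrable_inner)
  qed
  show "norm f = sqrt (f \<bullet> f)" by (fact norm_L2_def)
  show "sgn f = f /\<^sub>R norm f" by (fact sgn_L2_def)
  show "dist f g = norm (f - g)" by (fact dist_L2_def)
  show "uniformity = (INF e\<in>{0<..}. principal {(f, g::'a L2). dist f g < e})"
    by (fact uniformity_L2_def)
  fix U :: "'a L2 set"
  show "open U = (\<forall>f\<in>U. eventually (\<lambda>(f', g). f' = f \<longrightarrow> g \<in> U) uniformity)"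
    by (fact open_L2_def)
qed

end

text \<open>\<open>to_L2 f\<close> is the class of \<open>f\<close>; it is \<open>0\<close> if \<open>f\<close> is not square-integrable.\<close>

lift_definition to_L2 :: "('a::euclidean_space \<Rightarrow> complex) \<Rightarrow> 'a L2" is
  "\<lambda>f. if square_integrable f then f else (\<lambda>_. 0)"
  by simp

text \<open>A representative, determined only almost everywhere.\<close>

definition L2_fun :: "'a::euclidean_space L2 \<Rightarrow> 'a \<Rightarrow> complex" where
  "L2_fun F = rep_L2 F"

lemma square_integrable_L2_fun: "square_integrable (L2_fun F)"
  unfolding L2_fun_def using Quotient_rep_reflp[OF Quotient_L2, of F] by simp

lemma to_L2_L2_fun [simp]: "to_L2 (L2_fun F) = F"
proof -
  have "to_L2 (L2_fun F) = abs_L2 (L2_fun F)"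
    by (simp add: to_L2.abs_eq[symmetric] to_L2_def square_integrable_L2_fun)
  then show ?thesis by (simp add: L2_fun_def Quotient_abs_rep[OF Quotient_L2])
qed

lemma to_L2_eq_iff:
  assumes "square_integrable f" "square_integrable g"
  shows "to_L2 f = to_L2 g \<longleftrightarrow> (AE x in lborel. f x = g x)"
  using assms by transfer auto

lemma L2_fun_to_L2: "square_integrable f \<Longrightarrow> AE x in lborel. L2_fun (to_L2 f) x = f x"
  by (metis to_L2_eq_iff square_integrable_L2_fun to_L2_L2_fun)

lemma to_L2_zero: "to_L2 (\<lambda>x. 0) = 0"
  by transfer auto

lemma to_L2_add:
  "square_integrable f \<Longrightarrow> square_integrable g \<Longrightarrow> to_L2 (\<lambda>x. f x + g x) = to_L2 f + to_L2 g"
  by transfer (auto intro: square_integrable_add)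

lemma to_L2_diff:
  "square_integrable f \<Longrightarrow> square_integrable g \<Longrightarrow> to_L2 (\<lambda>x. f x - g x) = to_L2 f - to_L2 g"
  by transfer (auto intro: square_integrable_diff)

lemma to_L2_scaleR:
  "square_integrable f \<Longrightarrow> to_L2 (\<lambda>x. c *\<^sub>R f x) = c *\<^sub>R to_L2 f"
  by transfer (auto intro: square_integrable_scaleR)

lemma
  assumes "\<And>i. i \<in> I \<Longrightarrow> square_integrable (f i)"
  shows square_integrable_sum: "square_integrable (\<lambda>x. \<Sum>i\<in>I. f i x)"
    and to_L2_sum: "to_L2 (\<lambda>x. \<Sum>i\<in>I. f i x) = (\<Sum>i\<in>I. to_L2 (f i))"
proof -
  have "square_integrable (\<lambda>x. \<Sum>i\<in>I. f i x) \<and> to_L2 (\<lambda>x. \<Sum>i\<in>I. f i x) = (\<Sum>i\<in>I. to_L2 (f i))"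
    using assms
    by (induction I rule: infinite_finite_induct)
      (simp_all add: to_L2_zero to_L2_add square_integrable_add)
  then show "square_integrable (\<lambda>x. \<Sum>i\<in>I. f i x)"
    "to_L2 (\<lambda>x. \<Sum>i\<in>I. f i x) = (\<Sum>i\<in>I. to_L2 (f i))" by auto
qed

lemma norm_to_L2:
  "square_integrable f \<Longrightarrow> norm (to_L2 f) = sqrt (LINT x|lborel. (norm (f x))\<^sup>2)"
  unfolding norm_eq_sqrt_inner by transfer (simp add: power2_norm_eq_inner)

lemma dist_to_L2:
  "square_integrable f \<Longrightarrow> square_integrable g \<Longrightarrow>
     dist (to_L2 f) (to_L2 g) = sqrt (LINT x|lborel. (norm (f x - g x))\<^sup>2)"
  by (simp add: dist_norm flip: to_L2_diff) (simp add: norm_to_L2 square_integrable_diff)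

lemma nn_integral_diff_L2:
  assumes "square_integrable f" "square_integrable g"
  shows "(\<integral>\<^sup>+x. ennreal ((norm (f x - g x))\<^sup>2) \<partial>lborel) = ennreal ((dist (to_L2 f) (to_L2 g))\<^sup>2)"
  using assms square_integrable_diff[OF assms]
  by (subst nn_integral_eq_integral) (auto simp: dist_to_L2 square_integrable_def)

lemma to_L2_dominated_convergence:
  fixes g :: "'a::euclidean_space \<Rightarrow> complex"
  assumes f: "\<And>i. square_integrable (f i)" and g: "g \<in> borel_measurable lborel"
    and h: "integrable lborel h"
    and bound: "\<And>i. AE x in lborel. (norm (f i x))\<^sup>2 \<le> h x"
    and lim: "AE x in lborel. (\<lambda>i. f i x) \<longlonglongrightarrow> g x"
  shows "square_integrable g" and "(\<lambda>i. to_L2 (f i)) \<longlonglongrightarrow> to_L2 g"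
proof -
  note [measurable] = f g
  have bound_all: "AE x in lborel. \<forall>i. (norm (f i x))\<^sup>2 \<le> h x"
    using bound by (simp add: AE_all_countable)
  have "AE x in lborel. (norm (g x))\<^sup>2 \<le> h x"
    using lim bound_all
  proof eventually_elim
    case (elim x)
    have "(\<lambda>i. (norm (f i x))\<^sup>2) \<longlonglongrightarrow> (norm (g x))\<^sup>2"
      by (intro tendsto_intros elim)
    then show ?case
      by (rule LIMSEQ_le_const2) (use elim in auto)
  qed note gh = this
  show gs: "square_integrable g"
    by (rule square_integrable_bound[OF h _ gh]) (use g in simp)
  have "(\<lambda>i. LINT x|lborel. (norm (f i x - g x))\<^sup>2) \<longlonglongrightarrow> (LINT x::'a|lborel. (0::real))"
  proof (rule integral_dominated_convergence[where w = "\<lambda>x. 4 * h x"])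
    show "AE x in lborel. (\<lambda>i. (norm (f i x - g x))\<^sup>2) \<longlonglongrightarrow> 0"
      using lim
    proof eventually_elim
      case (elim x)
      then have "(\<lambda>i. norm (f i x - g x)) \<longlonglongrightarrow> 0"
        by (simp add: LIM_zero_iff tendsto_norm_zero_iff)
      then have "(\<lambda>i. (norm (f i x - g x))\<^sup>2) \<longlonglongrightarrow> 0\<^sup>2" by (rule tendsto_power)
      then show ?case by simp
    qed
    fix i
    show "AE x in lborel. norm ((norm (f i x - g x))\<^sup>2) \<le> 4 * h x"
      using bound[of i] gh
    proof eventually_elim
      case (elim x)
      then show ?case using norm_add_square_le[of "f i x" "- g x"] by simp
    qed
  qed (use h in auto)
  then have "(\<lambda>i. sqrt (LINT x|lborel. (norm (f i x - g x))\<^sup>2)) \<longlonglongrightarrow> sqrt 0"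
    by (intro tendsto_real_sqrt) simp
  then show "(\<lambda>i. to_L2 (f i)) \<longlonglongrightarrow> to_L2 g"
    by (subst tendsto_dist_iff) (simp add: dist_to_L2 f gs)
qed


subsection \<open>Completeness (Riesz-Fischer)\<close>

lemma L2_Cauchy_convergent:
  fixes X :: "nat \<Rightarrow> 'a::euclidean_space L2"
  assumes "Cauchy X" shows "convergent X"
proof -
  have "\<exists>r. strict_mono r \<and> (\<forall>k::nat. \<forall>m\<ge>r k. \<forall>n\<ge>r k. dist (X m) (X n) < (1/4)^k)"
  proof -
    have ex: "\<exists>N>n. \<forall>l\<ge>N. \<forall>m\<ge>N. dist (X l) (X m) < (1/4)^k" for k n :: nat
    proof -
      obtain N where "\<forall>l\<ge>N. \<forall>m\<ge>N. dist (X l) (X m) < (1/4)^k"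
        using assms unfolding Cauchy_def by (metis zero_less_divide_1_iff zero_less_numeral zero_less_power)
      then show ?thesis by (intro exI[of _ "Suc (max N n)"]) auto
    qed
    define r where "r = rec_nat (SOME N. \<forall>l\<ge>N. \<forall>m\<ge>N. dist (X l) (X m) < (1/4)^0)
      (\<lambda>k n. SOME N. N > n \<and> (\<forall>l\<ge>N. \<forall>m\<ge>N. dist (X l) (X m) < (1/4)^Suc k))"
    have "\<exists>N. \<forall>l\<ge>N. \<forall>m\<ge>N. dist (X l) (X m) < (1/4)^0" using ex[where k = 0 and n = 0] by blast
    then have r0: "\<forall>l\<ge>r 0. \<forall>m\<ge>r 0. dist (X l) (X m) < (1/4)^0"
      unfolding r_def by (simp only: nat.rec) (rule someI_ex)
    have rS: "r (Suc k) > r k \<and> (\<forall>l\<ge>r (Suc k). \<forall>m\<ge>r (Suc k). dist (X l) (X m) < (1/4)^Suc k)" for k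
      unfolding r_def by (simp only: nat.rec) (rule someI_ex[OF ex])
    have "\<forall>m\<ge>r k. \<forall>n\<ge>r k. dist (X m) (X n) < (1/4)^k" for k
      using r0 rS by (cases k) auto
    moreover have "strict_mono r" using rS by (simp add: strict_mono_Suc_iff)
    ultimately show ?thesis by blast
  qed
  then obtain r where r: "strict_mono (r::nat\<Rightarrow>nat)"
    and close: "\<And>k m n. m \<ge> r k \<Longrightarrow> n \<ge> r k \<Longrightarrow> dist (X m) (X n) < (1/4)^k" by blast
  define f where "f k = L2_fun (X (r k))" for k
  have fs [measurable]: "square_integrable (f k)" for k
    by (simp add: f_def square_integrable_L2_fun)
  have Xf: "to_L2 (f k) = X (r k)" for k by (simp add: f_def)
  have step: "dist (X (r (Suc k))) (X (r k)) \<le> (1/4)^k" for k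
    using close[of k "r (Suc k)" "r k"] strict_monoD[OF r, of k "Suc k"] by simp
  let ?d = "\<lambda>k x. 2^k * (norm (f (Suc k) x - f k x))\<^sup>2"
  have int_d: "(\<integral>\<^sup>+x. ennreal (?d k x) \<partial>lborel) \<le> ennreal ((1/8)^k)" for k
  proof -
    have "(\<integral>\<^sup>+x. ennreal (?d k x) \<partial>lborel)
        = ennreal (2^k) * (\<integral>\<^sup>+x. ennreal ((norm (f (Suc k) x - f k x))\<^sup>2) \<partial>lborel)"
      by (subst nn_integral_cmult[symmetric]) (auto simp: ennreal_mult')
    also have "\<dots> = ennreal (2^k * (dist (X (r (Suc k))) (X (r k)))\<^sup>2)"
      by (simp add: nn_integral_diff_L2 fs Xf ennreal_mult')
    also have "\<dots> \<le> ennreal (2^k * ((1/4)^k)\<^sup>2)"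
      by (intro ennreal_leI mult_left_mono power_mono step) auto
    also have "2^k * ((1/4)^k)\<^sup>2 = ((1/8)^k :: real)"
      by (simp add: power2_eq_square flip: power_mult_distrib)
    finally show ?thesis .
  qed
  have "(\<integral>\<^sup>+x. (\<Sum>k. ennreal (?d k x)) \<partial>lborel) = (\<Sum>k. \<integral>\<^sup>+x. ennreal (?d k x) \<partial>lborel)"
    by (rule nn_integral_suminf) measurable
  also have "\<dots> \<le> (\<Sum>k. ennreal ((1/8)^k))"
    by (intro suminf_le int_d) auto
  also have "\<dots> < \<infinity>"
    by (subst suminf_ennreal2) (auto intro: summable_geometric)
  finally have "AE x in lborel. (\<Sum>k. ennreal (?d k x)) \<noteq> \<infinity>"
    by (intro nn_integral_PInf_AE) auto
  then have "AE x in lborel. convergent (\<lambda>k. f k x)"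
  proof eventually_elim
    case (elim x)
    then have "summable (\<lambda>k. ?d k x)"
      by (intro summable_suminf_not_top) auto
    then have "(\<lambda>k. ?d k x) \<longlonglongrightarrow> 0" by (rule summable_LIMSEQ_zero)
    then have "Bseq (\<lambda>k. ?d k x)" by (intro convergent_imp_Bseq convergentI)
    then obtain K where "K > 0" and K: "\<And>k. norm (?d k x) \<le> K" by (auto elim: BseqE)
    have le: "norm (f (Suc k) x - f k x) \<le> sqrt K * (sqrt (1/2))^k" for k
    proof -
      have "(norm (f (Suc k) x - f k x))\<^sup>2 \<le> K * (1/2)^k"
        using K[of k] by (simp add: field_simps power_divide)
      then have "sqrt ((norm (f (Suc k) x - f k x))\<^sup>2) \<le> sqrt (K * (1/2)^k)"
        by (rule real_sqrt_le_mono)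
      then show ?thesis by (simp add: real_sqrt_mult real_sqrt_power)
    qed
    have "summable (\<lambda>k. sqrt K * (sqrt (1/2))^k)"
      by (intro summable_mult summable_geometric) (simp add: real_sqrt_divide)
    then have "summable (\<lambda>k. f (Suc k) x - f k x)"
      by (rule summable_comparison_test[rotated]) (use le in auto)
    then have "convergent (\<lambda>n. \<Sum>k<n. f (Suc k) x - f k x)"
      by (simp add: summable_iff_convergent)
    then have "convergent (\<lambda>n. f n x - f 0 x)" by (simp add: sum_lessThan_telescope[of "\<lambda>k. f k x"])
    then have "convergent (\<lambda>n. (f n x - f 0 x) + f 0 x)"
      by (intro convergent_add convergent_const)
    then show ?case by simp
  qed
  then have lim: "AE x in lborel. (\<lambda>k. f k x) \<longlonglongrightarrow> lim (\<lambda>k. f k x)"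
    by (simp add: convergent_LIMSEQ_iff)
  define g where "g x = lim (\<lambda>k. f k x)" for x
  have g [measurable]: "g \<in> borel_measurable borel"
    unfolding g_def by (rule borel_measurable_lim_metric) simp
  have fatou: "(\<integral>\<^sup>+x. ennreal ((norm (g x - f k x))\<^sup>2) \<partial>lborel) \<le> ennreal (((1/4)^k)\<^sup>2)" for k
  proof -
    have "(\<integral>\<^sup>+x. ennreal ((norm (g x - f k x))\<^sup>2) \<partial>lborel)
        = (\<integral>\<^sup>+x. liminf (\<lambda>j. ennreal ((norm (f j x - f k x))\<^sup>2)) \<partial>lborel)"
    proof (rule nn_integral_cong_AE)
      show "AE x in lborel. ennreal ((norm (g x - f k x))\<^sup>2)
          = liminf (\<lambda>j. ennreal ((norm (f j x - f k x))\<^sup>2))"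
        using lim
      proof eventually_elim
        case (elim x)
        then have "(\<lambda>j. ennreal ((norm (f j x - f k x))\<^sup>2)) \<longlonglongrightarrow> ennreal ((norm (g x - f k x))\<^sup>2)"
          unfolding g_def by (intro tendsto_intros)
        then show ?case
          by (intro lim_imp_Liminf[symmetric]) auto
      qed
    qed
    also have "\<dots> \<le> liminf (\<lambda>j. \<integral>\<^sup>+x. ennreal ((norm (f j x - f k x))\<^sup>2) \<partial>lborel)"
      by (rule nn_integral_liminf) measurable
    also have "\<dots> \<le> liminf (\<lambda>j. ennreal (((1/4)^k)\<^sup>2))"
    proof (rule Liminf_mono, rule eventually_sequentiallyI[of k])
      fix j assume "k \<le> j"
      then have "r k \<le> r j" using r by (simp add: strict_mono_less_eq)
      then have "dist (X (r j)) (X (r k)) \<le> (1/4)^k" using close[of k "r j" "r k"] by simp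
      then show "(\<integral>\<^sup>+x. ennreal ((norm (f j x - f k x))\<^sup>2) \<partial>lborel) \<le> ennreal (((1/4)^k)\<^sup>2)"
        by (simp add: nn_integral_diff_L2 fs Xf ennreal_leI power_mono)
    qed
    finally show ?thesis by (simp add: Liminf_const)
  qed
  have "square_integrable (\<lambda>x. g x - f k x)" for k
    unfolding square_integrable_def
  proof (intro conjI)
    show "integrable lborel (\<lambda>x. (norm (g x - f k x))\<^sup>2)"
      by (rule integrableI_nonneg) (use fatou[of k] in \<open>auto simp: le_less_trans\<close>)
  qed measurable
  from this[of 0] have gs: "square_integrable g"
    using square_integrable_add[of "\<lambda>x. g x - f 0 x" "f 0"] fs by simp
  have "dist (to_L2 g) (X (r k)) \<le> (1/4)^k" for k
  proof -
    have "ennreal ((dist (to_L2 g) (X (r k)))\<^sup>2) \<le> ennreal (((1/4)^k)\<^sup>2)"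
      using fatou[of k] by (simp add: nn_integral_diff_L2 gs fs Xf)
    then have "(dist (to_L2 g) (X (r k)))\<^sup>2 \<le> ((1/4)^k)\<^sup>2"
      by (subst (asm) ennreal_le_iff) auto
    then show ?thesis by (rule power2_le_imp_le) simp
  qed
  then have "(\<lambda>k. dist (to_L2 g) (X (r k))) \<longlonglongrightarrow> 0"
    by (intro tendsto_sandwich[OF _ _ tendsto_const LIMSEQ_realpow_zero[of "1/4"]]) auto
  then have "(X \<circ> r) \<longlonglongrightarrow> to_L2 g"
    by (subst tendsto_dist_iff) (simp add: dist_commute o_def)
  then show ?thesis
    using Cauchy_converges_subseq[OF assms r] by (auto simp: convergent_def)
qed

instance L2 :: (euclidean_space) banach
  by standard (rule L2_Cauchy_convergent)


subsection \<open>Separability\<close>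

lemma rational_combinations_closure:
  fixes G :: "'b::real_normed_vector set"
  assumes "countable G"
  obtains D where "countable D" "G \<subseteq> closure D" "0 \<in> closure D"
    "\<And>x y. x \<in> closure D \<Longrightarrow> y \<in> closure D \<Longrightarrow> x + y \<in> closure D"
    "\<And>c x. x \<in> closure D \<Longrightarrow> c *\<^sub>R x \<in> closure D"
proof
  define comb :: "(rat \<times> 'b) list \<Rightarrow> 'b" where "comb l = sum_list (map (\<lambda>(q, g). of_rat q *\<^sub>R g) l)" for l
  define D where "D = comb ` lists (UNIV \<times> G)"
  show "countable D" unfolding D_def using assms by (intro countable_image countable_lists) auto
  have D0: "0 \<in> D" unfolding D_def by (rule image_eqI[of _ _ "[]"]) (auto simp: comb_def)
  then show "0 \<in> closure D" using closure_subset by blast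
  have "G \<subseteq> D"
  proof
    fix g assume "g \<in> G"
    then show "g \<in> D" unfolding D_def
      by (intro image_eqI[of _ _ "[(1, g)]"]) (auto simp: comb_def)
  qed
  then show "G \<subseteq> closure D" using closure_subset by blast
  have add: "x + y \<in> D" if xy: "x \<in> D" "y \<in> D" for x y
  proof -
    obtain l l' where "l \<in> lists (UNIV \<times> G)" "l' \<in> lists (UNIV \<times> G)" "x = comb l" "y = comb l'"
      using xy unfolding D_def by blast
    then show ?thesis unfolding D_def by (intro image_eqI[of _ _ "l @ l'"]) (auto simp: comb_def)
  qed
  have scale: "of_rat q *\<^sub>R x \<in> D" if x: "x \<in> D" for q x
  proof -
    obtain l where l: "l \<in> lists (UNIV \<times> G)" "x = comb l"
      using x unfolding D_def by blast
    have "of_rat q *\<^sub>R comb l = comb (map (\<lambda>(p, g). (q * p, g)) l)"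
      by (induction l) (auto simp: comb_def scaleR_add_right of_rat_mult)
    then show ?thesis unfolding D_def using l
      by (intro image_eqI[of _ _ "map (\<lambda>(p, g). (q * p, g)) l"]) auto
  qed
  show "x + y \<in> closure D" if xy: "x \<in> closure D" "y \<in> closure D" for x y
  proof -
    obtain u v where "\<And>n. u n \<in> D" "u \<longlonglongrightarrow> x" "\<And>n. v n \<in> D" "v \<longlonglongrightarrow> y"
      using xy unfolding closure_sequential by blast
    then show ?thesis unfolding closure_sequential
      by (intro exI[of _ "\<lambda>n. u n + v n"]) (auto intro: add tendsto_add)
  qed
  show "c *\<^sub>R x \<in> closure D" if x: "x \<in> closure D" for c x
  proof -
    obtain u where u: "\<And>n. u n \<in> D" "u \<longlonglongrightarrow> x"
      using x unfolding closure_sequential by blast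
    have "c \<in> closure (\<rat>)" by (simp add: Rats_closure_real)
    then obtain q where q: "\<And>n. q n \<in> \<rat>" "q \<longlonglongrightarrow> c"
      unfolding closure_sequential by blast
    have "q n *\<^sub>R u n \<in> D" for n
      using q(1)[of n] scale[OF u(1)[of n]] by (auto elim: Rats_cases)
    then show ?thesis unfolding closure_sequential
      by (intro exI[of _ "\<lambda>n. q n *\<^sub>R u n"]) (auto intro: tendsto_scaleR u q)
  qed
qed

lemma square_integrable_indicator:
  fixes c :: complex and E :: "'a::euclidean_space set"
  assumes [measurable]: "E \<in> sets borel" and fin: "emeasure lborel E < \<infinity>"
  shows "square_integrable (\<lambda>x. indicator E x *\<^sub>R c)"
proof (rule square_integrable_bound)
  show "integrable lborel (\<lambda>x. indicator E x * (norm c)\<^sup>2 :: real)"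
    using fin by (intro integrable_mult_left integrable_real_indicator) auto
  show "AE x in lborel. (norm (indicator E x *\<^sub>R c))\<^sup>2 \<le> indicator E x * (norm c)\<^sup>2"
    by (intro AE_I2) (auto simp: indicator_def)
qed measurable

lemma square_integrable_indicator_ball:
  fixes c :: complex and E :: "'a::euclidean_space set"
  assumes "E \<in> sets borel"
  shows "square_integrable (\<lambda>x. indicator (E \<inter> ball 0 r) x *\<^sub>R c)"
proof (rule square_integrable_indicator)
  have "emeasure lborel (E \<inter> ball 0 r) \<le> emeasure lborel (ball (0::'a) r)"
    using assms by (intro emeasure_mono) auto
  also have "\<dots> < \<infinity>" by (rule emeasure_lborel_ball_finite)
  finally show "emeasure lborel (E \<inter> ball 0 r) < \<infinity>" .
qed (use assms in auto)

lemma L2_separable: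
  obtains D :: "'a::euclidean_space L2 set" where "countable D" "closure D = UNIV"
proof -
  obtain B :: "'a set set" where B: "countable B" "topological_basis B"
    using ex_countable_basis by blast
  define \<A> where "\<A> = Inter ` {F. finite F \<and> F \<subseteq> B}"
  have \<A>: "countable \<A>"
    unfolding \<A>_def by (intro countable_image countable_Collect_finite_subset B)
  have openA: "open A" if "A \<in> \<A>" for A
    using that B(2) unfolding \<A>_def by (auto intro!: open_Inter dest: topological_basis_open)
  have "B \<subseteq> \<A>"
  proof
    fix b assume "b \<in> B"
    then show "b \<in> \<A>" unfolding \<A>_def by (intro image_eqI[of _ _ "{b}"]) auto
  qed
  have UNIV_A: "UNIV \<in> \<A>" unfolding \<A>_def by (intro image_eqI[of _ _ "{}"]) auto
  have "Int_stable \<A>"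
  proof (rule Int_stableI)
    fix a b assume "a \<in> \<A>" "b \<in> \<A>"
    then obtain F F' where "finite F" "F \<subseteq> B" "a = \<Inter>F" "finite F'" "F' \<subseteq> B" "b = \<Inter>F'"
      unfolding \<A>_def by auto
    then show "a \<inter> b \<in> \<A>" unfolding \<A>_def
      by (intro image_eqI[of _ _ "F \<union> F'"]) auto
  qed
  have sets_A: "sets (borel :: 'a measure) = sigma_sets UNIV \<A>"
  proof
    have "sets (borel :: 'a measure) = sigma_sets UNIV B"
      using arg_cong[OF borel_eq_countable_basis[OF B], of sets] by (simp add: sets_measure_of)
    then show "sets (borel :: 'a measure) \<subseteq> sigma_sets UNIV \<A>"
      using sigma_sets_mono'[OF \<open>B \<subseteq> \<A>\<close>] by simp
    show "sigma_sets UNIV \<A> \<subseteq> sets (borel :: 'a measure)"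
    proof -
      have "\<A> \<subseteq> sets borel" using openA by auto
      then show ?thesis using sets.sigma_sets_subset[of \<A> "borel :: 'a measure"] by simp
    qed
  qed
  define e where "e E n c = to_L2 (\<lambda>x. indicator (E \<inter> ball 0 (real n)) x *\<^sub>R c)"
    for E :: "'a set" and n :: nat and c :: complex
  define G where "G = (\<lambda>(A, n, c). e A n c) ` (\<A> \<times> UNIV \<times> {1, \<i>})"
  have "countable G" unfolding G_def by (intro countable_image countable_SIGMA \<A>) auto
  then obtain D where D: "countable D" "G \<subseteq> closure D" and zero: "0 \<in> closure D"
    and add: "\<And>x y. x \<in> closure D \<Longrightarrow> y \<in> closure D \<Longrightarrow> x + y \<in> closure D"
    and scale: "\<And>c x. x \<in> closure D \<Longrightarrow> c *\<^sub>R x \<in> closure D"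
    using rational_combinations_closure by metis
  have G_in: "e A n c \<in> closure D" if "A \<in> \<A>" "c \<in> {1, \<i>}" for A n c
  proof -
    have "e A n c \<in> G" unfolding G_def
      by (rule image_eqI[of _ _ "(A, n, c)"]) (use that in auto)
    then show ?thesis using D(2) by blast
  qed
  have diff: "x - y \<in> closure D" if "x \<in> closure D" "y \<in> closure D" for x y
    using add[OF that(1) scale[OF that(2), of "-1"]] by simp
  have sum: "(\<Sum>i\<in>I. f i) \<in> closure D" if "\<And>i. i \<in> I \<Longrightarrow> f i \<in> closure D" for f and I :: "'i set"
    using that by (induction I rule: infinite_finite_induct) (auto simp: zero intro: add)
  have e_complex: "e E n c = Re c *\<^sub>R e E n 1 + Im c *\<^sub>R e E n \<i>" if E: "E \<in> sets borel" for E n c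
  proof -
    have "(\<lambda>x. indicator (E \<inter> ball 0 (real n)) x *\<^sub>R c) =
        (\<lambda>x. Re c *\<^sub>R (indicator (E \<inter> ball 0 (real n)) x *\<^sub>R 1)
           + Im c *\<^sub>R (indicator (E \<inter> ball 0 (real n)) x *\<^sub>R \<i>))"
      by (rule ext) (auto simp: indicator_def complex_eq_iff)
    then show ?thesis unfolding e_def
      by (simp only: to_L2_add to_L2_scaleR square_integrable_scaleR square_integrable_indicator_ball[OF E])
  qed
  have UNIV_borel: "(UNIV :: 'a set) \<in> sets borel" by simp
  have "\<A> \<subseteq> Pow UNIV" by simp
  have e_in: "e E n c \<in> closure D" if "E \<in> sets borel" for E n c
    using \<open>Int_stable \<A>\<close> \<open>\<A> \<subseteq> Pow UNIV\<close> that[unfolded sets_A]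
  proof (induction E arbitrary: n c rule: sigma_sets_induct_disjoint)
    fix A n c assume A: "A \<in> \<A>"
    then have "e A n 1 \<in> closure D" "e A n \<i> \<in> closure D"
      using G_in by auto
    then show "e A n c \<in> closure D"
      by (subst e_complex) (auto intro: add scale borel_open openA A)
  next
    show "e {} n c \<in> closure D" for n c
      using zero by (simp add: e_def to_L2_zero)
  next
    fix A n c assume A: "A \<in> sigma_sets UNIV \<A>" and IH: "\<And>n c. e A n c \<in> closure D"
    have A': "A \<in> sets borel" using A sets_A by simp
    have "e UNIV n 1 \<in> closure D" "e UNIV n \<i> \<in> closure D"
      using G_in UNIV_A by auto
    then have U: "e UNIV n c \<in> closure D"
      by (subst e_complex) (auto intro: add scale)
    have "(\<lambda>x. indicator ((UNIV - A) \<inter> ball 0 (real n)) x *\<^sub>R c) =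
        (\<lambda>x. indicator (UNIV \<inter> ball 0 (real n)) x *\<^sub>R c - indicator (A \<inter> ball 0 (real n)) x *\<^sub>R c)"
      by (rule ext) (auto simp: indicator_def)
    then have "e (UNIV - A) n c = e UNIV n c - e A n c"
      unfolding e_def
      by (simp only: to_L2_diff square_integrable_indicator_ball[OF A'] square_integrable_indicator_ball[OF UNIV_borel])
    then show "e (UNIV - A) n c \<in> closure D" using diff[OF U IH] by simp
  next
    fix A :: "nat \<Rightarrow> 'a set" and n :: nat and c :: complex
    assume dis: "disjoint_family A" and A: "range A \<subseteq> sigma_sets UNIV \<A>"
      and IH: "\<And>i n c. e (A i) n c \<in> closure D"
    have A' [measurable]: "A i \<in> sets borel" for i using A sets_A by auto
    let ?S = "\<lambda>k. \<Union>i<k. A i"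
    have S: "e (?S k) n c \<in> closure D" for k
    proof (induction k)
      case 0
      then show ?case using zero by (simp add: e_def to_L2_zero)
    next
      case (Suc k)
      have "A i \<inter> A k = {}" if "i < k" for i
        using disjoint_family_onD[OF dis, of i k] that by simp
      then have "A k \<inter> ?S k = {}" by blast
      then have "(\<lambda>x. indicator (?S (Suc k) \<inter> ball 0 (real n)) x *\<^sub>R c) =
        (\<lambda>x. indicator (?S k \<inter> ball 0 (real n)) x *\<^sub>R c + indicator (A k \<inter> ball 0 (real n)) x *\<^sub>R c)"
        by (intro ext) (auto simp: indicator_def lessThan_Suc split: if_splits)
      moreover have "?S k \<in> sets borel" by measurable
      ultimately have "e (?S (Suc k)) n c = e (?S k) n c + e (A k) n c"
        unfolding e_def by (simp only: to_L2_add square_integrable_indicator_ball A')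
      then show ?case using add[OF Suc IH] by simp
    qed
    have U: "(\<Union>i. A i) \<in> sets borel" by measurable
    have "(\<lambda>k. e (?S k) n c) \<longlonglongrightarrow> e (\<Union>i. A i) n c"
      unfolding e_def
    proof (rule to_L2_dominated_convergence(2))
      show "square_integrable (\<lambda>x. indicator (?S k \<inter> ball 0 (real n)) x *\<^sub>R c)" for k
        by (intro square_integrable_indicator_ball) measurable
      show "(\<lambda>x. indicator ((\<Union>i. A i) \<inter> ball 0 (real n)) x *\<^sub>R c) \<in> borel_measurable lborel"
        using square_integrable_indicator_ball[OF U, of "real n" c] by (simp add: square_integrable_def)
      show "integrable lborel (\<lambda>x::'a. (norm (indicator (UNIV \<inter> ball 0 (real n)) x *\<^sub>R c))\<^sup>2)"
        using square_integrable_indicator_ball[OF UNIV_borel, of "real n" c] unfolding square_integrable_def by simp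
      show "AE x in lborel. (norm (indicator (?S k \<inter> ball 0 (real n)) x *\<^sub>R c))\<^sup>2
          \<le> (norm (indicator (UNIV \<inter> ball 0 (real n)) x *\<^sub>R c))\<^sup>2" for k
        by (intro AE_I2) (auto simp: indicator_def)
      show "AE x in lborel. (\<lambda>k. indicator (?S k \<inter> ball 0 (real n)) x *\<^sub>R c)
          \<longlonglongrightarrow> indicator ((\<Union>i. A i) \<inter> ball 0 (real n)) x *\<^sub>R c"
      proof (intro AE_I2 tendsto_eventually)
        fix x :: 'a
        show "\<forall>\<^sub>F k in sequentially. indicator (?S k \<inter> ball 0 (real n)) x *\<^sub>R c
            = indicator ((\<Union>i. A i) \<inter> ball 0 (real n)) x *\<^sub>R c"
        proof (cases "\<exists>i. x \<in> A i")
          case True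
          then obtain i where "x \<in> A i" by blast
          then show ?thesis
            by (intro eventually_sequentiallyI[of "Suc i"]) (auto simp: indicator_def)
        next
          case False
          then show ?thesis by (intro always_eventually) (auto simp: indicator_def)
        qed
      qed
    qed
    then show "e (\<Union>i. A i) n c \<in> closure D"
      by (rule closed_sequentially[OF closed_closure, rotated]) (rule S)
  qed
  have "F \<in> closure D" for F :: "'a L2"
  proof -
    define f where "f = L2_fun F"
    have f [measurable]: "square_integrable f" by (simp add: f_def square_integrable_L2_fun)
    have "f \<in> borel_measurable lborel" by simp
    then obtain s where s: "\<And>i. simple_function lborel (s i)"
      and s_lim: "\<And>x. (\<lambda>i. s i x) \<longlonglongrightarrow> f x"
      and s_le: "\<And>i x. norm (s i x) \<le> 2 * norm (f x)"
      using borel_measurable_implies_sequence_metric[of f lborel 0] by (auto simp: dist_norm)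
    have [measurable]: "s i \<in> borel_measurable borel" for i
      using borel_measurable_simple_function[OF s] by simp
    define g where "g i x = indicator (ball 0 (real i)) x *\<^sub>R s i x" for i x
    have rep: "g i x = (\<Sum>y\<in>range (s i). indicator (s i -` {y} \<inter> ball 0 (real i)) x *\<^sub>R y)" for i x
    proof -
      have fin: "finite (range (s i))" using simple_functionD(1)[OF s] by simp
      have "(\<Sum>y\<in>range (s i). indicator (s i -` {y} \<inter> ball 0 (real i)) x *\<^sub>R y)
          = (\<Sum>y\<in>{s i x}. indicator (s i -` {y} \<inter> ball 0 (real i)) x *\<^sub>R y)"
        by (rule sum.mono_neutral_right) (use fin in auto)
      then show ?thesis by (simp add: g_def indicator_def)
    qed
    have pre: "s i -` {y} \<in> sets borel" for i y
      using measurable_sets_borel[of "s i" borel "{y}"] by simp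
    have g_eq: "g i = (\<lambda>x. \<Sum>y\<in>range (s i). indicator (s i -` {y} \<inter> ball 0 (real i)) x *\<^sub>R y)" for i
      by (rule ext) (rule rep)
    have g_in: "square_integrable (g i)" "to_L2 (g i) \<in> closure D" for i
    proof -
      show "square_integrable (g i)"
        unfolding g_eq by (intro square_integrable_sum square_integrable_indicator_ball pre)
      have "to_L2 (g i) = (\<Sum>y\<in>range (s i). e (s i -` {y}) i y)"
        unfolding g_eq e_def by (intro to_L2_sum square_integrable_indicator_ball pre)
      then show "to_L2 (g i) \<in> closure D"
        by (simp only:) (intro sum e_in pre)
    qed
    have "(\<lambda>i. to_L2 (g i)) \<longlonglongrightarrow> to_L2 f"
    proof (rule to_L2_dominated_convergence(2))
      show "square_integrable (g i)" for i by (fact g_in)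
      show "f \<in> borel_measurable lborel" by simp
      show "integrable lborel (\<lambda>x. 4 * (norm (f x))\<^sup>2)"
        using f by (simp add: square_integrable_def)
      show "AE x in lborel. (norm (g i x))\<^sup>2 \<le> 4 * (norm (f x))\<^sup>2" for i
      proof (rule AE_I2)
        fix x :: 'a
        have "norm (g i x) \<le> 2 * norm (f x)"
          using s_le[of i x] by (auto simp: g_def indicator_def)
        then have "(norm (g i x))\<^sup>2 \<le> (2 * norm (f x))\<^sup>2" by (intro power_mono) auto
        then show "(norm (g i x))\<^sup>2 \<le> 4 * (norm (f x))\<^sup>2" by (simp add: power_mult_distrib)
      qed
      show "AE x in lborel. (\<lambda>i. g i x) \<longlonglongrightarrow> f x"
      proof (rule AE_I2)
        fix x :: 'a
        obtain N :: nat where N: "norm x < real N" using reals_Archimedean2 by blast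
        have "\<forall>\<^sub>F i in sequentially. s i x = g i x"
          using N by (intro eventually_sequentiallyI[of N]) (auto simp: g_def)
        then show "(\<lambda>i. g i x) \<longlonglongrightarrow> f x"
          using s_lim[of x] by (rule Lim_transform_eventually[rotated])
      qed
    qed
    then have "to_L2 f \<in> closure D"
      by (rule closed_sequentially[OF closed_closure, rotated]) (rule g_in(2))
    then show ?thesis by (simp add: f_def)
  qed
  then show ?thesis using that D(1) by blast
qed

instance L2 :: (euclidean_space) second_countable_topology
proof
  obtain D :: "'a L2 set" where D: "countable D" "closure D = UNIV"
    by (rule L2_separable)
  define B where "B = (\<lambda>(d, n). ball d (1 / real (Suc n))) ` (D \<times> UNIV)"
  have "topological_basis B"
  proof (rule topological_basisI)
    show "open b" if "b \<in> B" for b using that by (auto simp: B_def)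
    fix U and x :: "'a L2" assume "open U" "x \<in> U"
    then obtain r where r: "r > 0" "ball x r \<subseteq> U" by (auto simp: open_contains_ball)
    obtain n where n: "1 / real (Suc n) < r / 2"
      using reals_Archimedean[of "r / 2"] r by (auto simp: inverse_eq_divide)
    have "x \<in> closure D" using D by simp
    then obtain d where d: "d \<in> D" "dist d x < 1 / real (Suc n)"
      unfolding closure_approachable by (meson of_nat_0_less_iff zero_less_Suc zero_less_divide_1_iff)
    have "ball d (1 / real (Suc n)) \<subseteq> U"
    proof
      fix y assume "y \<in> ball d (1 / real (Suc n))"
      then have "dist x y < r"
        using d(2) n dist_triangle3[of x y d] by simp
      then show "y \<in> U" using r by auto
    qed
    then show "\<exists>b\<in>B. x \<in> b \<and> b \<subseteq> U"
      using d by (intro bexI[of _ "ball d (1 / real (Suc n))"]) (auto simp: B_def)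
  qed
  moreover have "countable B" unfolding B_def using D by (intro countable_image) auto
  ultimately show "\<exists>B::'a L2 set set. countable B \<and> open = generate_topology B"
    using topological_basis_imp_subbasis by blast
qed

text \<open>Convergence in \<open>L\<^sup>2\<close> of a family of functions; the first clause excludes the default
  value of \<^const>\<open>to_L2\<close>.\<close>

definition tendsto_L2 ::
  "('i \<Rightarrow> 'a::euclidean_space \<Rightarrow> complex) \<Rightarrow> 'a L2 \<Rightarrow> 'i filter \<Rightarrow> bool" where
  "tendsto_L2 f L F \<longleftrightarrow>
     (\<forall>\<^sub>F z in F. square_integrable (f z)) \<and> ((\<lambda>z. to_L2 (f z)) \<longlongrightarrow> L) F"


section \<open>Smooth functions\<close>

text \<open>Intended for open \<open>S\<close>: \<open>f\<close> is of class \<open>C\<^sup>k\<close> on \<open>S\<close>.\<close>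

fun C_k_on :: "nat \<Rightarrow> 'a::real_normed_vector set \<Rightarrow> ('a \<Rightarrow> 'b::real_normed_vector) \<Rightarrow> bool" where
  "C_k_on 0 S f \<longleftrightarrow> continuous_on S f"
| "C_k_on (Suc k) S f \<longleftrightarrow>
     (\<forall>x\<in>S. f differentiable (at x)) \<and> (\<forall>v. C_k_on k S (\<lambda>x. frechet_derivative f (at x) v))"

definition smooth_on :: "'a::real_normed_vector set \<Rightarrow> ('a \<Rightarrow> 'b::real_normed_vector) \<Rightarrow> bool" where
  "smooth_on S f \<longleftrightarrow> (\<forall>k. C_k_on k S f)"

definition test_function :: "('a::real_normed_vector \<Rightarrow> 'b::real_normed_vector) \<Rightarrow> bool" where
  "test_function \<phi> \<longleftrightarrow> smooth_on UNIV \<phi> \<and> compact (closure {x. \<phi> x \<noteq> 0})"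

definition partial ::
  "'n::finite \<Rightarrow> (real ^ 'n \<Rightarrow> 'b::real_normed_vector) \<Rightarrow> real ^ 'n \<Rightarrow> 'b" where
  "partial j f x = frechet_derivative f (at x) (axis j 1)"

definition laplacian :: "(real ^ 'n::finite \<Rightarrow> 'b::real_normed_vector) \<Rightarrow> real ^ 'n \<Rightarrow> 'b" where
  "laplacian f x = (\<Sum>j\<in>UNIV. partial j (partial j f) x)"

text \<open>The list \<open>js\<close> runs through all iterated partial derivatives.\<close>

definition schwartz :: "(real ^ 'n::finite \<Rightarrow> 'b::real_normed_vector) \<Rightarrow> bool" where
  "schwartz f \<longleftrightarrow> smooth_on UNIV f \<and>
     (\<forall>(k::nat) js. bounded (range (\<lambda>x. (norm x ^ k) *\<^sub>R foldr partial js f x)))"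


section \<open>Vector fields and the sub-Laplacian\<close>

text \<open>\<open>V f = \<Sum>\<^sub>j V\<^sub>j \<partial>\<^sub>j f\<close>\<close>

definition vf_deriv ::
  "('a::real_normed_vector \<Rightarrow> 'a) \<Rightarrow> ('a \<Rightarrow> 'b::real_normed_vector) \<Rightarrow> 'a \<Rightarrow> 'b" where
  "vf_deriv V f x = frechet_derivative f (at x) (V x)"

text \<open>Formal adjoint: integrating \<open>(V f) g\<close> by parts moves \<open>V\<close> onto \<open>g\<close> as
  \<open>g \<mapsto> - \<Sum>\<^sub>j \<partial>\<^sub>j (V\<^sub>j g)\<close>.\<close>

definition vf_adjoint ::
  "(real ^ 'n::finite \<Rightarrow> real ^ 'n) \<Rightarrow> (real ^ 'n \<Rightarrow> 'b::real_normed_vector) \<Rightarrow> real ^ 'n \<Rightarrow> 'b" where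
  "vf_adjoint V g x = - (\<Sum>j\<in>UNIV. partial j (\<lambda>y. (V y $ j) *\<^sub>R g y) x)"

definition sub_laplacian ::
  "('m::finite \<Rightarrow> real ^ 'n::finite \<Rightarrow> real ^ 'n) \<Rightarrow> (real ^ 'n \<Rightarrow> 'b::real_normed_vector) \<Rightarrow>
     real ^ 'n \<Rightarrow> 'b" where
  "sub_laplacian X f x = - (\<Sum>i\<in>UNIV. vf_adjoint (X i) (vf_deriv (X i) f) x)"

text \<open>The bracket is \<open>[V, W] = V W - W V\<close>, with components \<open>V W\<^sub>j - W V\<^sub>j\<close>.\<close>

inductive_set lie_algebra ::
  "('m \<Rightarrow> 'a::real_normed_vector \<Rightarrow> 'a) \<Rightarrow> ('a \<Rightarrow> 'a) set" for X where
  generator: "X i \<in> lie_algebra X"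
| add: "V \<in> lie_algebra X \<Longrightarrow> W \<in> lie_algebra X \<Longrightarrow> (\<lambda>x. V x + W x) \<in> lie_algebra X"
| scale: "V \<in> lie_algebra X \<Longrightarrow> (\<lambda>x. c *\<^sub>R V x) \<in> lie_algebra X"
| bracket: "V \<in> lie_algebra X \<Longrightarrow> W \<in> lie_algebra X \<Longrightarrow>
    (\<lambda>x. vf_deriv V W x - vf_deriv W V x) \<in> lie_algebra X"

definition hormander_condition :: "('m \<Rightarrow> real ^ 'n::finite \<Rightarrow> real ^ 'n) \<Rightarrow> bool" where
  "hormander_condition X \<longleftrightarrow> (\<forall>x. dim ((\<lambda>V. V x) ` lie_algebra X) = CARD('n))"


section \<open>The Carnot-Caratheodory distance\<close>

definition piecewise_continuous :: "real \<Rightarrow> real \<Rightarrow> (real \<Rightarrow> real) \<Rightarrow> bool" where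
  "piecewise_continuous a b f \<longleftrightarrow>
     (\<exists>S. finite S \<and> continuous_on ({a..b} - S) f) \<and>
     (\<forall>t\<in>{a<..b}. \<exists>l. (f \<longlongrightarrow> l) (at_left t)) \<and> (\<forall>t\<in>{a..<b}. \<exists>l. (f \<longlongrightarrow> l) (at_right t))"

text \<open>\<open>\<gamma>\<close> joins \<open>x\<close> to \<open>y\<close> in time \<open>T\<close> with controls \<open>a\<^sub>i\<close>; as \<open>\<gamma>\<close> is only piecewise \<open>C\<^sup>1\<close>, the
  differential equation may fail at finitely many times.\<close>

definition admissible ::
  "('m::finite \<Rightarrow> 'a::real_normed_vector \<Rightarrow> 'a) \<Rightarrow> 'a \<Rightarrow> 'a \<Rightarrow> real \<Rightarrow> (real \<Rightarrow> 'a) \<Rightarrow>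
     ('m \<Rightarrow> real \<Rightarrow> real) \<Rightarrow> bool" where
  "admissible X x y T \<gamma> a \<longleftrightarrow>
     0 \<le> T \<and> \<gamma> piecewise_C1_differentiable_on {0..T} \<and> \<gamma> 0 = x \<and> \<gamma> T = y \<and>
     (\<forall>i. piecewise_continuous 0 T (a i)) \<and>
     (\<forall>t\<in>{0..T}. (\<Sum>i\<in>UNIV. \<bar>a i t\<bar>) \<le> 1) \<and>
     (\<exists>S. finite S \<and>
        (\<forall>t\<in>{0..T} - S. (\<gamma> has_vector_derivative (\<Sum>i\<in>UNIV. a i t *\<^sub>R X i (\<gamma> t))) (at t)))"

text \<open>The infimum is over a nonempty set under Hormander's condition (Chow-Rashevskii).\<close>

definition cc_dist ::
  "('m::finite \<Rightarrow> 'a::real_normed_vector \<Rightarrow> 'a) \<Rightarrow> 'a \<Rightarrow> 'a \<Rightarrow> real" where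
  "cc_dist X x y = Inf {T. \<exists>\<gamma> a. admissible X x y T \<gamma> a}"

definition cc_ball ::
  "('m::finite \<Rightarrow> 'a::real_normed_vector \<Rightarrow> 'a) \<Rightarrow> 'a \<Rightarrow> real \<Rightarrow> 'a set" where
  "cc_ball X x r = {y. cc_dist X x y < r}"


section \<open>The heat kernel\<close>

text \<open>\<open>p x \<xi> (t - \<tau>)\<close> is the fundamental solution of \<open>\<partial>\<^sub>t - L\<close> with pole \<open>(\<xi>, \<tau>)\<close>, extended by zero to
  \<open>t \<le> \<tau>\<close>. Since \<open>L\<close> is formally self-adjoint, the adjoint of \<open>\<partial>\<^sub>t - L\<close> is \<open>- \<partial>\<^sub>t - L\<close>.\<close>

definition heat_fundamental_solution ::
  "('m::finite \<Rightarrow> real ^ 'n::finite \<Rightarrow> real ^ 'n) \<Rightarrow>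
     (real ^ 'n \<Rightarrow> real ^ 'n \<Rightarrow> real \<Rightarrow> real) \<Rightarrow> bool" where
  "heat_fundamental_solution X p \<longleftrightarrow>
     (\<forall>x \<xi> t. (0 < t \<longrightarrow> 0 < p x \<xi> t) \<and> (t \<le> 0 \<longrightarrow> p x \<xi> t = 0)) \<and>
     (\<forall>\<xi> \<tau>. smooth_on (- {(\<xi>, \<tau>)}) (\<lambda>(x, t). p x \<xi> (t - \<tau>))) \<and>
     (\<forall>\<xi> \<tau> K. compact K \<longrightarrow> set_integrable lborel K (\<lambda>(x, t). p x \<xi> (t - \<tau>))) \<and>
     (\<forall>\<xi> \<tau> (\<phi> :: (real ^ 'n) \<times> real \<Rightarrow> real). test_function \<phi> \<longrightarrow>
        (LINT (x, t)|lborel. p x \<xi> (t - \<tau>) *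
           (- deriv (\<lambda>r. \<phi> (x, r)) t - sub_laplacian X (\<lambda>y. \<phi> (y, t)) x)) = \<phi> (\<xi>, \<tau>))"

definition heat_kernel_bounds ::
  "('m::finite \<Rightarrow> real ^ 'n::finite \<Rightarrow> real ^ 'n) \<Rightarrow>
     (real ^ 'n \<Rightarrow> real ^ 'n \<Rightarrow> real \<Rightarrow> real) \<Rightarrow> bool" where
  "heat_kernel_bounds X p \<longleftrightarrow>
     (\<exists>M>0.
        (\<forall>k j. \<exists>C>0. \<forall>js x y t. length js = j \<longrightarrow> 0 < t \<longrightarrow>
           \<bar>(deriv ^^ k) (\<lambda>r. foldr (\<lambda>i. vf_deriv (X i)) js (\<lambda>x'. p x' y r) x) t\<bar>
             \<le> C / (t powr (real k + real j / 2) * measure lborel (cc_ball X x (sqrt t)))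
                 * exp (- M * (cc_dist X x y)\<^sup>2 / t)) \<and>
        (\<exists>C>0. \<forall>x y t. 0 < t \<longrightarrow>
           inverse C / measure lborel (cc_ball X x (sqrt t))
               * exp (- inverse M * (cc_dist X x y)\<^sup>2 / t) \<le> p x y t))"


section \<open>The heat semigroup\<close>

definition heat_op ::
  "('a::euclidean_space \<Rightarrow> 'a \<Rightarrow> real \<Rightarrow> real) \<Rightarrow> real \<Rightarrow> ('a \<Rightarrow> complex) \<Rightarrow> 'a \<Rightarrow> complex" where
  "heat_op p t u x = (LINT y|lborel. p x y t *\<^sub>R u y)"

definition heat_semigroup ::
  "('a::euclidean_space \<Rightarrow> 'a \<Rightarrow> real \<Rightarrow> real) \<Rightarrow> real \<Rightarrow> 'a L2 \<Rightarrow> 'a L2" where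
  "heat_semigroup p t F = (if t = 0 then F else to_L2 (heat_op p t (L2_fun F)))"

definition contraction_semigroup :: "(real \<Rightarrow> 'h::real_normed_vector \<Rightarrow> 'h) \<Rightarrow> bool" where
  "contraction_semigroup P \<longleftrightarrow>
     (\<forall>F. P 0 F = F) \<and>
     (\<forall>t\<ge>0. \<forall>r\<ge>0. \<forall>F. P (t + r) F = P t (P r F)) \<and>
     (\<forall>t\<ge>0. linear (P t)) \<and>
     (\<forall>t\<ge>0. \<forall>F. norm (P t F) \<le> norm F) \<and>
     (\<forall>F. ((\<lambda>t. P t F) \<longlongrightarrow> F) (at_right 0))"

text \<open>\<open>F\<close> lies in the domain of the infinitesimal generator, which maps it to \<open>G\<close>.\<close>

definition generator_rel ::
  "(real \<Rightarrow> 'h::real_normed_vector \<Rightarrow> 'h) \<Rightarrow> 'h \<Rightarrow> 'h \<Rightarrow> bool" where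
  "generator_rel P F G \<longleftrightarrow> ((\<lambda>t. (P t F - F) /\<^sub>R t) \<longlongrightarrow> G) (at_right 0)"

text \<open>\<open>L F = G\<close> in the sense of distributions, \<open>L\<close> being formally self-adjoint.\<close>

definition sub_laplacian_L2 ::
  "('m::finite \<Rightarrow> real ^ 'n::finite \<Rightarrow> real ^ 'n) \<Rightarrow> (real ^ 'n) L2 \<Rightarrow> (real ^ 'n) L2 \<Rightarrow> bool" where
  "sub_laplacian_L2 X F G \<longleftrightarrow>
     (\<forall>\<phi>. test_function \<phi> \<longrightarrow>
        (LINT x|lborel. L2_fun F x * sub_laplacian X \<phi> x) = (LINT x|lborel. L2_fun G x * \<phi> x))"

text \<open>The first clause makes \<^const>\<open>heat_semigroup\<close> the operator on \<open>L\<^sup>2\<close> given by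
  \<^const>\<open>heat_op\<close>. Symmetry for the real inner product gives self-adjointness for the Hermitian one,
  as the operators are complex linear. In the last clause the domain of \<open>L\<close> is its maximal one in \<open>L\<^sup>2\<close>.\<close>

definition heat_semigroup_facts ::
  "('m::finite \<Rightarrow> real ^ 'n::finite \<Rightarrow> real ^ 'n) \<Rightarrow>
     (real ^ 'n \<Rightarrow> real ^ 'n \<Rightarrow> real \<Rightarrow> real) \<Rightarrow> bool" where
  "heat_semigroup_facts X p \<longleftrightarrow>
     (\<forall>t>0. \<forall>f. square_integrable f \<longrightarrow> square_integrable (heat_op p t f)) \<and>
     contraction_semigroup (heat_semigroup p) \<and>
     (\<forall>t\<ge>0. \<forall>F G. heat_semigroup p t F \<bullet> G = F \<bullet> heat_semigroup p t G) \<and>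
     (\<forall>F G. generator_rel (heat_semigroup p) F G \<longleftrightarrow> sub_laplacian_L2 X F G)"


section \<open>The fractional sub-Laplacian and the Poisson kernel\<close>

definition frac_sub_laplacian ::
  "('a::euclidean_space \<Rightarrow> 'a \<Rightarrow> real \<Rightarrow> real) \<Rightarrow> real \<Rightarrow> ('a \<Rightarrow> complex) \<Rightarrow> 'a L2" where
  "frac_sub_laplacian p s u =
     - (s / Gamma (1 - s)) *\<^sub>R
       (LINT t:{0<..}|lborel. t powr (- s - 1) *\<^sub>R (heat_semigroup p t (to_L2 u) - to_L2 u))"

definition poisson_kernel ::
  "('a \<Rightarrow> 'a \<Rightarrow> real \<Rightarrow> real) \<Rightarrow> real \<Rightarrow> real \<Rightarrow> 'a \<Rightarrow> 'a \<Rightarrow> real" where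
  "poisson_kernel p a z x y =
     1 / (2 powr (1 - a) * Gamma ((1 - a) / 2)) * z powr (1 - a) *
       (LINT t:{0<..}|lborel. exp (- z\<^sup>2 / (4 * t)) / t powr ((3 - a) / 2) * p x y t)"

end

theory Submission
  imports Defs
begin

text \<open>By Fubini, \<open>U(\<cdot>, z)\<close> is a multiple of \<open>\<integral> k(z, t) P\<^sub>t u dt\<close> with \<open>k(z, t) = z powr (2 s) exp (- z\<^sup>2 / 4 t) t powr (- s - 1)\<close>.
  The mass \<open>\<integral> k(z, t) dt\<close> is independent of \<open>z\<close> by scaling, so \<open>z powr a \<partial>\<^sub>z U\<close> is the same multiple of
  \<open>\<integral> (2 s - z\<^sup>2 / 2 t) exp (- z\<^sup>2 / 4 t) t powr (- s - 1) (P\<^sub>t u - u) dt\<close>, where the scalar factor is bounded by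
  \<open>4 t powr (- s - 1)\<close> and tends to \<open>2 s t powr (- s - 1)\<close>. Dominated convergence in \<open>L\<^sup>2\<close> gives the claim because
  \<open>\<parallel>P\<^sub>t u - u\<parallel> \<le> D min(t, 1)\<close>: the function \<open>u\<close> lies in the domain of the generator, as \<open>L u\<close> is square
  integrable (\<open>L\<close> is the Laplacian far out) and \<open>L\<close> is symmetric against test functions.\<close>

section \<open>Smooth functions and symmetry of the sub-Laplacian\<close>

text \<open>The function u is subtracted because t powr (- s - 1) is not integrable at 0, whereas
  its product with min(t, 1) is integrable exactly for 0 < s < 1. Strong continuity of the semigroup
  would not supply this factor; membership of u in the domain of the generator does. It is
  accessible because the hypotheses identify the generator with L on its maximal domain, so a
  distributional identity suffices. A second obstacle is that U and its z-derivative are pointwise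
  in x, while the limit and the fractional power live among classes of functions. Differentiation is
  therefore carried out at fixed x for scalar integrals, and only afterwards is the class of the
  resulting function recognised as a Bochner integral (\<open>to_L2_integral\<close>). This and
  Fubini require joint measurability of the kernel. The hypotheses give smoothness of
  \<open>p\<close> in (x, t) for each fixed pole; measurability in the pole is extracted from the
  unit mass, and \<open>measurable_Caratheodory\<close> joins the two.\<close>

lemma C_k_on_SucD: "C_k_on (Suc k) S f \<Longrightarrow> C_k_on k S f"
proof (induction k arbitrary: f)
  case 0
  then have "f differentiable_on S"
    by (auto simp: differentiable_on_def intro: differentiable_at_withinI)
  then show ?case
    by (simp add: differentiable_imp_continuous_on)
next
  case (Suc k)
  have *: "\<forall>x\<in>S. f differentiable (at x)" "\<forall>v. C_k_on (Suc k) S (\<lambda>x. frechet_derivative f (at x) v)"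
    using C_k_on.simps(2)[THEN iffD1, OF Suc.prems] by blast+
  show ?case
    unfolding C_k_on.simps(2)[of k] using * Suc.IH by blast
qed

lemma C_k_on_const: "C_k_on k S (\<lambda>x. c)"
  by (induction k arbitrary: c) auto

lemma C_k_on_add:
  "C_k_on k UNIV f \<Longrightarrow> C_k_on k UNIV g \<Longrightarrow> C_k_on k UNIV (\<lambda>x. f x + g x)"
proof (induction k arbitrary: f g)
  case 0
  then show ?case by (auto intro: continuous_on_add)
next
  case (Suc k)
  have d: "f differentiable (at x)" "g differentiable (at x)" for x using Suc.prems by auto
  have "frechet_derivative (\<lambda>x. f x + g x) (at x) v =
      frechet_derivative f (at x) v + frechet_derivative g (at x) v" for x v
    by (subst frechet_derivative_at[OF has_derivative_add[OF d[THEN frechet_derivative_works[THEN iffD1]]], symmetric]) simp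
  then show ?case using Suc.prems d by (simp add: Suc.IH)
qed

text \<open>By the Leibniz rule a directional derivative is a sum of two terms of the same shape;
  the factor left undifferentiated is lowered by \<open>C_k_on_SucD\<close> to meet the induction
  hypothesis. A general bilinear map covers scalar multiplication and products together.\<close>

lemma C_k_on_bilinear:
  fixes B :: "'b::real_normed_vector \<Rightarrow> 'c::real_normed_vector \<Rightarrow> 'd::real_normed_vector"
  assumes B: "bounded_bilinear B"
  shows "C_k_on k UNIV f \<Longrightarrow> C_k_on k UNIV g \<Longrightarrow> C_k_on k UNIV (\<lambda>x. B (f x) (g x))"
proof (induction k arbitrary: f g)
  case 0
  then show ?case
    using bounded_bilinear.continuous_on[OF B] by auto
next
  case (Suc k)
  have d: "f differentiable (at x)" "g differentiable (at x)" for x using Suc.prems by auto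
  note D = bounded_bilinear.FDERIV[OF B d[THEN frechet_derivative_works[THEN iffD1]]]
  have "frechet_derivative (\<lambda>x. B (f x) (g x)) (at x) v =
      B (f x) (frechet_derivative g (at x) v) + B (frechet_derivative f (at x) v) (g x)" for x v
    by (subst frechet_derivative_at[OF D, symmetric]) simp
  moreover have "(\<lambda>x. B (f x) (g x)) differentiable (at x)" for x
    using D by (rule differentiableI)
  ultimately show ?case
    using Suc.prems C_k_on_SucD[OF Suc.prems(1)] C_k_on_SucD[OF Suc.prems(2)]
    by (simp add: C_k_on_add Suc.IH)
qed

lemma C_k_on_linear:
  assumes L: "bounded_linear L"
  shows "C_k_on k UNIV f \<Longrightarrow> C_k_on k UNIV (\<lambda>x. L (f x))"
proof (induction k arbitrary: f)
  case 0
  then show ?case using bounded_linear.continuous_on[OF L] by auto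
next
  case (Suc k)
  have d: "f differentiable (at x)" for x using Suc.prems by auto
  note D = bounded_linear.has_derivative[OF L d[THEN frechet_derivative_works[THEN iffD1]]]
  have "frechet_derivative (\<lambda>x. L (f x)) (at x) v = L (frechet_derivative f (at x) v)" for x v
    by (subst frechet_derivative_at[OF D, symmetric]) simp
  moreover have "(\<lambda>x. L (f x)) differentiable (at x)" for x
    using D by (rule differentiableI)
  ultimately show ?case using Suc.prems by (simp add: Suc.IH)
qed

lemma smooth_on_add:
  "smooth_on UNIV f \<Longrightarrow> smooth_on UNIV g \<Longrightarrow> smooth_on UNIV (\<lambda>x. f x + g x)"
  by (simp add: smooth_on_def C_k_on_add)

lemma smooth_on_scaleR:
  "smooth_on UNIV f \<Longrightarrow> smooth_on UNIV g \<Longrightarrow> smooth_on UNIV (\<lambda>x. f x *\<^sub>R g x)"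
  by (simp add: smooth_on_def C_k_on_bilinear[OF bounded_bilinear_scaleR])

lemma smooth_on_mult:
  fixes f g :: "'a::real_normed_vector \<Rightarrow> 'b::real_normed_algebra"
  shows "smooth_on UNIV f \<Longrightarrow> smooth_on UNIV g \<Longrightarrow> smooth_on UNIV (\<lambda>x. f x * g x)"
  by (simp add: smooth_on_def C_k_on_bilinear[OF bounded_bilinear_mult])

lemma smooth_on_vec_nth: "smooth_on UNIV f \<Longrightarrow> smooth_on UNIV (\<lambda>x. f x $ i)"
  by (simp add: smooth_on_def C_k_on_linear[OF bounded_linear_vec_nth])

lemma smooth_on_sum:
  "(\<And>i. i \<in> I \<Longrightarrow> smooth_on UNIV (f i)) \<Longrightarrow> smooth_on UNIV (\<lambda>x. \<Sum>i\<in>I. f i x)"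
  by (induction I rule: infinite_finite_induct)
    (simp_all add: smooth_on_add, simp_all add: smooth_on_def C_k_on_const)

lemma smooth_on_partial: "smooth_on UNIV f \<Longrightarrow> smooth_on UNIV (partial j f)"
  unfolding smooth_on_def partial_def[abs_def]
proof
  fix k assume "\<forall>k. C_k_on k UNIV f"
  then have "C_k_on (Suc k) UNIV f" ..
  then show "C_k_on k UNIV (\<lambda>x. frechet_derivative f (at x) (axis j 1))" by simp
qed

lemma smooth_on_imp_differentiable: "smooth_on UNIV f \<Longrightarrow> f differentiable (at x)"
  unfolding smooth_on_def by (drule spec[of _ "Suc 0"]) simp

lemma smooth_on_imp_continuous_on: "smooth_on UNIV f \<Longrightarrow> continuous_on UNIV f"
  unfolding smooth_on_def by (drule spec[of _ 0]) simp

lemma smooth_on_imp_measurable: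
  "smooth_on UNIV f \<Longrightarrow> f \<in> borel_measurable borel"
  by (intro borel_measurable_continuous_onI smooth_on_imp_continuous_on)

lemma has_derivative_smooth:
  "smooth_on UNIV f \<Longrightarrow> (f has_derivative frechet_derivative f (at x)) (at x)"
  using smooth_on_imp_differentiable frechet_derivative_works by blast

text \<open>In \<open>vf_deriv\<close> the direction \<open>V x\<close> moves with the point, while
  \<open>C_k_on\<close> speaks of fixed directions only. Expanding in coordinates separates the two
  and reduces smoothness to that of products.\<close>

lemma vf_deriv_eq_sum_partial:
  fixes f :: "real ^ 'n::finite \<Rightarrow> 'b::real_normed_vector"
  assumes "smooth_on UNIV f"
  shows "vf_deriv V f x = (\<Sum>j\<in>UNIV. V x $ j *\<^sub>R partial j f x)"
proof -
  interpret linear "frechet_derivative f (at x)"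
    using has_derivative_linear[OF has_derivative_smooth[OF assms]] .
  have "frechet_derivative f (at x) (V x) = frechet_derivative f (at x) (\<Sum>j\<in>UNIV. V x $ j *\<^sub>R axis j 1)"
    by (simp add: basis_expansion flip: scalar_mult_eq_scaleR)
  then show ?thesis by (simp add: vf_deriv_def partial_def sum scale)
qed

lemma smooth_on_vf_deriv:
  fixes f :: "real ^ 'n::finite \<Rightarrow> 'b::real_normed_vector"
  assumes "smooth_on UNIV V" "smooth_on UNIV f"
  shows "smooth_on UNIV (vf_deriv V f)"
  unfolding vf_deriv_eq_sum_partial[OF assms(2), abs_def]
  by (intro smooth_on_sum smooth_on_scaleR smooth_on_vec_nth smooth_on_partial assms)

lemma partial_mult:
  fixes f g :: "real ^ 'n::finite \<Rightarrow> 'b::real_normed_algebra"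
  assumes "smooth_on UNIV f" "smooth_on UNIV g"
  shows "partial j (\<lambda>x. f x * g x) x = f x * partial j g x + partial j f x * g x"
  unfolding partial_def
  by (subst frechet_derivative_at[OF has_derivative_mult[OF assms[THEN has_derivative_smooth]], symmetric]) simp

lemma smooth_on_sub_laplacian:
  assumes "\<And>i. smooth_on UNIV (X i)" "smooth_on UNIV f"
  shows "smooth_on UNIV (sub_laplacian X f)"
  unfolding sub_laplacian_def[abs_def] vf_adjoint_def sum_negf minus_minus
  by (intro smooth_on_sum smooth_on_partial smooth_on_scaleR smooth_on_vec_nth smooth_on_vf_deriv assms)

section \<open>Integration by parts for products of bounded support\<close>

lemma integrable_smooth_bounded_support:
  fixes h :: "'a::euclidean_space \<Rightarrow> 'b::{banach, second_countable_topology}"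
  assumes "smooth_on UNIV h" "bounded {x. h x \<noteq> 0}"
  shows "integrable lborel h"
proof -
  obtain R where R: "\<And>x. h x \<noteq> 0 \<Longrightarrow> norm x \<le> R"
    using assms(2) by (auto simp: bounded_iff)
  have "integrable lborel (\<lambda>x. indicator (cball 0 R) x *\<^sub>R h x)"
    by (intro borel_integrable_compact)
      (auto intro: continuous_on_subset smooth_on_imp_continuous_on[OF assms(1)])
  also have "(\<lambda>x. indicator (cball 0 R) x *\<^sub>R h x) = h"
    using R by (auto simp: indicator_def fun_eq_iff)
  finally show ?thesis .
qed

lemma lborel_integral_translate:
  fixes h :: "'a::euclidean_space \<Rightarrow> 'b::{banach, second_countable_topology}"
  assumes h: "integrable lborel h"
  shows "integrable lborel (\<lambda>x. h (x + c)) \<and> (LINT x|lborel. h (x + c)) = (LINT x|lborel. h x)"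
proof -
  have m: "h \<in> borel_measurable borel" and m': "(+) c \<in> measurable lborel borel"
    using borel_measurable_integrable[OF h] by simp_all
  show ?thesis
    using integrable_distr_eq[OF m' m] integral_distr[OF m' m] h
    unfolding lborel_distr_plus by (simp add: add.commute[of _ c])
qed

text \<open>Dominated convergence acts on difference quotients, so derivatives are put in this form,
  both for partial derivatives and for derivatives under the integral sign.\<close>

lemma has_vector_derivative_within_slope:
  "(f has_vector_derivative D) (at x within S) \<longleftrightarrow>
    ((\<lambda>y. inverse (y - x) *\<^sub>R (f y - f x)) \<longlongrightarrow> D) (at x within S)"
proof -
  have "\<forall>\<^sub>F y in at x within S. norm ((f y - f x) - (y - x) *\<^sub>R D) / norm (y - x)
      = norm (inverse (y - x) *\<^sub>R (f y - f x) - D)"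
    unfolding eventually_at_filter
  proof (intro always_eventually allI impI)
    fix y assume "y \<noteq> x"
    then have "inverse (y - x) *\<^sub>R (f y - f x) - D = inverse (y - x) *\<^sub>R ((f y - f x) - (y - x) *\<^sub>R D)"
      by (simp add: scaleR_diff_right)
    then show "norm ((f y - f x) - (y - x) *\<^sub>R D) / norm (y - x) = norm (inverse (y - x) *\<^sub>R (f y - f x) - D)"
      by (simp add: divide_inverse mult.commute)
  qed
  then show ?thesis
    unfolding has_vector_derivative_def has_derivative_iff_norm
    by (simp add: tendsto_cong bounded_linear_scaleR_left tendsto_norm_zero_iff LIM_zero_iff)
qed

text \<open>The integral of a difference quotient vanishes by translation invariance.\<close>

lemma integral_partial_eq_0:
  fixes h :: "real ^ 'n::finite \<Rightarrow> 'b::{banach, second_countable_topology}"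
  assumes h: "smooth_on UNIV h" and supp: "bounded {x. h x \<noteq> 0}"
  shows "integrable lborel (partial j h)" "(LINT x|lborel. partial j h x) = 0"
proof -
  obtain R where R: "\<And>x. h x \<noteq> 0 \<Longrightarrow> norm x \<le> R" and "R > 0"
    using supp by (auto simp: bounded_pos)
  define e :: "real ^ 'n" where "e = axis j 1"
  have norm_e: "norm e = 1" by (simp add: e_def)
  have contp: "continuous_on UNIV (partial j h)"
    by (intro smooth_on_imp_continuous_on smooth_on_partial h)
  then have "compact (partial j h ` cball 0 (R + 1))"
    by (intro compact_continuous_image) (auto intro: continuous_on_subset)
  then obtain M where "\<forall>x\<in>cball 0 (R + 1). norm (partial j h x) \<le> M"
    by (auto dest!: compact_imp_bounded simp: bounded_iff)
  then have M0: "norm x \<le> R + 1 \<Longrightarrow> norm (partial j h x) \<le> M" for x by simp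
  have der: "((\<lambda>t. h (x + t *\<^sub>R e)) has_vector_derivative partial j h (x + t *\<^sub>R e)) (at t)" for x t
  proof -
    have "((\<lambda>t. x + t *\<^sub>R e) has_vector_derivative e) (at t)"
      by (auto intro!: derivative_eq_intros)
    from vector_derivative_diff_chain_within[OF this, of h "frechet_derivative h (at (x + t *\<^sub>R e))"]
    show ?thesis
      using has_derivative_at_withinI[OF has_derivative_smooth[OF h]]
      by (simp add: o_def partial_def e_def)
  qed
  have zero: "partial j h x = 0" if "norm x > R" for x
  proof -
    have "open {x :: real ^ 'n. R < norm x}" by (intro open_Collect_less continuous_intros)
    moreover have "h y = 0" if "y \<in> {x. R < norm x}" for y
      using R[of y] that by (cases "h y = 0") auto
    ultimately have "(h has_derivative (\<lambda>_. 0)) (at x)"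
      by (intro has_derivative_transform_within_open[OF has_derivative_const]) (use that in auto)
    then show ?thesis by (simp add: partial_def flip: frechet_derivative_at)
  qed
  have M: "norm (partial j h x) \<le> M" for x
  proof (cases "norm x \<le> R + 1")
    case False
    then have "partial j h x = 0" by (intro zero) simp
    moreover have "norm (partial j h 0) \<le> M" using \<open>R > 0\<close> by (intro M0) simp
    then have "0 \<le> M" by (rule order_trans[OF norm_ge_zero])
    ultimately show ?thesis by simp
  qed (rule M0)
  have "M \<ge> 0" using M[of 0] norm_ge_zero order_trans by blast
  define \<epsilon> where "\<epsilon> n = 1 / real (Suc n)" for n
  have eps: "0 < \<epsilon> n" "\<epsilon> n \<le> 1" for n by (auto simp: \<epsilon>_def)
  define q where "q n x = (h (x + \<epsilon> n *\<^sub>R e) - h x) /\<^sub>R \<epsilon> n" for n x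
  have meas: "h \<in> borel_measurable borel" using h by (rule smooth_on_imp_measurable)
  \<comment> \<open>The shift has length at most 1, so \<open>q n\<close> vanishes beyond radius
    \<open>R + 1\<close>; inside, the mean value inequality along the line in direction
    \<open>e\<close> gives \<open>M\<close>. One integrable bound thus serves all
    \<open>n\<close>.\<close>
  have qbound: "norm (q n x) \<le> M * indicator (cball 0 (R + 1)) x" for n x
  proof (cases "norm x \<le> R + 1")
    case True
    have "norm (h (x + \<epsilon> n *\<^sub>R e) - h (x + 0 *\<^sub>R e)) \<le> M * norm (\<epsilon> n - 0)"
    proof (rule differentiable_bound[where S = UNIV and f' = "\<lambda>t y. y *\<^sub>R partial j h (x + t *\<^sub>R e)"])
      show "((\<lambda>t. h (x + t *\<^sub>R e)) has_derivative (\<lambda>y. y *\<^sub>R partial j h (x + t *\<^sub>R e))) (at t within UNIV)" for t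
        using der by (simp add: has_vector_derivative_def)
      show "onorm (\<lambda>y. y *\<^sub>R partial j h (x + t *\<^sub>R e)) \<le> M" for t
        by (rule onorm_le) (use M in \<open>auto simp: mult.commute[of M] intro!: mult_left_mono\<close>)
    qed auto
    moreover have "norm (q n x) = norm (h (x + \<epsilon> n *\<^sub>R e) - h x) / \<epsilon> n"
      using eps(1)[of n] by (simp add: q_def divide_inverse mult.commute)
    ultimately show ?thesis using True eps(1)[of n] by (simp add: pos_divide_le_eq)
  next
    case False
    have "norm x \<le> norm (x + \<epsilon> n *\<^sub>R e) + norm (\<epsilon> n *\<^sub>R e)"
      using norm_triangle_ineq4[of "x + \<epsilon> n *\<^sub>R e" "\<epsilon> n *\<^sub>R e"] by simp
    then have "norm (x + \<epsilon> n *\<^sub>R e) > R"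
      using False eps[of n] by (simp add: norm_e)
    then have "h (x + \<epsilon> n *\<^sub>R e) = 0" "h x = 0"
      using R[of x] R[of "x + \<epsilon> n *\<^sub>R e"] False by (auto simp: not_le)
    then show ?thesis using False by (simp add: q_def)
  qed
  have int: "integrable lborel (\<lambda>x::real^'n. M * indicator (cball 0 (R + 1)) x)"
    by (intro integrable_mult_right integrable_real_indicator) (use emeasure_lborel_cball_finite[of 0 "R + 1"] in simp_all)
  have lim: "(\<lambda>n. q n x) \<longlonglongrightarrow> partial j h x" for x
  proof -
    have "((\<lambda>t. (h (x + t *\<^sub>R e) - h x) /\<^sub>R t) \<longlongrightarrow> partial j h x) (at 0)"
      using der[of x 0] unfolding has_vector_derivative_within_slope by simp
    moreover have "filterlim \<epsilon> (at 0) sequentially"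
      unfolding filterlim_at \<epsilon>_def using LIMSEQ_inverse_real_of_nat
      by (auto simp: inverse_eq_divide)
    ultimately show ?thesis unfolding q_def by (rule filterlim_compose)
  qed
  have hint: "integrable lborel h"
    using h supp by (rule integrable_smooth_bounded_support)
  have trans: "has_bochner_integral lborel (\<lambda>x. h (x + c)) (LINT x|lborel. h x)" for c
    using lborel_integral_translate[OF hint, of c] by (simp add: has_bochner_integral_iff)
  have int0: "(LINT x|lborel. q n x) = 0" for n
    using trans[of "\<epsilon> n *\<^sub>R e"] hint unfolding q_def
    by (simp add: has_bochner_integral_iff)
  have [measurable]: "h \<in> borel_measurable borel" "partial j h \<in> borel_measurable borel"
    using meas smooth_on_imp_measurable[OF smooth_on_partial[OF h]] by auto
  have [measurable]: "q n \<in> borel_measurable borel" for n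
    unfolding q_def by measurable
  show "integrable lborel (partial j h)"
    by (rule integrable_dominated_convergence[where s = q, OF _ _ int]) (auto simp: lim qbound)
  have "(\<lambda>n. LINT x|lborel. q n x) \<longlonglongrightarrow> (LINT x|lborel. partial j h x)"
    by (rule integral_dominated_convergence[OF _ _ int]) (auto simp: lim qbound)
  then show "(LINT x|lborel. partial j h x) = 0"
    by (simp add: int0 LIMSEQ_const_iff)
qed

text \<open>Off the closure \<open>h\<close> vanishes on a neighbourhood. The closure cannot be
  dropped: a derivative may be nonzero at an isolated zero of \<open>h\<close>.\<close>

lemma partial_neq_0_in_closure:
  fixes h :: "real ^ 'n::finite \<Rightarrow> 'b::real_normed_vector"
  assumes "partial j h x \<noteq> 0"
  shows "x \<in> closure {x. h x \<noteq> 0}"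
proof (rule ccontr)
  assume "x \<notin> closure {x. h x \<noteq> 0}"
  then have x: "x \<in> - closure {x. h x \<noteq> 0}" by simp
  have "0 = h y" if "y \<in> - closure {x. h x \<noteq> 0}" for y
    using subsetD[OF closure_subset, of y "{x. h x \<noteq> 0}"] that by fastforce
  then have "(h has_derivative (\<lambda>_. 0)) (at x)"
    by (rule has_derivative_transform_within_open[OF has_derivative_const open_Compl[OF closed_closure] x])
  then have "frechet_derivative h (at x) = (\<lambda>_. 0)"
    by (rule frechet_derivative_at[symmetric])
  then show False
    using assms by (simp add: partial_def)
qed

text \<open>The integral of the derivative of the product vanishes. Bounded support is asked of the
  product only, so either factor may be the compactly supported one.\<close>

lemma integral_by_parts:
  fixes f g :: "real ^ 'n::finite \<Rightarrow> complex"
  assumes f: "smooth_on UNIV f" and g: "smooth_on UNIV g"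
    and supp: "bounded {x. f x * g x \<noteq> 0}"
    and int: "integrable lborel (\<lambda>x. f x * partial j g x)"
  shows "integrable lborel (\<lambda>x. partial j f x * g x)"
    "(LINT x|lborel. partial j f x * g x) = - (LINT x|lborel. f x * partial j g x)"
proof -
  have eq: "partial j f x * g x = partial j (\<lambda>x. f x * g x) x - f x * partial j g x" for x
    by (simp add: partial_mult[OF f g])
  note * = integral_partial_eq_0[OF smooth_on_mult[OF f g] supp, of j]
  show "integrable lborel (\<lambda>x. partial j f x * g x)"
    unfolding eq using *(1) int by (rule Bochner_Integration.integrable_diff)
  show "(LINT x|lborel. partial j f x * g x) = - (LINT x|lborel. f x * partial j g x)"
    unfolding eq Bochner_Integration.integral_diff[OF *(1) int] *(2) by (rule diff_0)
qed

text \<open>A Green identity: one of the two vector fields in each summand of L is moved onto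
  \<open>f\<close>. Right-hand side and support condition are symmetric in \<open>f\<close> and
  \<open>g\<close>, so two applications yield the symmetry of L.\<close>

lemma integral_mult_sub_laplacian:
  fixes X :: "'m::finite \<Rightarrow> real ^ 'n::finite \<Rightarrow> real ^ 'n" and f g :: "real ^ 'n \<Rightarrow> complex"
  assumes X: "\<And>i. smooth_on UNIV (X i)" and f: "smooth_on UNIV f" and g: "smooth_on UNIV g"
    and supp: "bounded S" "{x. f x \<noteq> 0} \<subseteq> S \<or> {x. g x \<noteq> 0} \<subseteq> S"
  shows "(LINT x|lborel. f x * sub_laplacian X g x)
    = - (\<Sum>i\<in>UNIV. LINT x|lborel. vf_deriv (X i) f x * vf_deriv (X i) g x)"
proof -
  \<comment> \<open>Handles both cases of the support condition at once: whichever factor lives in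
    \<open>S\<close>, a function confined to both closures has bounded support.\<close>
  have supp': "bounded {x. A x \<noteq> 0}" if "\<And>x. A x \<noteq> 0 \<Longrightarrow> x \<in> closure {x. f x \<noteq> 0} \<and> x \<in> closure {x. g x \<noteq> 0}"
    for A :: "real ^ 'n \<Rightarrow> complex"
  proof -
    have "{x. A x \<noteq> 0} \<subseteq> closure S"
      using that supp(2) closure_mono[of _ S] by blast
    then show ?thesis using supp(1) bounded_subset bounded_closure by blast
  qed
  \<comment> \<open>The component \<open>j\<close> of the vector field (X_i g) X_i, whose divergence
    is \<open>- vf_adjoint (X i) (vf_deriv (X i) g)\<close>.\<close>
  define W where "W i j x = X i x $ j *\<^sub>R vf_deriv (X i) g x" for i j x
  have W: "smooth_on UNIV (W i j)" for i j
    unfolding W_def[abs_def] by (intro smooth_on_scaleR smooth_on_vec_nth smooth_on_vf_deriv X g)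
  have vfg: "x \<in> closure {x. g x \<noteq> 0}" if "vf_deriv (X i) g x \<noteq> 0" for i x
  proof (rule ccontr)
    assume "x \<notin> closure {x. g x \<noteq> 0}"
    then have "partial j g x = 0" for j using partial_neq_0_in_closure by blast
    then show False using that by (simp add: vf_deriv_eq_sum_partial[OF g])
  qed
  have fcl: "f x \<noteq> 0 \<Longrightarrow> x \<in> closure {x. f x \<noteq> 0}" for x
    using closure_subset[of "{x. f x \<noteq> 0}"] by auto
  have Wcl: "x \<in> closure {x. g x \<noteq> 0}" if "x \<in> closure {x. W i j x \<noteq> 0}" for i j x
  proof -
    have "{x. W i j x \<noteq> 0} \<subseteq> closure {x. g x \<noteq> 0}"
      using vfg by (auto simp: W_def)
    then show ?thesis using that closure_minimal by blast
  qed
  have int1: "integrable lborel (\<lambda>x. partial j f x * W i j x)" for i j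
    by (intro integrable_smooth_bounded_support smooth_on_mult smooth_on_partial f W supp')
      (use partial_neq_0_in_closure vfg in \<open>auto simp: W_def\<close>)
  have int2: "integrable lborel (\<lambda>x. f x * partial j (W i j) x)" for i j
    by (intro integrable_smooth_bounded_support smooth_on_mult smooth_on_partial f W supp')
      (use partial_neq_0_in_closure[of j "W i j"] Wcl fcl in auto)
  have parts: "(LINT x|lborel. f x * partial j (W i j) x) = - (LINT x|lborel. partial j f x * W i j x)" for i j
  proof -
    have "bounded {x. f x * W i j x \<noteq> 0}"
      by (rule supp') (use fcl vfg in \<open>auto simp: W_def\<close>)
    then show ?thesis
      using integral_by_parts(2)[OF f W _ int2, of i j] by simp
  qed
  have "f x * sub_laplacian X g x = (\<Sum>i\<in>UNIV. \<Sum>j\<in>UNIV. f x * partial j (W i j) x)" for x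
    by (simp add: sub_laplacian_def vf_adjoint_def W_def[abs_def] sum_negf sum_distrib_left)
  then have "(LINT x|lborel. f x * sub_laplacian X g x) = (\<Sum>i\<in>UNIV. \<Sum>j\<in>UNIV. LINT x|lborel. f x * partial j (W i j) x)"
    by (simp add: int2)
  also have "\<dots> = - (\<Sum>i\<in>UNIV. \<Sum>j\<in>UNIV. LINT x|lborel. partial j f x * W i j x)"
    by (simp add: parts sum_negf)
  also have "(\<Sum>i\<in>UNIV. \<Sum>j\<in>UNIV. LINT x|lborel. partial j f x * W i j x)
      = (\<Sum>i\<in>UNIV. LINT x|lborel. (\<Sum>j\<in>UNIV. partial j f x * W i j x))"
    by (simp add: int1)
  also have "\<dots> = (\<Sum>i\<in>UNIV. LINT x|lborel. vf_deriv (X i) f x * vf_deriv (X i) g x)"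
    by (simp add: W_def vf_deriv_eq_sum_partial[OF f] sum_distrib_right)
  finally show ?thesis .
qed

lemma sub_laplacian_symmetric:
  fixes X :: "'m::finite \<Rightarrow> real ^ 'n::finite \<Rightarrow> real ^ 'n" and f g :: "real ^ 'n \<Rightarrow> complex"
  assumes X: "\<And>i. smooth_on UNIV (X i)" and f: "smooth_on UNIV f" and g: "test_function g"
  shows "(LINT x|lborel. f x * sub_laplacian X g x) = (LINT x|lborel. sub_laplacian X f x * g x)"
proof -
  have g': "smooth_on UNIV g"
    using g by (simp add: test_function_def)
  have b: "bounded {x. g x \<noteq> 0}"
    by (rule bounded_subset[OF compact_imp_bounded closure_subset])
      (use g in \<open>simp add: test_function_def\<close>)
  have "(LINT x|lborel. f x * sub_laplacian X g x)
      = - (\<Sum>i\<in>UNIV. LINT x|lborel. vf_deriv (X i) f x * vf_deriv (X i) g x)"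
    by (rule integral_mult_sub_laplacian[OF X f g' b]) simp
  also have "\<dots> = - (\<Sum>i\<in>UNIV. LINT x|lborel. vf_deriv (X i) g x * vf_deriv (X i) f x)"
    by (simp add: mult.commute)
  also have "\<dots> = (LINT x|lborel. g x * sub_laplacian X f x)"
    by (rule integral_mult_sub_laplacian[OF X g' f b, symmetric]) simp
  finally show ?thesis by (simp add: mult.commute)
qed

section \<open>Schwartz functions and the generator\<close>

lemma nn_integral_inverse_1_plus_square_finite:
  "(\<integral>\<^sup>+x. ennreal (inverse (1 + x\<^sup>2)) \<partial>lborel) < \<infinity>"
proof -
  let ?f = "\<lambda>x::real. ennreal (inverse (1 + x\<^sup>2))"
  have half: "(\<integral>\<^sup>+x. ?f x * indicator {0..} x \<partial>lborel) = ennreal (pi / 2 - arctan 0)"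
    by (rule nn_integral_FTC_atLeast) (auto intro!: DERIV_arctan tendsto_arctan_at_top)
  have "(\<integral>\<^sup>+x. ?f x * indicator {..0} x \<partial>lborel) = (\<integral>\<^sup>+x. ?f x * indicator {0..} x \<partial>lborel)"
    by (subst nn_integral_real_affine[where c = "-1" and t = 0])
      (auto intro!: nn_integral_cong split: split_indicator)
  then have "(\<integral>\<^sup>+x. ?f x * indicator {..0} x + ?f x * indicator {0..} x \<partial>lborel) < \<infinity>"
    by (simp add: nn_integral_add half ennreal_plus[symmetric] del: ennreal_plus)
  moreover have "(\<integral>\<^sup>+x. ?f x \<partial>lborel) \<le> (\<integral>\<^sup>+x. ?f x * indicator {..0} x + ?f x * indicator {0..} x \<partial>lborel)"
    by (intro nn_integral_mono) (auto split: split_indicator)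
  ultimately show ?thesis by (rule le_less_trans[rotated])
qed

lemma integrable_prod_inverse_1_plus_square:
  "integrable lborel (\<lambda>x::'a::euclidean_space. \<Prod>b\<in>Basis. inverse (1 + (x \<bullet> b)\<^sup>2))"
proof (rule integrableI_nonneg)
  have "nn_integral lborel (\<lambda>x::'a. ennreal (\<Prod>b\<in>Basis. inverse (1 + (x \<bullet> b)\<^sup>2)))
      = nn_integral lborel (\<lambda>x::'a. \<Prod>b\<in>Basis. ennreal (inverse (1 + (x \<bullet> b)\<^sup>2)))"
    by (simp add: prod_ennreal)
  also have "\<dots> = (\<Prod>b\<in>(Basis :: 'a set). (\<integral>\<^sup>+x. ennreal (inverse (1 + x\<^sup>2)) \<partial>lborel))"
    by (rule nn_integral_lborel_prod) auto
  also have "\<dots> < \<infinity>"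
    using nn_integral_inverse_1_plus_square_finite by (simp add: power_less_top_ennreal)
  finally show "nn_integral lborel (\<lambda>x::'a. ennreal (\<Prod>b\<in>Basis. inverse (1 + (x \<bullet> b)\<^sup>2))) < \<infinity>" .
qed (auto intro!: AE_I2 prod_nonneg)

text \<open>Since \<open>(1 + \<bar>x\<bar>)\<^sup>2 \<ge> 1 + x\<^sub>b\<^sup>2\<close> for every coordinate, decay of order \<open>DIM('a)\<close> bounds \<open>\<bar>g\<bar>\<^sup>2\<close> by a product of
  integrable functions of one variable.\<close>

lemma square_integrable_rapidly_decreasing:
  fixes g :: "'a::euclidean_space \<Rightarrow> complex"
  assumes g: "g \<in> borel_measurable borel" and dec: "\<And>k::nat. bounded (range (\<lambda>x. norm x ^ k *\<^sub>R g x))"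
  shows "square_integrable g"
proof -
  let ?n = "DIM('a)"
  obtain C0 where C0: "\<And>x. norm (g x) \<le> C0"
    using dec[of 0] by (auto simp: bounded_iff)
  obtain C1 where C1: "\<And>x. norm x ^ ?n * norm (g x) \<le> C1"
    using dec[of ?n] by (auto simp: bounded_iff norm_mult norm_power)
  \<comment> \<open>Combines the decay orders 0 and n = \<open>DIM('a)\<close> through (1 + r) ^ n
    <= 2 ^ n (1 + r ^ n).\<close>
  define C where "C = 2 ^ ?n * (C0 + C1)"
  have bound: "(1 + norm x) ^ ?n * norm (g x) \<le> C" for x
  proof -
    have "(1 + norm x) ^ ?n \<le> (2 * max 1 (norm x)) ^ ?n" by (intro power_mono) auto
    also have "\<dots> = 2 ^ ?n * max 1 (norm x) ^ ?n" by (rule power_mult_distrib)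
    also have "\<dots> \<le> 2 ^ ?n * (1 + norm x ^ ?n)" by (intro mult_left_mono) (auto simp: max_def)
    finally have "(1 + norm x) ^ ?n * norm (g x) \<le> 2 ^ ?n * (1 + norm x ^ ?n) * norm (g x)"
      by (rule mult_right_mono) simp
    also have "\<dots> = 2 ^ ?n * (norm (g x) + norm x ^ ?n * norm (g x))" by (simp add: algebra_simps)
    also have "\<dots> \<le> C" unfolding C_def by (intro mult_left_mono add_mono C0 C1) simp
    finally show ?thesis .
  qed
  have prod: "(\<Prod>b\<in>Basis. (1 + (x \<bullet> b)\<^sup>2)) \<le> ((1 + norm x) ^ ?n)\<^sup>2" for x :: 'a
  proof -
    have "1 + (x \<bullet> b)\<^sup>2 \<le> (1 + norm x)\<^sup>2" if "b \<in> Basis" for b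
    proof -
      have "\<bar>x \<bullet> b\<bar>\<^sup>2 \<le> (norm x)\<^sup>2" using that by (intro power_mono Basis_le_norm) auto
      then have "(x \<bullet> b)\<^sup>2 \<le> (norm x)\<^sup>2" by simp
      then show ?thesis using norm_ge_zero[of x] unfolding power2_sum one_power2 by linarith
    qed
    then have "(\<Prod>b\<in>Basis. (1 + (x \<bullet> b)\<^sup>2)) \<le> (\<Prod>b\<in>(Basis::'a set). (1 + norm x)\<^sup>2)"
      by (intro prod_mono) auto
    then show ?thesis by (simp add: power_mult[symmetric] mult.commute)
  qed
  show ?thesis
  proof (rule square_integrable_bound[OF integrable_mult_right[OF integrable_prod_inverse_1_plus_square, of "C\<^sup>2"] g], rule AE_I2)
    fix x :: 'a
    have pos: "0 < (\<Prod>b\<in>Basis. (1 + (x \<bullet> b)\<^sup>2))" by (intro prod_pos) (auto intro: add_pos_nonneg)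
    have "(\<Prod>b\<in>Basis. (1 + (x \<bullet> b)\<^sup>2)) * (norm (g x))\<^sup>2 \<le> ((1 + norm x) ^ ?n)\<^sup>2 * (norm (g x))\<^sup>2"
      by (intro mult_right_mono prod) simp
    also have "\<dots> = ((1 + norm x) ^ ?n * norm (g x))\<^sup>2" by (simp add: power_mult_distrib)
    also have "\<dots> \<le> C\<^sup>2" by (intro power_mono bound) simp
    finally have "(norm (g x))\<^sup>2 \<le> C\<^sup>2 / (\<Prod>b\<in>Basis. (1 + (x \<bullet> b)\<^sup>2))"
      using pos by (simp add: pos_le_divide_eq mult.commute)
    then show "(norm (g x))\<^sup>2 \<le> C\<^sup>2 * (\<Prod>b\<in>Basis. inverse (1 + (x \<bullet> b)\<^sup>2))"
      using prod_inversef[of "\<lambda>b. 1 + (x \<bullet> b)\<^sup>2" Basis] by (simp add: o_def divide_inverse)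
  qed
qed

lemma schwartz_smooth: "schwartz u \<Longrightarrow> smooth_on UNIV u"
  by (simp add: schwartz_def)

lemma schwartz_decreasing:
  "schwartz u \<Longrightarrow> bounded (range (\<lambda>x. norm x ^ k *\<^sub>R foldr partial js u x))"
  by (simp add: schwartz_def)

lemma schwartz_square_integrable:
  fixes u :: "real ^ 'n::finite \<Rightarrow> complex"
  assumes "schwartz u" shows "square_integrable u"
  using schwartz_decreasing[OF assms, of _ "[]"]
  by (intro square_integrable_rapidly_decreasing smooth_on_imp_measurable schwartz_smooth assms) simp

lemma bounded_range_sum:
  fixes f :: "'i \<Rightarrow> 'a \<Rightarrow> 'b::real_normed_vector"
  assumes "\<And>i. i \<in> I \<Longrightarrow> bounded (range (f i))"
  shows "bounded (range (\<lambda>x. \<Sum>i\<in>I. f i x))"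
  using assms
  by (induction I rule: infinite_finite_induct) (auto intro: bounded_plus_comp)

text \<open>Smoothness of the fields does not limit the growth of their coefficients, so the decay
  of L u is not read off from its definition. It comes from continuity on the compact set
  \<open>K\<close> and, off \<open>K\<close>, from the second derivatives in the Laplacian of a
  Schwartz function.\<close>

lemma square_integrable_sub_laplacian_schwartz:
  fixes X :: "'m::finite \<Rightarrow> real ^ 'n::finite \<Rightarrow> real ^ 'n" and u :: "real ^ 'n \<Rightarrow> complex"
  assumes X: "\<And>i. smooth_on UNIV (X i)" and u: "schwartz u"
    and K: "compact K" "\<And>x. x \<notin> K \<Longrightarrow> sub_laplacian X u x = laplacian u x"
  shows "square_integrable (sub_laplacian X u)"
proof (rule square_integrable_rapidly_decreasing)
  have sm: "smooth_on UNIV (sub_laplacian X u)"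
    by (intro smooth_on_sub_laplacian X schwartz_smooth u)
  then show "sub_laplacian X u \<in> borel_measurable borel" by (rule smooth_on_imp_measurable)
  fix k :: nat
  let ?f = "\<lambda>x. norm x ^ k *\<^sub>R sub_laplacian X u x"
  let ?g = "\<lambda>x. \<Sum>j\<in>UNIV. norm x ^ k *\<^sub>R foldr partial [j, j] u x"
  have "compact (?f ` K)"
    by (intro compact_continuous_image continuous_on_scaleR continuous_on_power continuous_on_norm
        continuous_on_id K(1) continuous_on_subset[OF smooth_on_imp_continuous_on[OF sm] subset_UNIV])
  then have "bounded (?f ` K)" by (rule compact_imp_bounded)
  moreover have "bounded (range ?g)" by (rule bounded_range_sum) (rule schwartz_decreasing[OF u])
  ultimately have "bounded (?f ` K \<union> range ?g)" by (simp only: bounded_Un)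
  moreover have "range ?f \<subseteq> ?f ` K \<union> range ?g"
  proof (rule image_subsetI)
    fix x
    show "?f x \<in> ?f ` K \<union> range ?g"
    proof (cases "x \<in> K")
      case False
      have "?f x = ?g x"
        unfolding K(2)[OF False] laplacian_def scaleR_sum_right by simp
      also have "\<dots> \<in> range ?g" by (rule rangeI)
      finally show ?thesis by (rule UnI2)
    qed (rule UnI1, rule imageI)
  qed
  ultimately show "bounded (range ?f)" by (rule bounded_subset)
qed

text \<open>By \<open>heat_semigroup_facts\<close> the generator is L on its maximal domain, so it
  is enough to test against \<open>\<phi>\<close>, where \<open>sub_laplacian_symmetric\<close>
  applies. The representatives chosen by \<open>L2_fun\<close> are only known almost everywhere and
  are replaced under the integral.\<close>

lemma generator_schwartz:
  fixes X :: "'m::finite \<Rightarrow> real ^ 'n::finite \<Rightarrow> real ^ 'n" and u :: "real ^ 'n \<Rightarrow> complex"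
  assumes X: "\<And>i. smooth_on UNIV (X i)" and u: "schwartz u"
    and sq: "square_integrable (sub_laplacian X u)"
    and facts: "heat_semigroup_facts X p"
  shows "generator_rel (heat_semigroup p) (to_L2 u) (to_L2 (sub_laplacian X u))"
proof -
  have "sub_laplacian_L2 X (to_L2 u) (to_L2 (sub_laplacian X u))"
    unfolding sub_laplacian_L2_def
  proof (intro allI impI)
    fix \<phi> :: "real ^ 'n \<Rightarrow> complex" assume \<phi>: "test_function \<phi>"
    then have sm: "smooth_on UNIV \<phi>" by (simp add: test_function_def)
    note [measurable] = smooth_on_imp_measurable[OF sm]
      smooth_on_imp_measurable[OF smooth_on_sub_laplacian[OF X sm]]
      square_integrable_measurable[OF square_integrable_L2_fun]
      square_integrable_measurable[OF sq] square_integrable_measurable[OF schwartz_square_integrable[OF u]]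
    have "(LINT x|lborel. L2_fun (to_L2 u) x * sub_laplacian X \<phi> x) = (LINT x|lborel. u x * sub_laplacian X \<phi> x)"
      using L2_fun_to_L2[OF schwartz_square_integrable[OF u]]
      by (intro integral_cong_AE) (auto elim: eventually_mono)
    also have "\<dots> = (LINT x|lborel. sub_laplacian X u x * \<phi> x)"
      by (rule sub_laplacian_symmetric[OF X schwartz_smooth[OF u] \<phi>])
    also have "\<dots> = (LINT x|lborel. L2_fun (to_L2 (sub_laplacian X u)) x * \<phi> x)"
      using L2_fun_to_L2[OF sq]
      by (intro integral_cong_AE) (auto elim: eventually_mono)
    finally show "(LINT x|lborel. L2_fun (to_L2 u) x * sub_laplacian X \<phi> x) =
        (LINT x|lborel. L2_fun (to_L2 (sub_laplacian X u)) x * \<phi> x)" .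
  qed
  then show ?thesis using facts unfolding heat_semigroup_facts_def by blast
qed

section \<open>Contraction semigroups: continuity and increments\<close>

lemma contraction_semigroupD:
  assumes "contraction_semigroup P"
  shows "P 0 F = F" "0 \<le> t \<Longrightarrow> 0 \<le> r \<Longrightarrow> P (t + r) F = P t (P r F)" "0 \<le> t \<Longrightarrow> linear (P t)"
    "0 \<le> t \<Longrightarrow> norm (P t F) \<le> norm F" "((\<lambda>t. P t F) \<longlongrightarrow> F) (at_right 0)"
  using assms unfolding contraction_semigroup_def by blast+

text \<open>Applying the contraction \<open>P r\<close> to \<open>P (t - r) F - F\<close> carries
  right continuity at 0 to two-sided continuity at every positive time. Its purpose is measurability
  of the orbit in t.\<close>

lemma contraction_semigroup_continuous:
  assumes P: "contraction_semigroup P"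
  shows "continuous_on {0..} (\<lambda>t. P t F)"
proof -
  have diff: "norm (P t F - P r F) \<le> norm (P (t - r) F - F)" if "0 \<le> r" "r \<le> t" for r t
  proof -
    have "P t F = P r (P (t - r) F)"
      using contraction_semigroupD(2)[OF P, of r "t - r" F] that by simp
    then have "P t F - P r F = P r (P (t - r) F - F)"
      using linear_diff[OF contraction_semigroupD(3)[OF P that(1)]] by simp
    then show ?thesis using contraction_semigroupD(4)[OF P that(1)] by simp
  qed
  show ?thesis unfolding continuous_on_iff
  proof (intro ballI allI impI)
    fix t e :: real assume "t \<in> {0..}" "0 < e"
    have "\<forall>\<^sub>F h in at_right 0. dist (P h F) F < e"
      using contraction_semigroupD(5)[OF P] \<open>0 < e\<close> by (rule tendstoD)
    then obtain d where "d > 0" and d: "\<And>h. 0 < h \<Longrightarrow> h < d \<Longrightarrow> dist (P h F) F < e"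
      by (auto simp: eventually_at_right_field)
    have d': "norm (P h F - F) < e" if "0 \<le> h" "h < d" for h
      using d[of h] that \<open>0 < e\<close>
      by (cases "h = 0") (simp_all add: dist_norm contraction_semigroupD(1)[OF P])
    show "\<exists>d>0. \<forall>r\<in>{0..}. dist r t < d \<longrightarrow> dist (P r F) (P t F) < e"
    proof (intro exI[of _ d] conjI ballI impI \<open>d > 0\<close>)
      fix r :: real assume r: "r \<in> {0..}" "dist r t < d"
      show "dist (P r F) (P t F) < e"
      proof (cases "r \<le> t")
        case True
        then show ?thesis using diff[of r t] d'[of "t - r"] r
          by (simp add: dist_norm norm_minus_commute)
      next
        case False
        then show ?thesis using diff[of t r] d'[of "r - t"] r \<open>t \<in> {0..}\<close>
          by (simp add: dist_norm)
      qed
    qed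
  qed
qed

text \<open>Near 0 the difference quotient converges and is therefore bounded; for larger t
  contractivity bounds the increment by \<open>2 * norm F\<close>.\<close>

lemma semigroup_increment_bound:
  assumes P: "contraction_semigroup P" and gen: "generator_rel P F G"
  obtains D where "\<forall>t\<ge>0. norm (P t F - F) \<le> D * min t 1"
proof -
  have "((\<lambda>t. norm ((P t F - F) /\<^sub>R t)) \<longlongrightarrow> norm G) (at_right 0)"
    using gen unfolding generator_rel_def by (rule tendsto_norm)
  then have "\<forall>\<^sub>F t in at_right 0. norm ((P t F - F) /\<^sub>R t) < norm G + 1"
    by (rule order_tendstoD) simp
  then obtain e where "e > 0" and e: "\<And>t. 0 < t \<Longrightarrow> t < e \<Longrightarrow> norm ((P t F - F) /\<^sub>R t) < norm G + 1"
    by (auto simp: eventually_at_right_field)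
  define d where "d = min e 1"
  have "d > 0" using \<open>e > 0\<close> by (simp add: d_def)
  \<comment> \<open>The last summand turns \<open>2 * norm F\<close> into a multiple of
    \<open>d\<close>, and \<open>d <= min t 1\<close> once \<open>t >= d\<close>, because
    \<open>d\<close> was capped at 1.\<close>
  define D where "D = norm G + 1 + 2 * norm F / d"
  have "norm (P t F - F) \<le> D * min t 1" if t: "0 \<le> t" for t
  proof (cases "t = 0")
    case True
    then show ?thesis by (simp add: contraction_semigroupD(1)[OF P])
  next
    case False
    show ?thesis
    proof (cases "t < d")
      case True
      then have "norm (P t F - F) / t < norm G + 1"
        using e[of t] False t by (simp add: d_def divide_inverse mult.commute)
      then have "norm (P t F - F) \<le> (norm G + 1) * t"
        using False t by (simp add: pos_divide_less_eq)
      also have "\<dots> \<le> D * t" using \<open>d > 0\<close> t by (intro mult_right_mono) (auto simp: D_def)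
      finally show ?thesis using True by (simp add: d_def)
    next
      case False
      have "norm (P t F - F) \<le> norm (P t F) + norm F" by (rule norm_triangle_ineq4)
      also have "\<dots> \<le> 2 * norm F" using contraction_semigroupD(4)[OF P t, of F] by simp
      also have "\<dots> = 2 * norm F / d * d" using \<open>d > 0\<close> by simp
      also have "\<dots> \<le> D * min t 1"
        using False \<open>d > 0\<close> by (intro mult_mono) (auto simp: D_def d_def)
      finally show ?thesis .
    qed
  qed
  then show ?thesis by (intro that[of D]) simp
qed

section \<open>Integrals of families in \<open>L\<^sup>2\<close>\<close>

text \<open>Cauchy-Schwarz after splitting the weight into two square roots. The right-hand side
  contains the square of \<open>f\<close>, so it can be integrated in x by Tonelli when
  \<open>f\<close> also depends on x.\<close>

lemma nn_integral_weighted_square: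
  fixes w :: "'t \<Rightarrow> real" and f :: "'t \<Rightarrow> 'b::{real_normed_vector, second_countable_topology}"
  assumes [measurable]: "w \<in> borel_measurable M" "f \<in> borel_measurable M"
  shows "(\<integral>\<^sup>+t. ennreal (norm (w t *\<^sub>R f t)) \<partial>M)\<^sup>2
    \<le> (\<integral>\<^sup>+t. ennreal \<bar>w t\<bar> \<partial>M) * (\<integral>\<^sup>+t. ennreal (\<bar>w t\<bar> * (norm (f t))\<^sup>2) \<partial>M)"
proof -
  have "(\<integral>\<^sup>+t. ennreal (norm (w t *\<^sub>R f t)) \<partial>M)
      = (\<integral>\<^sup>+t. ennreal (sqrt \<bar>w t\<bar>) * ennreal (sqrt \<bar>w t\<bar> * norm (f t)) \<partial>M)"
    by (intro nn_integral_cong) (simp add: ennreal_mult'[symmetric] mult.assoc[symmetric])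
  also have "(\<dots>)\<^sup>2 \<le> (\<integral>\<^sup>+t. (ennreal (sqrt \<bar>w t\<bar>))\<^sup>2 \<partial>M) * (\<integral>\<^sup>+t. (ennreal (sqrt \<bar>w t\<bar> * norm (f t)))\<^sup>2 \<partial>M)"
    by (rule Cauchy_Schwarz_nn_integral) measurable
  finally show ?thesis by (simp add: ennreal_power power_mult_distrib)
qed

lemma inner_eq_imp_eq:
  assumes "\<And>G. F \<bullet> G = F' \<bullet> G" shows "F = (F' :: 'a::real_inner)"
  using assms[of "F - F'"] by (metis inner_diff_left inner_eq_zero_iff right_minus_eq)

lemma inner_to_L2:
  "square_integrable f \<Longrightarrow> square_integrable g \<Longrightarrow> to_L2 f \<bullet> to_L2 g = (LINT x|lborel. f x \<bullet> g x)"
  by transfer simp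

lemma nn_integral_norm_square_to_L2:
  assumes "square_integrable f"
  shows "(\<integral>\<^sup>+x. ennreal ((norm (f x))\<^sup>2) \<partial>lborel) = ennreal ((norm (to_L2 f))\<^sup>2)"
  using assms by (subst nn_integral_eq_integral) (auto simp: norm_to_L2 square_integrable_def)

text \<open>A crude bound by |v|^2 + |w|^2 is enough, as it serves only to justify Fubini.\<close>

lemma nn_integral_inner_le:
  assumes f: "square_integrable f" and g: "square_integrable g"
  shows "(\<integral>\<^sup>+x. ennreal (norm (f x \<bullet> g x)) \<partial>lborel) \<le> ennreal ((norm (to_L2 f))\<^sup>2 + (norm (to_L2 g))\<^sup>2)"
proof -
  have [measurable]: "f \<in> borel_measurable borel" "g \<in> borel_measurable borel"
    using f g by (simp_all add: square_integrable_measurable)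
  have le: "norm (v \<bullet> w) \<le> (norm v)\<^sup>2 + (norm w)\<^sup>2" for v w :: complex
  proof -
    have "\<bar>v \<bullet> w\<bar> \<le> norm v * norm w" by (rule Cauchy_Schwarz_ineq2)
    moreover have "0 \<le> norm v * norm w" by simp
    ultimately show ?thesis
      using sum_squares_bound[of "norm v" "norm w"] unfolding real_norm_def by linarith
  qed
  have "(\<integral>\<^sup>+x. ennreal (norm (f x \<bullet> g x)) \<partial>lborel)
      \<le> (\<integral>\<^sup>+x. ennreal ((norm (f x))\<^sup>2) + ennreal ((norm (g x))\<^sup>2) \<partial>lborel)"
    using le by (intro nn_integral_mono) (simp add: ennreal_plus[symmetric] ennreal_leI del: ennreal_plus)
  also have "\<dots> = ennreal ((norm (to_L2 f))\<^sup>2 + (norm (to_L2 g))\<^sup>2)"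
    by (subst nn_integral_add) (auto simp: nn_integral_norm_square_to_L2 f g)
  finally show ?thesis .
qed

text \<open>Integrability is not assumed: otherwise the integral has the default value 0 and the
  bound is trivial.\<close>

lemma norm_integral_le_nn_integral:
  fixes f :: "'t \<Rightarrow> 'b::{banach, second_countable_topology}"
  shows "ennreal (norm (integral\<^sup>L M f)) \<le> (\<integral>\<^sup>+t. ennreal (norm (f t)) \<partial>M)"
  by (cases "integrable M f") (simp_all add: integral_norm_bound_ennreal not_integrable_integral_eq)

text \<open>The identity is obtained by pairing with an arbitrary \<open>G\<close> and applying Fubini.\<close>

lemma
  fixes w :: "'t \<Rightarrow> real" and f :: "'t \<Rightarrow> 'a::euclidean_space \<Rightarrow> complex"
  assumes M: "sigma_finite_measure M" and w: "integrable M w"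
    and meas [measurable]: "(\<lambda>(t, x). f t x) \<in> borel_measurable (M \<Otimes>\<^sub>M borel)"
    and f: "\<And>t. square_integrable (f t)" and B: "\<And>t. norm (to_L2 (f t)) \<le> B"
    and fm [measurable]: "(\<lambda>t. to_L2 (f t)) \<in> borel_measurable M"
  shows square_integrable_integral: "square_integrable (\<lambda>x. LINT t|M. w t *\<^sub>R f t x)"
    and to_L2_integral: "to_L2 (\<lambda>x. LINT t|M. w t *\<^sub>R f t x) = (LINT t|M. w t *\<^sub>R to_L2 (f t))"
proof -
  interpret sigma_finite_measure M by (rule M)
  interpret P: pair_sigma_finite M "lborel :: 'a measure" ..
  have [measurable]: "w \<in> borel_measurable M" using w by simp
  have [measurable]: "f t \<in> borel_measurable borel" for t
    using f by (simp add: square_integrable_measurable)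
  have [measurable]: "(\<lambda>(t, x). f t x) \<in> borel_measurable (M \<Otimes>\<^sub>M lborel)"
    using meas by (simp cong: measurable_cong_sets sets_pair_measure_cong)
  have sec: "(\<lambda>t. f t x) \<in> borel_measurable M" for x
  proof -
    have "(\<lambda>t. (t, x)) \<in> measurable M (M \<Otimes>\<^sub>M borel)" by measurable
    from measurable_compose[OF this meas] show ?thesis by simp
  qed
  have B0: "0 \<le> B" using B order_trans[OF norm_ge_zero] by blast
  define V where "V x = (LINT t|M. w t *\<^sub>R f t x)" for x
  have [measurable]: "V \<in> borel_measurable borel"
    unfolding V_def by measurable
  define W where "W = (\<integral>\<^sup>+t. ennreal \<bar>w t\<bar> \<partial>M)"
  define S where "S x = (\<integral>\<^sup>+t. ennreal (\<bar>w t\<bar> * (norm (f t x))\<^sup>2) \<partial>M)" for x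
  have W: "W < \<infinity>" using w by (simp add: W_def integrable_iff_bounded)
  have [measurable]: "S \<in> borel_measurable borel" unfolding S_def by measurable
  have "(\<integral>\<^sup>+x. S x \<partial>lborel) = (\<integral>\<^sup>+t. (\<integral>\<^sup>+x. ennreal (\<bar>w t\<bar> * (norm (f t x))\<^sup>2) \<partial>lborel) \<partial>M)"
    unfolding S_def by (rule P.Fubini') measurable
  also have "\<dots> = (\<integral>\<^sup>+t. ennreal \<bar>w t\<bar> * ennreal ((norm (to_L2 (f t)))\<^sup>2) \<partial>M)"
    by (intro nn_integral_cong)
      (simp add: ennreal_mult nn_integral_cmult nn_integral_norm_square_to_L2 f)
  also have "\<dots> \<le> (\<integral>\<^sup>+t. ennreal \<bar>w t\<bar> * ennreal (B\<^sup>2) \<partial>M)"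
    by (intro nn_integral_mono mult_left_mono ennreal_leI power_mono B) auto
  also have "\<dots> = W * ennreal (B\<^sup>2)" unfolding W_def by (rule nn_integral_multc) simp
  also have "\<dots> < \<infinity>" using W by (simp add: ennreal_mult_less_top)
  finally have S_fin: "(\<integral>\<^sup>+x. S x \<partial>lborel) < \<infinity>" .
  have cs: "(\<integral>\<^sup>+t. ennreal (norm (w t *\<^sub>R f t x)) \<partial>M)\<^sup>2 \<le> W * S x" for x
    unfolding W_def S_def by (rule nn_integral_weighted_square) (simp_all add: sec)
  \<comment> \<open>This holds at every x, including those where the section is not integrable and
    \<open>V x\<close> is 0 by default.\<close>
  have V2: "ennreal ((norm (V x))\<^sup>2) \<le> W * S x" for x
  proof -
    have "ennreal ((norm (V x))\<^sup>2) = (ennreal (norm (V x)))\<^sup>2" by (simp add: ennreal_power)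
    also have "\<dots> \<le> (\<integral>\<^sup>+t. ennreal (norm (w t *\<^sub>R f t x)) \<partial>M)\<^sup>2"
      unfolding V_def by (intro power_mono norm_integral_le_nn_integral) simp
    finally show ?thesis using cs[of x] by (rule order_trans)
  qed
  have "(\<integral>\<^sup>+x. ennreal ((norm (V x))\<^sup>2) \<partial>lborel) \<le> (\<integral>\<^sup>+x. W * S x \<partial>lborel)"
    by (intro nn_integral_mono V2)
  also have "\<dots> = W * (\<integral>\<^sup>+x. S x \<partial>lborel)" by (rule nn_integral_cmult) simp
  also have "\<dots> < \<infinity>" using W S_fin by (simp add: ennreal_mult_less_top)
  finally have "integrable lborel (\<lambda>x. (norm (V x))\<^sup>2)"
    by (intro integrableI_nonneg) auto
  then have V: "square_integrable V" by (simp add: square_integrable_def)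
  then show "square_integrable (\<lambda>x. LINT t|M. w t *\<^sub>R f t x)" by (simp add: V_def[abs_def])
  have int_L2: "integrable M (\<lambda>t. w t *\<^sub>R to_L2 (f t))"
  proof (rule Bochner_Integration.integrable_bound)
    show "integrable M (\<lambda>t. w t * B)" using w by simp
    show "AE t in M. norm (w t *\<^sub>R to_L2 (f t)) \<le> norm (w t * B)"
      using B B0 by (intro AE_I2) (simp add: abs_mult mult_left_mono)
  qed measurable
  \<comment> \<open>Finiteness of \<open>S x\<close> makes the section in t integrable by
    \<open>cs\<close>. Having this almost everywhere is enough to move the pairing with
    \<open>g x\<close> inside the t-integral.\<close>
  have "AE x in lborel. S x \<noteq> \<infinity>"
    using S_fin by (intro nn_integral_PInf_AE) auto
  then have int_t: "AE x in lborel. integrable M (\<lambda>t. w t *\<^sub>R f t x)"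
  proof eventually_elim
    case (elim x)
    have "(\<integral>\<^sup>+t. ennreal (norm (w t *\<^sub>R f t x)) \<partial>M)\<^sup>2 < \<infinity>"
      using cs[of x] elim W by (auto simp: ennreal_mult_less_top less_top intro: le_less_trans)
    then show ?case
      by (intro integrableI_bounded) (simp_all add: sec power_less_top_ennreal)
  qed
  have "to_L2 V \<bullet> G = (LINT t|M. w t *\<^sub>R to_L2 (f t)) \<bullet> G" for G
  proof -
    define g where "g = L2_fun G"
    have g: "square_integrable g" "G = to_L2 g"
      by (simp_all add: g_def square_integrable_L2_fun)
    note [measurable] = square_integrable_measurable[OF g(1)]
    have "(\<integral>\<^sup>+z. ennreal (norm ((\<lambda>(t, x). w t * (f t x \<bullet> g x)) z)) \<partial>(M \<Otimes>\<^sub>M lborel))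
        = (\<integral>\<^sup>+t. (\<integral>\<^sup>+x. ennreal (norm (w t * (f t x \<bullet> g x))) \<partial>lborel) \<partial>M)"
      by (subst lborel.nn_integral_fst[symmetric]) auto
    also have "\<dots> = (\<integral>\<^sup>+t. ennreal \<bar>w t\<bar> * (\<integral>\<^sup>+x. ennreal (norm (f t x \<bullet> g x)) \<partial>lborel) \<partial>M)"
      by (simp add: nn_integral_cmult[symmetric] ennreal_mult abs_mult)
    also have "\<dots> \<le> (\<integral>\<^sup>+t. ennreal \<bar>w t\<bar> * ennreal (B\<^sup>2 + (norm G)\<^sup>2) \<partial>M)"
    proof (intro nn_integral_mono mult_left_mono)
      fix t
      have "(norm (to_L2 (f t)))\<^sup>2 + (norm G)\<^sup>2 \<le> B\<^sup>2 + (norm G)\<^sup>2"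
        by (intro add_right_mono power_mono B) simp
      then show "(\<integral>\<^sup>+x. ennreal (norm (f t x \<bullet> g x)) \<partial>lborel) \<le> ennreal (B\<^sup>2 + (norm G)\<^sup>2)"
        using nn_integral_inner_le[OF f[of t] g(1)] unfolding g(2)
        by (meson ennreal_leI order_trans)
    qed simp
    also have "\<dots> = W * ennreal (B\<^sup>2 + (norm G)\<^sup>2)" unfolding W_def by (rule nn_integral_multc) simp
    also have "\<dots> < \<infinity>" using W by (simp add: ennreal_mult_less_top)
    finally have int: "integrable (M \<Otimes>\<^sub>M lborel) (\<lambda>(t, x). w t * (f t x \<bullet> g x))"
      by (intro integrableI_bounded) auto
    have "to_L2 V \<bullet> G = (LINT x|lborel. V x \<bullet> g x)"
      unfolding g(2) by (rule inner_to_L2[OF V g(1)])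
    also have "\<dots> = (LINT x|lborel. LINT t|M. w t * (f t x \<bullet> g x))"
    proof (rule integral_cong_AE)
      show "AE x in lborel. V x \<bullet> g x = (LINT t|M. w t * (f t x \<bullet> g x))"
        using int_t
      proof eventually_elim
        case (elim x)
        then show ?case
          unfolding V_def using integral_inner_left[of "g x" M "\<lambda>t. w t *\<^sub>R f t x"] by simp
      qed
    qed measurable
    also have "\<dots> = (LINT t|M. LINT x|lborel. w t * (f t x \<bullet> g x))"
      by (rule P.Fubini_integral[OF int])
    also have "\<dots> = (LINT t|M. (w t *\<^sub>R to_L2 (f t)) \<bullet> G)"
      by (simp add: g(2) inner_to_L2 f g(1) square_integrable_inner)
    also have "\<dots> = (LINT t|M. w t *\<^sub>R to_L2 (f t)) \<bullet> G"
      by (intro integral_inner_left int_L2)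
    finally show ?thesis .
  qed
  then have "to_L2 V = (LINT t|M. w t *\<^sub>R to_L2 (f t))" by (rule inner_eq_imp_eq)
  then show "to_L2 (\<lambda>x. LINT t|M. w t *\<^sub>R f t x) = (LINT t|M. w t *\<^sub>R to_L2 (f t))"
    by (simp add: V_def[abs_def])
qed

text \<open>The bound on \<open>f'\<close> is uniform over the interval, so the mean value
  inequality dominates all difference quotients at \<open>z\<close> by the same
  \<open>w\<close>.\<close>

lemma has_vector_derivative_integral:
  fixes f :: "real \<Rightarrow> 't \<Rightarrow> 'b::{banach, second_countable_topology}"
  assumes z: "a < z" "z < b"
    and int: "\<And>y. a < y \<Longrightarrow> y < b \<Longrightarrow> integrable M (f y)"
    and der: "\<And>y t. a < y \<Longrightarrow> y < b \<Longrightarrow> ((\<lambda>y. f y t) has_vector_derivative f' y t) (at y)"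
    and meas: "f' z \<in> borel_measurable M" and w: "integrable M w"
    and bound: "\<And>y t. a < y \<Longrightarrow> y < b \<Longrightarrow> norm (f' y t) \<le> w t"
  shows "((\<lambda>y. LINT t|M. f y t) has_vector_derivative (LINT t|M. f' z t)) (at z)"
proof -
  let ?S = "{a<..<b}"
  have lip: "norm (f y t - f z t) \<le> w t * \<bar>y - z\<bar>" if "y \<in> ?S" for y t
  proof -
    have "norm (f y t - f z t) \<le> w t * norm (y - z)"
    proof (rule differentiable_bound[where S = ?S and f' = "\<lambda>y h. h *\<^sub>R f' y t"])
      show "((\<lambda>y. f y t) has_derivative (\<lambda>h. h *\<^sub>R f' y t)) (at y within ?S)" if "y \<in> ?S" for y
        using der[of y t] that by (auto simp: has_vector_derivative_def intro: has_derivative_at_withinI)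
      show "onorm (\<lambda>h. h *\<^sub>R f' y t) \<le> w t" if "y \<in> ?S" for y
        by (rule onorm_le)
          (use bound[of y t] that in \<open>auto simp: mult.commute[of "w t"] intro!: mult_left_mono\<close>)
    qed (use that z in auto)
    then show ?thesis by simp
  qed
  have quot: "((\<lambda>y. inverse (y - z) *\<^sub>R (f y t - f z t)) \<longlongrightarrow> f' z t) (at z within ?S)" for t
    using has_vector_derivative_at_within[OF der[OF z], of t ?S]
    by (simp only: has_vector_derivative_within_slope)
  \<comment> \<open>The filter within the interval keeps every test sequence where the bounds hold;
    since the interval is open, nothing is lost on returning to \<open>at z\<close>.\<close>
  have "((\<lambda>y. LINT t|M. inverse (y - z) *\<^sub>R (f y t - f z t)) \<longlongrightarrow> (LINT t|M. f' z t)) (at z within ?S)"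
    unfolding tendsto_at_iff_sequentially
  proof (intro allI impI)
    fix Y :: "nat \<Rightarrow> real" assume Y: "\<forall>i. Y i \<in> ?S - {z}" "Y \<longlonglongrightarrow> z"
    have "(\<lambda>i. LINT t|M. inverse (Y i - z) *\<^sub>R (f (Y i) t - f z t)) \<longlonglongrightarrow> (LINT t|M. f' z t)"
    proof (rule integral_dominated_convergence[OF meas _ w])
      show "(\<lambda>t. inverse (Y i - z) *\<^sub>R (f (Y i) t - f z t)) \<in> borel_measurable M" for i
        using borel_measurable_integrable[OF int[of "Y i"]] borel_measurable_integrable[OF int[OF z]] Y(1)
        by (intro borel_measurable_scaleR borel_measurable_diff) auto
      show "AE t in M. (\<lambda>i. inverse (Y i - z) *\<^sub>R (f (Y i) t - f z t)) \<longlonglongrightarrow> f' z t"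
        using quot Y unfolding tendsto_at_iff_sequentially by (auto simp: o_def)
      show "AE t in M. norm (inverse (Y i - z) *\<^sub>R (f (Y i) t - f z t)) \<le> w t" for i
      proof (rule AE_I2)
        fix t
        have "Y i \<noteq> z" "Y i \<in> ?S" using Y(1) by auto
        then show "norm (inverse (Y i - z) *\<^sub>R (f (Y i) t - f z t)) \<le> w t"
          using lip[of "Y i" t] by (simp add: inverse_eq_divide pos_divide_le_eq)
      qed
    qed
    then show "((\<lambda>y. LINT t|M. inverse (y - z) *\<^sub>R (f y t - f z t)) \<circ> Y) \<longlonglongrightarrow> (LINT t|M. f' z t)"
      by (simp add: o_def)
  qed
  moreover have "\<forall>\<^sub>F y in at z within ?S. (LINT t|M. inverse (y - z) *\<^sub>R (f y t - f z t))
      = inverse (y - z) *\<^sub>R ((LINT t|M. f y t) - (LINT t|M. f z t))"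
    unfolding eventually_at_filter by (intro always_eventually allI impI) (simp add: int z)
  ultimately have "((\<lambda>y. inverse (y - z) *\<^sub>R ((LINT t|M. f y t) - (LINT t|M. f z t))) \<longlongrightarrow> (LINT t|M. f' z t)) (at z within ?S)"
    by (rule Lim_transform_eventually)
  then have "((\<lambda>y. LINT t|M. f y t) has_vector_derivative (LINT t|M. f' z t)) (at z within ?S)"
    by (simp only: has_vector_derivative_within_slope)
  then show ?thesis using z by (simp add: at_within_open[of z ?S])
qed

text \<open>Replacing \<open>a\<close> by a nearby point of a countable dense set gives functions
  that are measurable piece by piece; by continuity in \<open>a\<close> they converge to
  \<open>f\<close>.\<close>

lemma measurable_Caratheodory:
  fixes f :: "'a::{metric_space, second_countable_topology} \<Rightarrow> 'b \<Rightarrow> 'c::{metric_space, second_countable_topology}"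
  assumes S: "open S" and cont: "\<And>y. y \<in> space N \<Longrightarrow> continuous_on S (\<lambda>a. f a y)"
    and meas: "\<And>a. a \<in> S \<Longrightarrow> f a \<in> borel_measurable N"
  shows "(\<lambda>(a, y). if a \<in> S then f a y else c) \<in> borel_measurable (borel \<Otimes>\<^sub>M N)"
proof (cases "S = {}")
  case False
  obtain D :: "'a set" where D: "countable D" "\<And>X. open X \<Longrightarrow> X \<noteq> {} \<Longrightarrow> \<exists>d\<in>D. d \<in> X"
    by (erule countable_dense_setE)
  \<comment> \<open>Openness of \<open>S\<close> makes \<open>E\<close> dense in \<open>S\<close>,
    so the approximating points stay where \<open>f\<close> is continuous and its sections are
    measurable.\<close>
  define E where "E = D \<inter> S"
  have E: "countable E" "E \<noteq> {}" using D S False by (auto simp: E_def)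
  define d where "d = from_nat_into E"
  have d_S: "d n \<in> S" for n using from_nat_into[OF E(2), of n] by (simp add: d_def E_def)
  define r where "r k = 1 / real (Suc k)" for k
  have ex: "\<exists>n. dist a (d n) < r k" if "a \<in> S" for a k
  proof -
    have "\<exists>e\<in>D. e \<in> S \<inter> ball a (r k)"
      using that S by (intro D) (auto simp: r_def intro!: exI[of _ a])
    then obtain e where "e \<in> E" "dist a e < r k" by (auto simp: E_def)
    then show ?thesis using from_nat_into_surj[OF E(1), of e] by (auto simp: d_def)
  qed
  \<comment> \<open>Choosing the least index makes the selected point a measurable function of
    \<open>a\<close> with countably many values.\<close>
  define n where "n k a = (LEAST n. dist a (d n) < r k)" for k a
  have n: "dist a (d (n k a)) < r k" if "a \<in> S" for a k
    unfolding n_def using ex[OF that] by (rule LeastI_ex)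
  have [measurable]: "S \<in> sets borel" using S by simp
  have [measurable]: "n k \<in> measurable borel (count_space UNIV)" for k
    unfolding n_def by measurable
  have [measurable]: "f (d i) \<in> borel_measurable N" for i by (rule meas[OF d_S])
  show ?thesis
  proof (rule borel_measurable_LIMSEQ_metric)
    fix k
    have "(\<lambda>z. f (d (n k (fst z))) (snd z)) \<in> borel_measurable (borel \<Otimes>\<^sub>M N)"
      by (rule measurable_compose_countable[where f = "\<lambda>i z. f (d i) (snd z)"]) measurable
    then show "(\<lambda>(a, y). if a \<in> S then f (d (n k a)) y else c) \<in> borel_measurable (borel \<Otimes>\<^sub>M N)"
      by (simp add: case_prod_beta)
  next
    fix z :: "'a \<times> 'b" assume z: "z \<in> space (borel \<Otimes>\<^sub>M N)"
    obtain a y where ay: "z = (a, y)" "y \<in> space N" using z by (cases z) (auto simp: space_pair_measure)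
    show "(\<lambda>k. case z of (a, y) \<Rightarrow> if a \<in> S then f (d (n k a)) y else c)
        \<longlonglongrightarrow> (case z of (a, y) \<Rightarrow> if a \<in> S then f a y else c)"
    proof (cases "a \<in> S")
      case True
      have "(\<lambda>k. dist (d (n k a)) a) \<longlonglongrightarrow> 0"
      proof (rule tendsto_sandwich[OF _ _ tendsto_const])
        show "r \<longlonglongrightarrow> 0" unfolding r_def using LIMSEQ_inverse_real_of_nat by (simp add: inverse_eq_divide)
        show "\<forall>\<^sub>F k in sequentially. dist (d (n k a)) a \<le> r k"
          using n[OF True] by (intro always_eventually allI less_imp_le) (simp add: dist_commute)
      qed simp
      then have "(\<lambda>k. d (n k a)) \<longlonglongrightarrow> a" by (subst tendsto_dist_iff)
      then have "(\<lambda>k. f (d (n k a)) y) \<longlonglongrightarrow> f a y"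
        by (rule continuous_on_tendsto_compose[OF cont[OF ay(2)] _ True]) (simp add: d_S)
      then show ?thesis using True ay by simp
    qed (use ay in simp)
  qed
qed simp

section \<open>The weights of the Poisson kernel\<close>

text \<open>The indicators are needed because \<^const>\<open>powr\<close> does not vanish for negative base. Up to the constant
  \<open>1 / (2 powr (2 s) \<Gamma>(s))\<close>, \<open>poisson_weight\<close> is the density that turns \<open>P\<^sub>t u\<close> into \<open>U(\<cdot>, z)\<close>, and
  \<open>poisson_weight_deriv\<close> is \<open>z powr (1 - 2 s)\<close> times its derivative in \<open>z\<close>.\<close>

definition frac_weight :: "real \<Rightarrow> real \<Rightarrow> real" where
  "frac_weight s t = indicator {0<..} t * (t powr (- s - 1) * min t 1)"

definition poisson_weight :: "real \<Rightarrow> real \<Rightarrow> real \<Rightarrow> real" where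
  "poisson_weight s z t = indicator {0<..} t * (z powr (2 * s) * exp (- z\<^sup>2 / (4 * t)) * t powr (- s - 1))"

definition poisson_weight_deriv :: "real \<Rightarrow> real \<Rightarrow> real \<Rightarrow> real" where
  "poisson_weight_deriv s z t =
    indicator {0<..} t * ((2 * s - z\<^sup>2 / (2 * t)) * exp (- z\<^sup>2 / (4 * t)) * t powr (- s - 1))"

lemma weights_measurable [measurable]:
  "frac_weight s \<in> borel_measurable borel"
  "poisson_weight s z \<in> borel_measurable borel"
  "poisson_weight_deriv s z \<in> borel_measurable borel"
  unfolding frac_weight_def[abs_def] poisson_weight_def[abs_def] poisson_weight_deriv_def[abs_def]
  by measurable

text \<open>Transfers gauge integrability, in which the power integrals are available, to
  \<open>lborel\<close>: nonnegativity makes it absolute, and Borel measurability removes the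
  completion.\<close>

lemma integrable_lborel_nonneg:
  fixes f :: "real \<Rightarrow> real"
  assumes "f integrable_on S" "\<And>x. x \<in> S \<Longrightarrow> 0 \<le> f x" "S \<in> sets borel" "f \<in> borel_measurable borel"
  shows "integrable lborel (\<lambda>x. indicator S x * f x)"
proof -
  have "f absolutely_integrable_on S"
    using assms(1,2) by (rule nonnegative_absolutely_integrable_1)
  then have "integrable (completion lborel) (\<lambda>x. indicator S x * f x)"
    by (simp add: set_integrable_def)
  then show ?thesis
    using assms(3,4) by (subst (asm) integrable_completion) auto
qed

text \<open>On (0, 1] the weight is t powr (- s), integrable because s < 1; beyond 1 it is t powr (-
  s - 1), integrable because s > 0.\<close>

lemma integrable_frac_weight:
  assumes "0 < s" "s < 1" shows "integrable lborel (frac_weight s)"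
proof (rule Bochner_Integration.integrable_bound)
  have "(\<lambda>t. t powr (- s)) integrable_on {0..1::real}"
    using assms by (intro integrable_on_powr_from_0) auto
  moreover have "(\<lambda>t. t powr (- s - 1)) integrable_on {1::real..}"
    using has_integral_powr_to_inf[of "- s - 1" 1] assms by (auto simp: integrable_on_def)
  ultimately show "integrable lborel (\<lambda>t::real. indicator {0..1} t * t powr (- s) + indicator {1..} t * t powr (- s - 1))"
    by (intro Bochner_Integration.integrable_add integrable_lborel_nonneg) auto
  show "AE t in lborel. norm (frac_weight s t)
      \<le> norm (indicator {0..1} t * t powr (- s) + indicator {1..} t * t powr (- s - 1))"
  proof (rule AE_I2)
    fix t :: real
    have "t powr (- s - 1) * t = t powr (- s)" if "0 < t"
      using that powr_mult_base[of t "- s - 1"] by (simp add: mult.commute)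
    then show "norm (frac_weight s t)
        \<le> norm (indicator {0..1} t * t powr (- s) + indicator {1..} t * t powr (- s - 1))"
      by (auto simp: frac_weight_def indicator_def min_def)
  qed
qed measurable

text \<open>The exponential dominates each term of its quadratic Taylor polynomial.\<close>

lemma exp_minus_bounds:
  fixes y :: real assumes "0 \<le> y"
  shows "exp (- y) \<le> 1" "y * exp (- y) \<le> 1" "y * (y * exp (- y)) \<le> 2"
proof -
  have e: "1 + y + y\<^sup>2 / 2 \<le> exp y" using assms by (rule exp_lower_Taylor_quadratic)
  have "y \<le> exp y" "y\<^sup>2 \<le> 2 * exp y"
    using e assms zero_le_power2[of y] by linarith+
  then show "exp (- y) \<le> 1" "y * exp (- y) \<le> 1" "y * (y * exp (- y)) \<le> 2"
    using assms by (simp_all add: exp_minus field_simps power2_eq_square)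
qed

lemma min_le_max_mult_min:
  fixes t c :: real assumes "0 \<le> t" shows "min 1 (c * t) \<le> max 1 c * min t 1"
proof (cases "t \<le> 1")
  case True
  have "c * t \<le> max 1 c * t" using assms by (intro mult_right_mono) auto
  then show ?thesis using True by simp
qed auto

text \<open>With y = z^2 / (4 t) the scalar factor is at most (2 + 2 y) exp(- y). This is at most 2
  + 2 = 4, and its product with y is at most 2 + 4 = 6. The factor \<open>min t 1\<close> comes from
  min(1, 1/y), where 1/y = 4 t / z^2.\<close>

lemma exp_weight_bounds:
  fixes s z t :: real assumes "0 < s" "s < 1" "0 < z" "0 < t"
  shows "exp (- z\<^sup>2 / (4 * t)) \<le> max 1 (4 / z\<^sup>2) * min t 1"
    and "\<bar>2 * s - z\<^sup>2 / (2 * t)\<bar> * exp (- z\<^sup>2 / (4 * t)) \<le> 4"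
    and "\<bar>2 * s - z\<^sup>2 / (2 * t)\<bar> * exp (- z\<^sup>2 / (4 * t)) \<le> 6 * (max 1 (4 / z\<^sup>2) * min t 1)"
proof -
  define y where "y = z\<^sup>2 / (4 * t)"
  have y: "0 < y" using assms by (simp add: y_def)
  have inv: "inverse y = 4 / z\<^sup>2 * t" using assms by (simp add: y_def field_simps)
  have min: "min 1 (inverse y) \<le> max 1 (4 / z\<^sup>2) * min t 1"
    unfolding inv using assms by (intro min_le_max_mult_min) simp
  have exp_eq: "exp (- z\<^sup>2 / (4 * t)) = exp (- y)" by (simp add: y_def)
  note b = exp_minus_bounds[OF less_imp_le[OF y]]
  have "exp (- y) \<le> inverse y" using b(2) y by (simp add: field_simps)
  then show "exp (- z\<^sup>2 / (4 * t)) \<le> max 1 (4 / z\<^sup>2) * min t 1"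
    unfolding exp_eq using b(1) min by linarith
  have le: "\<bar>2 * s - z\<^sup>2 / (2 * t)\<bar> * exp (- z\<^sup>2 / (4 * t)) \<le> (2 + 2 * y) * exp (- y)"
    unfolding exp_eq
  proof (intro mult_right_mono)
    have "z\<^sup>2 / (2 * t) = 2 * y" by (simp add: y_def)
    then show "\<bar>2 * s - z\<^sup>2 / (2 * t)\<bar> \<le> 2 + 2 * y" using assms y by linarith
  qed simp
  have "(2 + 2 * y) * exp (- y) = 2 * exp (- y) + 2 * (y * exp (- y))" by (simp add: algebra_simps)
  also have "\<dots> \<le> 4" using b by linarith
  finally have 4: "(2 + 2 * y) * exp (- y) \<le> 4" .
  with le show "\<bar>2 * s - z\<^sup>2 / (2 * t)\<bar> * exp (- z\<^sup>2 / (4 * t)) \<le> 4" by linarith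
  have "y * ((2 + 2 * y) * exp (- y)) = 2 * (y * exp (- y)) + 2 * (y * (y * exp (- y)))"
    by (simp add: algebra_simps)
  also have "\<dots> \<le> 6" using b by linarith
  finally have "(2 + 2 * y) * exp (- y) \<le> 6 / y"
    using y by (simp only: pos_le_divide_eq mult.commute[of y])
  then have "(2 + 2 * y) * exp (- y) \<le> 6 * inverse y" by (simp only: divide_inverse)
  with 4 have "(2 + 2 * y) * exp (- y) \<le> 6 * min 1 (inverse y)" by (simp add: min_def)
  with le min show "\<bar>2 * s - z\<^sup>2 / (2 * t)\<bar> * exp (- z\<^sup>2 / (4 * t)) \<le> 6 * (max 1 (4 / z\<^sup>2) * min t 1)"
    by linarith
qed

text \<open>The first two bounds give integrability for fixed \<open>z\<close> and domination for
  \<open>z\<close> near a positive value. Their constants blow up as z tends to 0; the third is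
  uniform in \<open>z\<close>, and there the missing \<open>min t 1\<close> is supplied by P_t u -
  u.\<close>

lemma weight_bounds:
  fixes s z t :: real assumes s: "0 < s" "s < 1" and z: "0 < z"
  shows "\<bar>poisson_weight s z t\<bar> \<le> z powr (2 * s) * max 1 (4 / z\<^sup>2) * frac_weight s t"
    and "\<bar>poisson_weight_deriv s z t\<bar> \<le> 6 * max 1 (4 / z\<^sup>2) * frac_weight s t"
    and "\<bar>poisson_weight_deriv s z t\<bar> \<le> 4 * (indicator {0<..} t * t powr (- s - 1))"
proof -
  note b = exp_weight_bounds[OF s z, of t]
  show "\<bar>poisson_weight s z t\<bar> \<le> z powr (2 * s) * max 1 (4 / z\<^sup>2) * frac_weight s t"
  proof (cases "0 < t")
    case True
    from mult_left_mono[OF b(1)[OF True], of "z powr (2 * s) * t powr (- s - 1)"]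
    show ?thesis using True by (simp add: poisson_weight_def frac_weight_def abs_mult mult_ac)
  qed (simp add: poisson_weight_def frac_weight_def)
  show "\<bar>poisson_weight_deriv s z t\<bar> \<le> 6 * max 1 (4 / z\<^sup>2) * frac_weight s t"
  proof (cases "0 < t")
    case True
    from mult_left_mono[OF b(3)[OF True], of "t powr (- s - 1)"]
    show ?thesis using True by (simp add: poisson_weight_deriv_def frac_weight_def abs_mult mult_ac)
  qed (simp add: poisson_weight_deriv_def frac_weight_def)
  show "\<bar>poisson_weight_deriv s z t\<bar> \<le> 4 * (indicator {0<..} t * t powr (- s - 1))"
  proof (cases "0 < t")
    case True
    from mult_left_mono[OF b(2)[OF True], of "t powr (- s - 1)"]
    show ?thesis using True by (simp add: poisson_weight_deriv_def abs_mult mult_ac)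
  qed (simp add: poisson_weight_deriv_def)
qed

lemma
  assumes s: "0 < s" "s < 1" and z: "0 < z"
  shows integrable_poisson_weight: "integrable lborel (poisson_weight s z)"
    and integrable_poisson_weight_deriv: "integrable lborel (poisson_weight_deriv s z)"
proof -
  note w = integrable_frac_weight[OF s]
  have nn: "0 \<le> frac_weight s t" for t by (simp add: frac_weight_def indicator_def)
  show "integrable lborel (poisson_weight s z)"
    by (rule Bochner_Integration.integrable_bound[OF integrable_mult_right[OF w, of "z powr (2 * s) * max 1 (4 / z\<^sup>2)"]])
      (use weight_bounds(1)[OF s z] nn in \<open>auto intro!: AE_I2 simp: abs_mult\<close>)
  show "integrable lborel (poisson_weight_deriv s z)"
    by (rule Bochner_Integration.integrable_bound[OF integrable_mult_right[OF w, of "6 * max 1 (4 / z\<^sup>2)"]])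
      (use weight_bounds(2)[OF s z] nn in \<open>auto intro!: AE_I2 simp: abs_mult\<close>)
qed

lemma poisson_weight_has_derivative:
  assumes z: "0 < z"
  shows "((\<lambda>z. poisson_weight s z t) has_real_derivative z powr (2 * s - 1) * poisson_weight_deriv s z t) (at z)"
proof (cases "0 < t")
  case True
  have e: "z powr (2 * s) = z powr (2 * s - 1) * z"
    using z powr_mult_base[of z "2 * s - 1"] by (simp add: mult.commute)
  have "((\<lambda>z. z powr (2 * s) * exp (- z\<^sup>2 / (4 * t)) * t powr (- s - 1)) has_real_derivative
      (2 * s * z powr (2 * s - 1) * exp (- z\<^sup>2 / (4 * t)) + z powr (2 * s) * (exp (- z\<^sup>2 / (4 * t)) * (- (2 * z) / (4 * t))))
        * t powr (- s - 1)) (at z)"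
    using z True by (auto intro!: derivative_eq_intros)
  also have "(2 * s * z powr (2 * s - 1) * exp (- z\<^sup>2 / (4 * t)) + z powr (2 * s) * (exp (- z\<^sup>2 / (4 * t)) * (- (2 * z) / (4 * t))))
        * t powr (- s - 1) = z powr (2 * s - 1) * ((2 * s - z\<^sup>2 / (2 * t)) * exp (- z\<^sup>2 / (4 * t)) * t powr (- s - 1))"
    unfolding e using True by (simp add: field_simps power2_eq_square)
  finally show ?thesis using True by (simp add: poisson_weight_def poisson_weight_deriv_def)
qed (simp add: poisson_weight_def poisson_weight_deriv_def)

text \<open>Bounded \<open>h\<close> is general enough for the two uses: a constant, which gives the
  derivative of the mass, and P_t u(x) at fixed x.\<close>

lemma integral_poisson_weight_has_derivative:
  fixes h :: "real \<Rightarrow> 'b::{banach, second_countable_topology}"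
  assumes s: "0 < s" "s < 1" and z: "0 < z"
    and h [measurable]: "h \<in> borel_measurable borel" and B: "\<And>t. norm (h t) \<le> B"
  shows "((\<lambda>z. LINT t|lborel. poisson_weight s z t *\<^sub>R h t) has_vector_derivative
    z powr (2 * s - 1) *\<^sub>R (LINT t|lborel. poisson_weight_deriv s z t *\<^sub>R h t)) (at z)"
proof -
  have B0: "0 \<le> B" using B order_trans[OF norm_ge_zero] by blast
  have nn: "0 \<le> frac_weight s t" for t by (simp add: frac_weight_def indicator_def)
  \<comment> \<open>The power with exponent 2 s - 1 may increase or decrease, so on (z/2, 2 z) it is
    bounded by the sum of both endpoint values. The 16 in \<open>C\<close> is from 4 / (z/2)^2 = 16
    / z^2.\<close>
  define A where "A = (z / 2) powr (2 * s - 1) + (2 * z) powr (2 * s - 1)"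
  define C where "C = A * (6 * max 1 (16 / z\<^sup>2)) * B"
  have "((\<lambda>z. LINT t|lborel. poisson_weight s z t *\<^sub>R h t) has_vector_derivative
    (LINT t|lborel. (z powr (2 * s - 1) * poisson_weight_deriv s z t) *\<^sub>R h t)) (at z)"
  proof (rule has_vector_derivative_integral[where a = "z / 2" and b = "2 * z" and w = "\<lambda>t. C * frac_weight s t"])
    fix y t assume y: "z / 2 < y" "y < 2 * z"
    then have y0: "0 < y" using z by linarith
    show "integrable lborel (\<lambda>t. poisson_weight s y t *\<^sub>R h t)"
    proof (rule Bochner_Integration.integrable_bound)
      show "integrable lborel (\<lambda>t. poisson_weight s y t * B)"
        by (intro integrable_mult_left integrable_poisson_weight s y0)
      show "AE t in lborel. norm (poisson_weight s y t *\<^sub>R h t) \<le> norm (poisson_weight s y t * B)"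
        using B B0 by (intro AE_I2) (simp add: abs_mult mult_left_mono)
    qed measurable
    have "((\<lambda>y. poisson_weight s y t) has_vector_derivative y powr (2 * s - 1) * poisson_weight_deriv s y t) (at y)"
      using poisson_weight_has_derivative[OF y0] by (simp add: has_real_derivative_iff_has_vector_derivative)
    from bounded_linear.has_vector_derivative[OF bounded_linear_scaleR_left this, of "h t"]
    show "((\<lambda>y. poisson_weight s y t *\<^sub>R h t) has_vector_derivative
        (y powr (2 * s - 1) * poisson_weight_deriv s y t) *\<^sub>R h t) (at y)" .
    have A: "y powr (2 * s - 1) \<le> A"
    proof (cases "0 \<le> 2 * s - 1")
      case True
      then have "y powr (2 * s - 1) \<le> (2 * z) powr (2 * s - 1)" using y y0 by (intro powr_mono2) auto
      then show ?thesis by (simp add: A_def add_increasing)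
    next
      case False
      then have "y powr (2 * s - 1) \<le> (z / 2) powr (2 * s - 1)" using y z by (intro powr_mono2') auto
      then show ?thesis by (simp add: A_def add_increasing2)
    qed
    have "(z / 2)\<^sup>2 \<le> y\<^sup>2" using y z by (intro power_mono) auto
    then have "4 / y\<^sup>2 \<le> 4 / (z / 2)\<^sup>2" using z y0 by (intro divide_left_mono) auto
    then have "4 / y\<^sup>2 \<le> 16 / z\<^sup>2" by (simp add: power_divide)
    then have "6 * max 1 (4 / y\<^sup>2) * frac_weight s t \<le> 6 * max 1 (16 / z\<^sup>2) * frac_weight s t"
      by (intro mult_right_mono mult_left_mono max.mono nn) auto
    with weight_bounds(2)[OF s y0, of t]
    have "\<bar>poisson_weight_deriv s y t\<bar> \<le> 6 * max 1 (16 / z\<^sup>2) * frac_weight s t" by linarith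
    then have "y powr (2 * s - 1) * \<bar>poisson_weight_deriv s y t\<bar> * norm (h t)
        \<le> A * (6 * max 1 (16 / z\<^sup>2) * frac_weight s t) * B"
      using A B nn by (intro mult_mono) (auto simp: A_def)
    then show "norm ((y powr (2 * s - 1) * poisson_weight_deriv s y t) *\<^sub>R h t) \<le> C * frac_weight s t"
      by (simp add: C_def abs_mult mult_ac)
  qed (use z integrable_frac_weight[OF s] in auto)
  then show ?thesis by (simp only: scaleR_scaleR[symmetric] integral_scaleR_right)
qed

text \<open>Substitute \<open>t = z\<^sup>2 r\<close>.\<close>

lemma integral_poisson_weight_eq:
  assumes z: "0 < z"
  shows "(LINT t|lborel. poisson_weight s z t) = (LINT t|lborel. poisson_weight s 1 t)"
proof -
  have z2: "z\<^sup>2 = z powr 2" using z by simp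
  have *: "z\<^sup>2 * poisson_weight s z (z\<^sup>2 * t) = poisson_weight s 1 t" for t
  proof (cases "0 < t")
    case True
    have "(z\<^sup>2 * t) powr (- s - 1) = z powr (2 * (- s - 1)) * t powr (- s - 1)"
      unfolding powr_mult z2 powr_powr ..
    moreover have "z\<^sup>2 * (z powr (2 * s) * z powr (2 * (- s - 1))) = 1"
      unfolding z2 powr_add[symmetric] using z by simp
    moreover have "z\<^sup>2 / (4 * (z\<^sup>2 * t)) = 1 / (4 * t)" using z by simp
    ultimately show ?thesis using True z
      by (simp add: poisson_weight_def mult_ac)
  next
    case False
    then show ?thesis using z by (simp add: poisson_weight_def zero_less_mult_iff)
  qed
  have "(LINT t|lborel. poisson_weight s z t) = z\<^sup>2 * (LINT t|lborel. poisson_weight s z (z\<^sup>2 * t))"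
    using lborel_integral_real_affine[of "z\<^sup>2" "poisson_weight s z" 0] z by simp
  also have "\<dots> = (LINT t|lborel. z\<^sup>2 * poisson_weight s z (z\<^sup>2 * t))"
    by (rule integral_mult_right_zero[symmetric])
  also have "\<dots> = (LINT t|lborel. poisson_weight s 1 t)" by (simp only: *)
  finally show ?thesis .
qed

text \<open>Differentiate the constant mass. Zero total mass is what permits u(x), constant in t, to
  be subtracted from P_t u(x).\<close>

lemma integral_poisson_weight_deriv:
  assumes s: "0 < s" "s < 1" and z: "0 < z"
  shows "(LINT t|lborel. poisson_weight_deriv s z t) = 0"
proof -
  have "((\<lambda>z. LINT t|lborel. poisson_weight s z t) has_vector_derivative
      z powr (2 * s - 1) * (LINT t|lborel. poisson_weight_deriv s z t)) (at z)"
    using integral_poisson_weight_has_derivative[OF s z, of "\<lambda>_. 1 :: real" 1] by simp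
  moreover have "((\<lambda>z. LINT t|lborel. poisson_weight s z t) has_vector_derivative 0) (at z)"
  proof (rule has_vector_derivative_transform_within_open[OF has_vector_derivative_const open_greaterThan[of 0]])
    show "(LINT t|lborel. poisson_weight s 1 t) = (LINT t|lborel. poisson_weight s y t)" if "y \<in> {0<..}" for y
      using that by (intro integral_poisson_weight_eq[symmetric]) simp
  qed (use z in simp)
  ultimately have "z powr (2 * s - 1) * (LINT t|lborel. poisson_weight_deriv s z t) = 0"
    by (rule vector_derivative_unique_at)
  then show ?thesis using z by simp
qed

text \<open>Dominated convergence with the majorant \<open>4 * D * frac_weight s\<close>,
  independent of \<open>z\<close>. Bounding \<open>F\<close> for t > 0 suffices since the weights
  vanish elsewhere.\<close>

lemma integral_poisson_weight_deriv_tendsto: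
  fixes F :: "real \<Rightarrow> 'b::{banach, second_countable_topology}"
  assumes s: "0 < s" "s < 1"
    and F [measurable]: "F \<in> borel_measurable borel" and D: "\<And>t. 0 < t \<Longrightarrow> norm (F t) \<le> D * min t 1"
  shows "((\<lambda>z. LINT t|lborel. poisson_weight_deriv s z t *\<^sub>R F t) \<longlongrightarrow>
    (2 * s) *\<^sub>R (LINT t:{0<..}|lborel. t powr (- s - 1) *\<^sub>R F t)) (at_right 0)"
  unfolding tendsto_at_iff_sequentially
proof (intro allI impI)
  fix Z :: "nat \<Rightarrow> real" assume Z: "\<forall>i. Z i \<in> {0<..} - {0}" "Z \<longlonglongrightarrow> 0"
  have "(\<lambda>i. LINT t|lborel. poisson_weight_deriv s (Z i) t *\<^sub>R F t)
      \<longlonglongrightarrow> (LINT t|lborel. (2 * s) *\<^sub>R (indicator {0<..} t *\<^sub>R (t powr (- s - 1) *\<^sub>R F t)))"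
  proof (rule integral_dominated_convergence[where w = "\<lambda>t. 4 * D * frac_weight s t"])
    show "integrable lborel (\<lambda>t. 4 * D * frac_weight s t)"
      by (intro integrable_mult_right integrable_frac_weight s)
    show "AE t in lborel. norm (poisson_weight_deriv s (Z i) t *\<^sub>R F t) \<le> 4 * D * frac_weight s t" for i
    proof (rule AE_I2)
      fix t
      have Zi: "0 < Z i" using Z(1) by auto
      show "norm (poisson_weight_deriv s (Z i) t *\<^sub>R F t) \<le> 4 * D * frac_weight s t"
      proof (cases "0 < t")
        case True
        have "\<bar>poisson_weight_deriv s (Z i) t\<bar> * norm (F t) \<le> 4 * (indicator {0<..} t * t powr (- s - 1)) * (D * min t 1)"
          using weight_bounds(3)[OF s Zi, of t] D[OF True] by (intro mult_mono) auto
        then show ?thesis using True by (simp add: frac_weight_def mult_ac)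
      qed (simp add: poisson_weight_deriv_def frac_weight_def)
    qed
    show "AE t in lborel. (\<lambda>i. poisson_weight_deriv s (Z i) t *\<^sub>R F t)
        \<longlonglongrightarrow> (2 * s) *\<^sub>R (indicator {0<..} t *\<^sub>R (t powr (- s - 1) *\<^sub>R F t))"
    proof (rule AE_I2)
      fix t :: real
      show "(\<lambda>i. poisson_weight_deriv s (Z i) t *\<^sub>R F t)
        \<longlonglongrightarrow> (2 * s) *\<^sub>R (indicator {0<..} t *\<^sub>R (t powr (- s - 1) *\<^sub>R F t))"
      proof (cases "0 < t")
        case True
        then have "(\<lambda>i. ((2 * s - (Z i)\<^sup>2 / (2 * t)) * exp (- (Z i)\<^sup>2 / (4 * t)) * t powr (- s - 1)) *\<^sub>R F t)
            \<longlonglongrightarrow> ((2 * s - 0\<^sup>2 / (2 * t)) * exp (- 0\<^sup>2 / (4 * t)) * t powr (- s - 1)) *\<^sub>R F t"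
          using Z(2) by (intro tendsto_intros) auto
        then show ?thesis using True by (simp add: poisson_weight_deriv_def)
      qed (simp add: poisson_weight_deriv_def)
    qed
  qed measurable
  then show "((\<lambda>z. LINT t|lborel. poisson_weight_deriv s z t *\<^sub>R F t) \<circ> Z)
      \<longlonglongrightarrow> (2 * s) *\<^sub>R (LINT t:{0<..}|lborel. t powr (- s - 1) *\<^sub>R F t)"
    unfolding o_def set_lebesgue_integral_def integral_scaleR_right .
qed

section \<open>The heat kernel and the Poisson integral\<close>

lemma heat_kernel_pos: "heat_fundamental_solution X p \<Longrightarrow> 0 < t \<Longrightarrow> 0 < p x y t"
  and heat_kernel_eq_0: "heat_fundamental_solution X p \<Longrightarrow> t \<le> 0 \<Longrightarrow> p x y t = 0"
  using heat_fundamental_solution_def[THEN iffD1, THEN conjunct1, THEN spec, THEN spec, THEN spec] by blast+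

lemma heat_kernel_nonneg: "heat_fundamental_solution X p \<Longrightarrow> 0 \<le> p x y t"
  using heat_kernel_pos[of X p t x y] heat_kernel_eq_0[of X p t x y] by (cases "0 < t") auto

text \<open>The pole (y, 0) lies outside the half-space t > 0, so smoothness off the pole applies
  there for every y.\<close>

lemma heat_kernel_continuous:
  assumes "heat_fundamental_solution X p"
  shows "continuous_on {z. 0 < snd z} (\<lambda>z. p (fst z) y (snd z))"
proof -
  have "smooth_on (- {(y, 0)}) (\<lambda>(x, t). p x y (t - 0))"
    using assms[unfolded heat_fundamental_solution_def, THEN conjunct2, THEN conjunct1, rule_format, of y 0] .
  then have "C_k_on 0 (- {(y, 0)}) (\<lambda>(x, t). p x y (t - 0))"
    unfolding smooth_on_def by (rule spec)
  then have "continuous_on (- {(y, 0)}) (\<lambda>z. p (fst z) y (snd z))"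
    by (simp add: case_prod_beta)
  then show ?thesis by (rule continuous_on_subset) auto
qed

text \<open>A non-integrable function has integral 0 by default, contradicting unit mass.
  Measurability of the kernel in the pole is obtained here.\<close>

lemma integrable_heat_kernel:
  fixes p :: "'a::euclidean_space \<Rightarrow> 'a \<Rightarrow> real \<Rightarrow> real"
  assumes "(LINT y|lborel. p x y t) = 1" shows "integrable lborel (\<lambda>y. p x y t)"
  by (rule ccontr) (use assms in \<open>simp add: not_integrable_integral_eq\<close>)

text \<open>The zero extension to t <= 0 is exactly the default branch of
  \<open>measurable_Caratheodory\<close>.\<close>

lemma heat_kernel_measurable:
  fixes p :: "real ^ 'n::finite \<Rightarrow> real ^ 'n \<Rightarrow> real \<Rightarrow> real"
  assumes fs: "heat_fundamental_solution X p" and mass: "\<And>x t. 0 < t \<Longrightarrow> (LINT y|lborel. p x y t) = 1"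
  shows "(\<lambda>(z, y). p (fst z) y (snd z)) \<in> borel_measurable (borel \<Otimes>\<^sub>M borel)"
proof -
  let ?S = "{z :: (real ^ 'n) \<times> real. 0 < snd z}"
  have "(\<lambda>(z, y). if z \<in> ?S then p (fst z) y (snd z) else 0) \<in> borel_measurable (borel \<Otimes>\<^sub>M borel)"
  proof (rule measurable_Caratheodory)
    show "open ?S" by (intro open_Collect_less continuous_intros)
    show "continuous_on ?S (\<lambda>z. p (fst z) y (snd z))" for y by (rule heat_kernel_continuous[OF fs])
    show "(\<lambda>y. p (fst z) y (snd z)) \<in> borel_measurable borel" if "z \<in> ?S" for z
    proof -
      have "integrable lborel (\<lambda>y. p (fst z) y (snd z))"
        by (rule integrable_heat_kernel) (use that mass in simp)
      then show ?thesis by simp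
    qed
  qed
  also have "(\<lambda>(z, y). if z \<in> ?S then p (fst z) y (snd z) else 0) = (\<lambda>(z, y). p (fst z) y (snd z))"
    using heat_kernel_eq_0[OF fs] by (auto simp: fun_eq_iff)
  finally show ?thesis .
qed

context
  fixes X :: "'m::finite \<Rightarrow> real ^ 'n::finite \<Rightarrow> real ^ 'n"
    and p :: "real ^ 'n \<Rightarrow> real ^ 'n \<Rightarrow> real \<Rightarrow> real"
    and u :: "real ^ 'n \<Rightarrow> complex" and B :: real
  assumes fs: "heat_fundamental_solution X p"
    and mass: "\<And>x t. 0 < t \<Longrightarrow> (LINT y|lborel. p x y t) = 1"
    and u [measurable]: "u \<in> borel_measurable borel" and B: "\<And>y. norm (u y) \<le> B"
begin

text \<open>Arbitrary functions are substituted so that it can serve as a raw rule for automated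
  measurability proofs.\<close>

lemma kernel_measurable:
  assumes "f \<in> borel_measurable N" "g \<in> borel_measurable N" "h \<in> borel_measurable N"
  shows "(\<lambda>w. p (f w) (g w) (h w)) \<in> borel_measurable N"
proof -
  have "(\<lambda>w. ((f w, h w), g w)) \<in> measurable N (borel \<Otimes>\<^sub>M borel)"
    by (intro measurable_Pair borel_measurable_Pair assms)
  from measurable_compose[OF this heat_kernel_measurable[OF fs mass]] show ?thesis by simp
qed

lemma heat_op_measurable: "(\<lambda>(t, x). heat_op p t u x) \<in> borel_measurable (borel \<Otimes>\<^sub>M borel)"
proof -
  note [measurable (raw)] = kernel_measurable
  show ?thesis unfolding heat_op_def by measurable
qed

lemma heat_op_eq_0: "t \<le> 0 \<Longrightarrow> heat_op p t u x = 0"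
  by (simp add: heat_op_def heat_kernel_eq_0[OF fs])

lemma nn_integral_heat_kernel_le: "(\<integral>\<^sup>+y. ennreal (p x y t * norm (u y)) \<partial>lborel) \<le> ennreal B"
proof (cases "0 < t")
  case True
  note [measurable (raw)] = kernel_measurable
  have B0: "0 \<le> B" using B order_trans[OF norm_ge_zero] by blast
  have "(\<integral>\<^sup>+y. ennreal (p x y t * norm (u y)) \<partial>lborel) \<le> (\<integral>\<^sup>+y. ennreal (p x y t) * ennreal B \<partial>lborel)"
    using heat_kernel_nonneg[OF fs] B B0
    by (intro nn_integral_mono) (simp add: ennreal_mult[symmetric] mult_left_mono ennreal_leI)
  also have "\<dots> = (\<integral>\<^sup>+y. ennreal (p x y t) \<partial>lborel) * ennreal B"
    by (rule nn_integral_multc) measurable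
  also have "(\<integral>\<^sup>+y. ennreal (p x y t) \<partial>lborel) = 1"
    using nn_integral_eq_integral[OF integrable_heat_kernel[of p x t]] mass[OF True] heat_kernel_nonneg[OF fs]
    by simp
  finally show ?thesis by simp
qed (simp add: heat_kernel_eq_0[OF fs])

lemma norm_heat_op_le: "norm (heat_op p t u x) \<le> B"
proof -
  have B0: "0 \<le> B" using B order_trans[OF norm_ge_zero] by blast
  have "ennreal (norm (heat_op p t u x)) \<le> (\<integral>\<^sup>+y. ennreal (norm (p x y t *\<^sub>R u y)) \<partial>lborel)"
    unfolding heat_op_def by (rule norm_integral_le_nn_integral)
  also have "\<dots> = (\<integral>\<^sup>+y. ennreal (p x y t * norm (u y)) \<partial>lborel)"
    by (simp add: heat_kernel_nonneg[OF fs])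
  also have "\<dots> \<le> ennreal B" by (rule nn_integral_heat_kernel_le)
  finally show ?thesis using B0 by simp
qed

text \<open>\<open>heat_semigroup\<close> acts on an arbitrary representative; integration in y does
  not see the choice, so the two functions agree at every x.\<close>

lemma heat_semigroup_to_L2:
  assumes "square_integrable u" "0 < t"
  shows "heat_semigroup p t (to_L2 u) = to_L2 (heat_op p t u)"
proof -
  note [measurable (raw)] = kernel_measurable
  note [measurable] = square_integrable_measurable[OF square_integrable_L2_fun]
  have "heat_op p t (L2_fun (to_L2 u)) = heat_op p t u"
    unfolding heat_op_def
  proof (rule ext, rule integral_cong_AE)
    show "AE y in lborel. p x y t *\<^sub>R L2_fun (to_L2 u) y = p x y t *\<^sub>R u y" for x
      using L2_fun_to_L2[OF assms(1)] by eventually_elim simp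
  qed measurable
  then show ?thesis using assms(2) by (simp add: heat_semigroup_def)
qed

lemma poisson_integral_eq:
  assumes s: "0 < s" "s < 1" and z: "0 < z"
  shows "(LINT y|lborel. poisson_kernel p (1 - 2 * s) z x y *\<^sub>R u y) =
    (1 / (2 powr (2 * s) * Gamma s)) *\<^sub>R (LINT t|lborel. poisson_weight s z t *\<^sub>R heat_op p t u x)"
proof -
  note [measurable (raw)] = kernel_measurable
  define C where "C = 1 / (2 powr (2 * s) * Gamma s)"
  let ?k = "poisson_weight s z"
  have kernel: "poisson_kernel p (1 - 2 * s) z x y = C * (LINT t|lborel. ?k t * p x y t)" for y
  proof -
    have "?k t * p x y t = z powr (2 * s) *
        (indicator {0<..} t *\<^sub>R (exp (- z\<^sup>2 / (4 * t)) / t powr (1 + s) * p x y t))" for t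
    proof -
      have "- s - 1 = - (1 + s)" by simp
      then have "t powr (- s - 1) = inverse (t powr (1 + s))" by (simp only: powr_minus)
      then show ?thesis
        unfolding poisson_weight_def divide_inverse real_scaleR_def by (simp only: mult_ac)
    qed
    then have "(LINT t|lborel. ?k t * p x y t) = z powr (2 * s) *
        (LINT t:{0<..}|lborel. exp (- z\<^sup>2 / (4 * t)) / t powr (1 + s) * p x y t)"
      by (simp only: set_lebesgue_integral_def integral_mult_right_zero)
    moreover have "(3 - (1 - 2 * s)) / 2 = 1 + s" "(1 - (1 - 2 * s)) / 2 = s" "1 - (1 - 2 * s) = 2 * s"
      by simp_all
    ultimately show ?thesis by (simp only: poisson_kernel_def C_def mult.assoc)
  qed
  \<comment> \<open>Written as a complex product, the constant \<open>u y\<close> leaves the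
    integral without any check of integrability in t for individual y.\<close>
  have pull: "(LINT t|lborel. ?k t * p x y t) *\<^sub>R u y = (LINT t|lborel. (?k t * p x y t) *\<^sub>R u y)" for y
    unfolding scaleR_conv_of_real integral_mult_left_zero integral_complex_of_real ..
  \<comment> \<open>Integrate in y first: unit mass of the kernel bounds the inner integral by
    \<open>B\<close>, leaving only the integrable weight in t.\<close>
  have int: "integrable (lborel \<Otimes>\<^sub>M lborel) (\<lambda>(t, y). (?k t * p x y t) *\<^sub>R u y)"
  proof (rule integrableI_bounded)
    have "(\<integral>\<^sup>+w. ennreal (norm (case w of (t, y) \<Rightarrow> (?k t * p x y t) *\<^sub>R u y)) \<partial>(lborel \<Otimes>\<^sub>M lborel))
        = (\<integral>\<^sup>+t. (\<integral>\<^sup>+y. ennreal (norm ((?k t * p x y t) *\<^sub>R u y)) \<partial>lborel) \<partial>lborel)"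
      by (subst lborel.nn_integral_fst[symmetric]) auto
    also have "\<dots> = (\<integral>\<^sup>+t. ennreal \<bar>?k t\<bar> * (\<integral>\<^sup>+y. ennreal (p x y t * norm (u y)) \<partial>lborel) \<partial>lborel)"
    proof (rule nn_integral_cong)
      fix t
      have "norm ((?k t * p x y t) *\<^sub>R u y) = \<bar>?k t\<bar> * (p x y t * norm (u y))" for y
        using heat_kernel_nonneg[OF fs, of x y t] by (simp add: abs_mult)
      then have "ennreal (norm ((?k t * p x y t) *\<^sub>R u y)) = ennreal \<bar>?k t\<bar> * ennreal (p x y t * norm (u y))" for y
        by (simp only: ennreal_mult'[OF abs_ge_zero])
      then have "(\<integral>\<^sup>+y. ennreal (norm ((?k t * p x y t) *\<^sub>R u y)) \<partial>lborel)
          = (\<integral>\<^sup>+y. ennreal \<bar>?k t\<bar> * ennreal (p x y t * norm (u y)) \<partial>lborel)"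
        by (simp only:)
      also have "\<dots> = ennreal \<bar>?k t\<bar> * (\<integral>\<^sup>+y. ennreal (p x y t * norm (u y)) \<partial>lborel)"
        by (rule nn_integral_cmult) measurable
      finally show "(\<integral>\<^sup>+y. ennreal (norm ((?k t * p x y t) *\<^sub>R u y)) \<partial>lborel)
          = ennreal \<bar>?k t\<bar> * (\<integral>\<^sup>+y. ennreal (p x y t * norm (u y)) \<partial>lborel)" .
    qed
    also have "\<dots> \<le> (\<integral>\<^sup>+t. ennreal \<bar>?k t\<bar> * ennreal B \<partial>lborel)"
      by (intro nn_integral_mono mult_left_mono nn_integral_heat_kernel_le) simp
    also have "\<dots> = (\<integral>\<^sup>+t. ennreal \<bar>?k t\<bar> \<partial>lborel) * ennreal B"
      by (rule nn_integral_multc) measurable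
    also have "\<dots> < \<infinity>"
      using integrable_poisson_weight[OF s z] by (simp add: integrable_iff_bounded ennreal_mult_less_top)
    finally show "(\<integral>\<^sup>+w. ennreal (norm (case w of (t, y) \<Rightarrow> (?k t * p x y t) *\<^sub>R u y)) \<partial>(lborel \<Otimes>\<^sub>M lborel)) < \<infinity>" .
  qed measurable
  have "(LINT y|lborel. poisson_kernel p (1 - 2 * s) z x y *\<^sub>R u y)
      = C *\<^sub>R (LINT y|lborel. LINT t|lborel. (?k t * p x y t) *\<^sub>R u y)"
    by (simp only: kernel scaleR_scaleR[symmetric] pull integral_scaleR_right)
  also have "(LINT y|lborel. LINT t|lborel. (?k t * p x y t) *\<^sub>R u y)
      = (LINT t|lborel. LINT y|lborel. (?k t * p x y t) *\<^sub>R u y)"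
    by (rule lborel_pair.Fubini_integral[OF int])
  also have "\<dots> = (LINT t|lborel. ?k t *\<^sub>R heat_op p t u x)"
    by (simp only: heat_op_def scaleR_scaleR[symmetric] integral_scaleR_right)
  finally show ?thesis by (simp only: C_def)
qed

end

text \<open>The factors on the left are the constant of the theorem, the normalisation of the
  Poisson kernel, and the limit 2 s of the scalar factor of the weight. Since 2 powr (- a) = 2 powr
  (2 s) / 2, all but s / Gamma(1 - s) cancels.\<close>

lemma poisson_constant:
  assumes s: "0 < s" "s < (1::real)" and a: "a = 1 - 2 * s"
  shows "2 powr (- a) * Gamma ((1 - a) / 2) / Gamma ((1 + a) / 2) * (1 / (2 powr (2 * s) * Gamma s)) * (2 * s)
    = s / Gamma (1 - s)"
proof -
  have 1: "(1 - a) / 2 = s" "(1 + a) / 2 = 1 - s" and 2: "(2::real) powr (- a) = 2 powr (2 * s) / 2"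
    by (simp_all add: a powr_diff)
  have "Gamma s > 0" using s by (intro Gamma_real_pos)
  then show ?thesis unfolding 1 2 by simp
qed

theorem proposition10p8:
  fixes X :: "'m::finite \<Rightarrow> real ^ 'n \<Rightarrow> real ^ 'n"
    and p :: "real ^ 'n \<Rightarrow> real ^ 'n \<Rightarrow> real \<Rightarrow> real"
    and u :: "real ^ 'n \<Rightarrow> complex"
    and U :: "real ^ 'n \<Rightarrow> real \<Rightarrow> complex"
    and s a :: real
  assumes dim: "CARD('n) \<ge> 3"
    and smooth: "\<And>i. smooth_on UNIV (X i)"
    and hormander: "hormander_condition X"
    and laplacian_outside: "\<exists>K. compact K \<and>
      (\<forall>(f :: real ^ 'n \<Rightarrow> complex) x. smooth_on UNIV f \<longrightarrow> x \<notin> K \<longrightarrow> sub_laplacian X f x = laplacian f x)"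
    and fundamental_solution: "heat_fundamental_solution X p"
    and bounds: "heat_kernel_bounds X p"
    and mass: "\<And>x t. 0 < t \<Longrightarrow> (LINT y|lborel. p x y t) = 1"
    and semigroup: "heat_semigroup_facts X p"
    and s: "0 < s" "s < 1"
    and a: "a = 1 - 2 * s"
    and u: "schwartz u"
    and U: "\<And>x z. 0 < z \<Longrightarrow> U x z = (LINT y|lborel. poisson_kernel p a z x y *\<^sub>R u y)"
  shows "(\<forall>x. \<forall>z>0. (\<lambda>r. U x r) differentiable (at z)) \<and>
    (\<exists>L. tendsto_L2 (\<lambda>z x. z powr a *\<^sub>R vector_derivative (\<lambda>r. U x r) (at z)) L (at_right 0) \<and>
      - (2 powr (- a) * Gamma ((1 - a) / 2) / Gamma ((1 + a) / 2)) *\<^sub>R L = frac_sub_laplacian p s u)"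
proof -
  have sq_u: "square_integrable u" by (rule schwartz_square_integrable[OF u])
  have um [measurable]: "u \<in> borel_measurable borel" using sq_u by (rule square_integrable_measurable)
  obtain B where B: "\<And>y. norm (u y) \<le> B"
    using schwartz_decreasing[OF u, of 0 "[]"] by (auto simp: bounded_iff)
  note ctx = fundamental_solution mass um B
  note [measurable] = heat_op_measurable[OF ctx]
  note semigroup_facts = semigroup[unfolded heat_semigroup_facts_def]
  have P: "contraction_semigroup (heat_semigroup p)"
    by (rule semigroup_facts[THEN conjunct2, THEN conjunct1])
  have sq_op: "square_integrable (heat_op p t u)" if "0 < t" for t
    by (rule semigroup_facts[THEN conjunct1, rule_format, OF that sq_u])

  define C where "C = 1 / (2 powr (2 * s) * Gamma s)"
  define f where "f t x = heat_op p t u x - u x" for t x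
  define F where "F t = to_L2 (f t)" for t
  let ?d = "poisson_weight_deriv s"

  have F_pos: "F t = heat_semigroup p t (to_L2 u) - to_L2 u" if "0 < t" for t
    unfolding F_def f_def[abs_def] to_L2_diff[OF sq_op[OF that] sq_u]
    by (simp only: heat_semigroup_to_L2[OF ctx sq_u that])
  \<comment> \<open>The lemmas on integrals of families quantify over all real t. Where t <= 0 the
    kernel is 0, so \<open>f t\<close> is - u, still square integrable, and the weights
    vanish.\<close>
  have f_neg: "f t = (\<lambda>x. 0 - u x)" if "t \<le> 0" for t
    using heat_op_eq_0[OF ctx that] by (simp add: f_def[abs_def])
  have F_neg: "F t = - to_L2 u" if "t \<le> 0" for t
    unfolding F_def f_neg[OF that] to_L2_diff[OF square_integrable_zero sq_u] by (simp add: to_L2_zero)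
  have f_sq: "square_integrable (f t)" for t
  proof (cases "0 < t")
    case True
    then show ?thesis unfolding f_def[abs_def] by (intro square_integrable_diff sq_op sq_u)
  next
    case False
    then have "f t = (\<lambda>x. 0 - u x)" by (intro f_neg) simp
    then show ?thesis using square_integrable_diff[OF square_integrable_zero sq_u] by simp
  qed
  have f_meas: "(\<lambda>(t, x). f t x) \<in> borel_measurable (lborel \<Otimes>\<^sub>M borel)"
    unfolding f_def by measurable
  have F_bound: "norm (F t) \<le> 2 * norm (to_L2 u)" for t
  proof (cases "0 < t")
    case True
    then have "norm (F t) \<le> norm (heat_semigroup p t (to_L2 u)) + norm (to_L2 u)"
      unfolding F_pos[OF True] by (intro norm_triangle_ineq4)
    then show ?thesis using contraction_semigroupD(4)[OF P, of t "to_L2 u"] True by simp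
  next
    case False
    then show ?thesis by (simp add: F_neg)
  qed
  \<comment> \<open>Continuity of the orbit for t > 0 is glued to the constant value - u for t <=
    0.\<close>
  have F_meas [measurable]: "F \<in> borel_measurable borel"
  proof -
    have "continuous_on {0<..} (\<lambda>t. heat_semigroup p t (to_L2 u) - to_L2 u)"
      by (intro continuous_on_diff continuous_on_const
          continuous_on_subset[OF contraction_semigroup_continuous[OF P]]) auto
    then have "(\<lambda>t. if t \<in> {0<..} then heat_semigroup p t (to_L2 u) - to_L2 u else - to_L2 u) \<in> borel_measurable borel"
      by (intro borel_measurable_continuous_on_if continuous_on_const) auto
    also have "(\<lambda>t. if t \<in> {0<..} then heat_semigroup p t (to_L2 u) - to_L2 u else - to_L2 u) = F"
      by (rule ext) (simp add: F_pos F_neg)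
    finally show ?thesis .
  qed

  have der: "((\<lambda>r. U x r) has_vector_derivative
      C *\<^sub>R (z powr (2 * s - 1) *\<^sub>R (LINT t|lborel. ?d z t *\<^sub>R f t x))) (at z)" if z: "0 < z" for x z
  proof -
    have hm [measurable]: "(\<lambda>t. heat_op p t u x) \<in> borel_measurable borel" by measurable
    have dint: "integrable lborel (\<lambda>t. ?d z t *\<^sub>R h t)"
      if "h \<in> borel_measurable borel" "\<And>t. norm (h t) \<le> B" for h :: "real \<Rightarrow> complex"
    proof (rule Bochner_Integration.integrable_bound)
      show "integrable lborel (\<lambda>t. ?d z t * B)"
        by (intro integrable_mult_left integrable_poisson_weight_deriv s z)
      show "AE t in lborel. norm (?d z t *\<^sub>R h t) \<le> norm (?d z t * B)"
      proof (rule AE_I2)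
        fix t
        have "norm (h t) \<le> \<bar>B\<bar>" using that(2)[of t] by simp
        then show "norm (?d z t *\<^sub>R h t) \<le> norm (?d z t * B)"
          by (simp add: abs_mult mult_left_mono)
      qed
    qed (use that(1) in measurable)
    \<comment> \<open>At fixed x the zero mass of the differentiated weight replaces P_t u(x) by P_t
      u(x) - u(x), without using any decay of that difference in t.\<close>
    have "(LINT t|lborel. ?d z t *\<^sub>R u x) = (LINT t|lborel. ?d z t) *\<^sub>R u x"
      by (intro integral_scaleR_left integrable_poisson_weight_deriv s z)
    then have zero: "(LINT t|lborel. ?d z t *\<^sub>R u x) = 0"
      by (simp add: integral_poisson_weight_deriv[OF s z])
    have "(LINT t|lborel. ?d z t *\<^sub>R f t x)
        = (LINT t|lborel. ?d z t *\<^sub>R heat_op p t u x) - (LINT t|lborel. ?d z t *\<^sub>R u x)"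
      unfolding f_def scaleR_diff_right
      by (intro Bochner_Integration.integral_diff dint hm borel_measurable_const norm_heat_op_le[OF ctx] B)
    then have eq: "(LINT t|lborel. ?d z t *\<^sub>R f t x) = (LINT t|lborel. ?d z t *\<^sub>R heat_op p t u x)"
      by (simp add: zero)
    have "((\<lambda>r. LINT t|lborel. poisson_weight s r t *\<^sub>R heat_op p t u x) has_vector_derivative
        z powr (2 * s - 1) *\<^sub>R (LINT t|lborel. ?d z t *\<^sub>R f t x)) (at z)"
      unfolding eq by (rule integral_poisson_weight_has_derivative[OF s z hm norm_heat_op_le[OF ctx]])
    from bounded_linear.has_vector_derivative[OF bounded_linear_scaleR_right this, of C]
    show ?thesis
    proof (rule has_vector_derivative_transform_within_open[OF _ open_greaterThan[of 0]])
      show "C *\<^sub>R (LINT t|lborel. poisson_weight s r t *\<^sub>R heat_op p t u x) = U x r" if "r \<in> {0<..}" for r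
        using poisson_integral_eq[OF ctx s, of r x] U[of r x] that by (simp add: C_def a)
    qed (use z in simp)
  qed

  define V where "V z x = z powr a *\<^sub>R vector_derivative (\<lambda>r. U x r) (at z)" for z x
  have V: "V z = (\<lambda>x. C *\<^sub>R (LINT t|lborel. ?d z t *\<^sub>R f t x))" if z: "0 < z" for z
  proof
    fix x
    have "z powr a * z powr (2 * s - 1) = 1" using z by (simp add: a powr_add[symmetric])
    then have "z powr a *\<^sub>R (C *\<^sub>R (z powr (2 * s - 1) *\<^sub>R v)) = C *\<^sub>R v" for v :: complex
      by (simp add: mult.left_commute[of "z powr a"])
    then show "V z x = C *\<^sub>R (LINT t|lborel. ?d z t *\<^sub>R f t x)"
      by (simp only: V_def vector_derivative_at[OF der[OF z]])
  qed
  have FL: "\<And>t. norm (to_L2 (f t)) \<le> 2 * norm (to_L2 u)" "(\<lambda>t. to_L2 (f t)) \<in> borel_measurable lborel"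
    using F_bound F_meas by (simp_all add: F_def[abs_def])
  \<comment> \<open>The passage from functions to classes: the integral taken at each x becomes a
    Bochner integral of \<open>F\<close>, to which the estimate in norm applies.\<close>
  have V_sq: "square_integrable (V z)" and V_L2: "to_L2 (V z) = C *\<^sub>R (LINT t|lborel. ?d z t *\<^sub>R F t)" if z: "0 < z" for z
  proof -
    note facts = lborel.sigma_finite_measure_axioms integrable_poisson_weight_deriv[OF s z] f_meas f_sq FL
    note sq = square_integrable_integral[OF facts]
    show "square_integrable (V z)" unfolding V[OF z] by (rule square_integrable_scaleR[OF sq])
    show "to_L2 (V z) = C *\<^sub>R (LINT t|lborel. ?d z t *\<^sub>R F t)"
      unfolding V[OF z] to_L2_scaleR[OF sq] to_L2_integral[OF facts] F_def ..
  qed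

  obtain K where K: "compact K"
    and lap: "\<forall>(f :: real ^ 'n \<Rightarrow> complex) x. smooth_on UNIV f \<longrightarrow> x \<notin> K \<longrightarrow> sub_laplacian X f x = laplacian f x"
    using laplacian_outside by (elim exE conjE)
  have "square_integrable (sub_laplacian X u)"
    by (rule square_integrable_sub_laplacian_schwartz[OF smooth u K]) (rule lap[rule_format, OF schwartz_smooth[OF u]])
  then have gen: "generator_rel (heat_semigroup p) (to_L2 u) (to_L2 (sub_laplacian X u))"
    by (rule generator_schwartz[OF smooth u _ semigroup])
  obtain D where D: "\<forall>t\<ge>0. norm (heat_semigroup p t (to_L2 u) - to_L2 u) \<le> D * min t 1"
    by (rule semigroup_increment_bound[OF P gen])
  have F_small: "norm (F t) \<le> D * min t 1" if "0 < t" for t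
    unfolding F_pos[OF that] using D that by simp

  define I where "I = (LINT t:{0<..}|lborel. t powr (- s - 1) *\<^sub>R F t)"
  have lim: "((\<lambda>z. C *\<^sub>R (LINT t|lborel. ?d z t *\<^sub>R F t)) \<longlongrightarrow> C *\<^sub>R ((2 * s) *\<^sub>R I)) (at_right 0)"
    unfolding I_def
    by (intro tendsto_scaleR tendsto_const integral_poisson_weight_deriv_tendsto[OF s F_meas F_small])
  have ev: "\<forall>\<^sub>F z in at_right 0. (0::real) < z" by (rule eventually_at_right_less)
  have "((\<lambda>z. to_L2 (V z)) \<longlongrightarrow> C *\<^sub>R ((2 * s) *\<^sub>R I)) (at_right 0)"
    by (rule Lim_transform_eventually[OF lim]) (rule eventually_mono[OF ev], simp add: V_L2)
  moreover have "\<forall>\<^sub>F z in at_right 0. square_integrable (V z)"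
    by (rule eventually_mono[OF ev V_sq])
  ultimately have "tendsto_L2 V (C *\<^sub>R ((2 * s) *\<^sub>R I)) (at_right 0)"
    by (simp only: tendsto_L2_def)
  moreover have "- (2 powr (- a) * Gamma ((1 - a) / 2) / Gamma ((1 + a) / 2)) *\<^sub>R (C *\<^sub>R ((2 * s) *\<^sub>R I))
      = frac_sub_laplacian p s u"
  proof -
    have "I = (LINT t:{0<..}|lborel. t powr (- s - 1) *\<^sub>R (heat_semigroup p t (to_L2 u) - to_L2 u))"
      unfolding I_def by (rule set_lebesgue_integral_cong) (simp_all add: F_pos)
    then have "frac_sub_laplacian p s u = - (s / Gamma (1 - s)) *\<^sub>R I"
      by (simp only: frac_sub_laplacian_def)
    moreover define A where "A = 2 powr (- a) * Gamma ((1 - a) / 2) / Gamma ((1 + a) / 2)"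
    moreover have "A * C * (2 * s) = s / Gamma (1 - s)"
      unfolding A_def C_def by (rule poisson_constant[OF s a])
    then have "- A *\<^sub>R (C *\<^sub>R ((2 * s) *\<^sub>R I)) = - (s / Gamma (1 - s)) *\<^sub>R I"
      unfolding scaleR_scaleR by (simp only: mult_minus_left mult.assoc)
    ultimately show ?thesis by (simp only:)
  qed
  moreover have "(\<lambda>r. U x r) differentiable (at z)" if "0 < z" for x z
    using der[OF that] by (rule differentiableI_vector)
  ultimately show ?thesis
    unfolding V_def[abs_def] by (intro conjI allI impI exI[of _ "C *\<^sub>R ((2 * s) *\<^sub>R I)"])
qed

end
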